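(* Let $\Omega\subset\mathbb{R}^n$ be a bounded domain with $C^{1,\varepsilon}$ boundary, let $1<p<\infty$ and $p>n$. For each $m>0$ let $x_m\in\partial\Omega$ be a point such that $$\lambda(m,\Omega)=\ell_1(m\,\delta_{x_m},\Omega).$$ Then any convergent subsequence of $x_m$ tends, as $m\to\infty$, to a point of minimum of the function $x\mapsto\lambda_1(x;\Omega)$ on $\partial\Omega$. That is, if $m_k\to\infty$ and $x_{m_k}\to\bar x\in\partial\Omega$, then $\lambda_1(\bar x;\Omega)=\min_{x\in\partial\Omega}\lambda_1(x;\Omega)$.
   Context: $\mathcal H^{n-1}$ is the $(n-1)$-dimensional Hausdorff measure and $\delta_x$ is the unit Dirac measure at $x$. For $m>0$ put $$\Sigma_m(\partial\Omega)=\Big\{\sigma\in L^1(\partial\Omega):\ \sigma\ge0,\ \int_{\partial\Omega}\sigma\,d\mathcal H^{n-1}=m\Big\},$$ and for $\sigma\in\Sigma_m(\partial\Omega)$ $$\ell_1(\sigma,\Omega)=\inf_{u\in W^{1,p}(\Omega),\,u\neq0}\frac{\int_\Omega|\nabla u|^p\,dx+\int_{\partial\Omega}\sigma|u|^p\,d\mathcal H^{n-1}}{\int_\Omega|u|^p\,dx},\qquad \lambda(m,\Omega)=\inf_{\sigma\in\Sigma_m(\partial\Omega)}\ell_1(\sigma,\Omega).$$ Since $p>n$, every $u\in W^{1,p}(\Omega)$ is identified with its representative that is continuous on $\overline\Omega$. For $x\in\partial\Omega$, $$\ell_1(m\,\delta_x,\Omega)=\inf_{u\in W^{1,p}(\Omega),\,u\ne0}\frac{\int_\Omega|\nabla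 u|^p\,dx+m|u(x)|^p}{\int_\Omega|u|^p\,dx}.$$ It is a theorem that for $p>n$ and each $m>0$ there exists at least one point $x_m\in\partial\Omega$ with $\lambda(m,\Omega)=\ell_1(m\,\delta_{x_m},\Omega)=\inf_{x\in\partial\Omega}\ell_1(m\,\delta_x,\Omega)$. For $x\in\partial\Omega$, $$\lambda_1(x;\Omega)=\inf\left\{\frac{\|\nabla u\|_{L^p(\Omega)}^p}{\|u\|_{L^p(\Omega)}^p}:\ u\in W^{1,p}(\Omega),\ u\neq0,\ u(x)=0\right\},$$ which is a continuous function of $x\in\partial\Omega$ and hence attains its minimum there. *)

theory Defs
  imports "HOL-Analysis.Analysis"
begin

text \<open>The case distinction matters only for \<open>d = 0\<close>, where \<open>0 ^ 0 = 1\<close>: a nonempty set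
  then has weight 1 (so that the 0-dimensional measure is the counting measure) and the empty set
  weight 0.  The constant is the usual one, for which the measure of dimension \<open>DIM('a)\<close> is
  Lebesgue measure.\<close>

definition hausdorff_weight :: "nat \<Rightarrow> 'a::metric_space set \<Rightarrow> real" where
  "hausdorff_weight d C =
     (if C = {} then 0 else unit_ball_vol (real d) * (diameter C / 2) ^ d)"

definition hausdorff_pre :: "nat \<Rightarrow> real \<Rightarrow> 'a::metric_space set \<Rightarrow> ennreal" where
  "hausdorff_pre d \<delta> A =
     (INF C \<in> {C :: nat \<Rightarrow> 'a set. (\<forall>i. bounded (C i) \<and> diameter (C i) \<le> \<delta>) \<and> A \<subseteq> (\<Union>i. C i)}.
        \<Sum>i. ennreal (hausdorff_weight d (C i)))"

definition hausdorff_outer :: "nat \<Rightarrow> 'a::metric_space set \<Rightarrow> ennreal" where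
  "hausdorff_outer d A = (SUP \<delta> \<in> {0<..}. hausdorff_pre d \<delta> A)"

text \<open>The outer measure is a metric outer measure, hence countably additive on Borel sets, so that
  \<^const>\<open>measure_of\<close> does not fall back to the zero measure here.\<close>

definition hausdorff_measure :: "nat \<Rightarrow> 'a::metric_space measure" where
  "hausdorff_measure d = measure_of UNIV (sets borel) (hausdorff_outer d)"

definition boundary_measure :: "'a::euclidean_space set \<Rightarrow> 'a measure" where
  "boundary_measure \<Omega> = restrict_space (hausdorff_measure (DIM('a) - 1)) (frontier \<Omega>)"

text \<open>Near every boundary point, \<open>\<Omega>\<close> is the region above the graph, in direction \<open>e\<close>, of a
  function of class \<open>C\<^sup>1\<close> with \<open>\<epsilon>\<close>-Hoelder gradient on the hyperplane orthogonal to \<open>e\<close>.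
  The function \<open>\<gamma>\<close> is given on the whole space, but only its values on that hyperplane
  enter; a function on the hyperplane extends by composition with the orthogonal projection.\<close>

definition C1_holder_boundary :: "real \<Rightarrow> 'a::euclidean_space set \<Rightarrow> bool" where
  "C1_holder_boundary \<epsilon> \<Omega> \<longleftrightarrow>
     (\<forall>z \<in> frontier \<Omega>. \<exists>r > 0. \<exists>e :: 'a. \<exists>\<gamma> :: 'a \<Rightarrow> real. \<exists>D :: 'a \<Rightarrow> 'a. \<exists>L :: real.
        norm e = 1 \<and>
        (\<forall>y. (\<gamma> has_derivative (\<lambda>h. D y \<bullet> h)) (at y)) \<and>
        (\<forall>y y'. norm (D y - D y') \<le> L * dist y y' powr \<epsilon>) \<and>
        \<Omega> \<inter> ball z r = {y \<in> ball z r. \<gamma> (y - (y \<bullet> e) *\<^sub>R e) < y \<bullet> e})"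

primrec C_k :: "nat \<Rightarrow> ('a::euclidean_space \<Rightarrow> real) \<Rightarrow> bool" where
  "C_k 0 f \<longleftrightarrow> continuous_on UNIV f"
| "C_k (Suc k) f \<longleftrightarrow>
     (\<forall>x. f differentiable (at x)) \<and>
     (\<forall>b \<in> Basis. C_k k (\<lambda>x. frechet_derivative f (at x) b))"

definition test_functions :: "'a::euclidean_space set \<Rightarrow> ('a \<Rightarrow> real) set" where
  "test_functions \<Omega> =
     {\<phi>. (\<forall>k. C_k k \<phi>) \<and> compact (closure {x. \<phi> x \<noteq> 0}) \<and> closure {x. \<phi> x \<noteq> 0} \<subseteq> \<Omega>}"

definition has_weak_gradient ::
    "('a::euclidean_space \<Rightarrow> real) \<Rightarrow> ('a \<Rightarrow> 'a) \<Rightarrow> 'a set \<Rightarrow> bool" where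
  "has_weak_gradient u g \<Omega> \<longleftrightarrow>
     (\<forall>K. compact K \<and> K \<subseteq> \<Omega> \<longrightarrow>
        integrable (lebesgue_on K) u \<and> integrable (lebesgue_on K) g) \<and>
     (\<forall>\<phi> \<in> test_functions \<Omega>. \<forall>b \<in> Basis.
        (LINT x|lebesgue_on \<Omega>. u x * frechet_derivative \<phi> (at x) b) =
        - (LINT x|lebesgue_on \<Omega>. (g x \<bullet> b) * \<phi> x))"

definition Lp :: "real \<Rightarrow> 'a::euclidean_space set \<Rightarrow> ('a \<Rightarrow> 'b::euclidean_space) set" where
  "Lp p \<Omega> = {f \<in> borel_measurable (lebesgue_on \<Omega>).
               integrable (lebesgue_on \<Omega>) (\<lambda>x. norm (f x) powr p)}"

text \<open>The pairs \<open>(u, \<nabla>u)\<close> with \<open>u\<close> in the Sobolev space \<open>W\<^sup>1\<^sup>,\<^sup>p(\<Omega>)\<close>; the gradient is determined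
  up to null sets, so the integrals below do not depend on the choice of its version.\<close>

definition sobolev :: "real \<Rightarrow> 'a::euclidean_space set \<Rightarrow> (('a \<Rightarrow> real) \<times> ('a \<Rightarrow> 'a)) set" where
  "sobolev p \<Omega> = {(u, g). u \<in> Lp p \<Omega> \<and> g \<in> Lp p \<Omega> \<and> has_weak_gradient u g \<Omega>}"

text \<open>For \<open>p > DIM('a)\<close> every Sobolev function on a domain with the above regularity is identified
  with its representative that is continuous up to the boundary, which gives sense to its boundary
  values. Nonzero means nonzero as an element of the Sobolev space.\<close>

definition admissible :: "real \<Rightarrow> 'a::euclidean_space set \<Rightarrow> (('a \<Rightarrow> real) \<times> ('a \<Rightarrow> 'a)) set" where
  "admissible p \<Omega> = {(u, g) \<in> sobolev p \<Omega>.
     continuous_on (closure \<Omega>) u \<and> \<not> (AE x in lebesgue_on \<Omega>. u x = 0)}"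

definition Sigma_m :: "real \<Rightarrow> 'a::euclidean_space set \<Rightarrow> ('a \<Rightarrow> real) set" where
  "Sigma_m m \<Omega> = {\<sigma>. integrable (boundary_measure \<Omega>) \<sigma> \<and>
     (AE x in boundary_measure \<Omega>. \<sigma> x \<ge> 0) \<and> (LINT x|boundary_measure \<Omega>. \<sigma> x) = m}"

definition ell1 :: "real \<Rightarrow> ('a::euclidean_space \<Rightarrow> real) \<Rightarrow> 'a set \<Rightarrow> real" where
  "ell1 p \<sigma> \<Omega> =
     (INF (u, g) \<in> admissible p \<Omega>.
        ((LINT x|lebesgue_on \<Omega>. norm (g x) powr p)
          + (LINT x|boundary_measure \<Omega>. \<sigma> x * \<bar>u x\<bar> powr p))
        / (LINT x|lebesgue_on \<Omega>. \<bar>u x\<bar> powr p))"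

definition lambda_opt :: "real \<Rightarrow> real \<Rightarrow> 'a::euclidean_space set \<Rightarrow> real" where
  "lambda_opt p m \<Omega> = (INF \<sigma> \<in> Sigma_m m \<Omega>. ell1 p \<sigma> \<Omega>)"

definition ell1_dirac :: "real \<Rightarrow> real \<Rightarrow> 'a::euclidean_space \<Rightarrow> 'a set \<Rightarrow> real" where
  "ell1_dirac p m x \<Omega> =
     (INF (u, g) \<in> admissible p \<Omega>.
        ((LINT y|lebesgue_on \<Omega>. norm (g y) powr p) + m * \<bar>u x\<bar> powr p)
        / (LINT y|lebesgue_on \<Omega>. \<bar>u y\<bar> powr p))"

definition lambda1 :: "real \<Rightarrow> 'a::euclidean_space \<Rightarrow> 'a set \<Rightarrow> real" where
  "lambda1 p x \<Omega> =
     (INF (u, g) \<in> {(u, g) \<in> admissible p \<Omega>. u x = 0}.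
        (LINT y|lebesgue_on \<Omega>. norm (g y) powr p) / (LINT y|lebesgue_on \<Omega>. \<bar>u y\<bar> powr p))"

end

(* By comparison with boundary weights concentrated near a boundary point y, every function u with
   u(y) = 0 has Rayleigh quotient at least lambda(m); hence lambda(m) <= lambda_1(y) for all y and m.
   The weights exist because small pieces of the boundary, locally a Lipschitz graph, have positive
   finite Hausdorff measure; both bounds follow by comparing volumes of unit tubes over the graph
   in the direction of its axis.  Conversely, take normalized near-minimizers u_k for
   ell_1(m_k delta_{x_k}).  Their gradients are bounded in L^p and u_k(x_k) -> 0.  A Morrey estimate
   up to the boundary, uniform on interior cones with vertex on the boundary, gives u_k(xbar) -> 0,
   so u_k - u_k(xbar) competes for lambda_1(xbar) with nearly the same quotient.
   The Morrey estimate is obtained from scaled bump functions rho_s supported in the cone at x: the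
   s-derivative of rho_s is minus the divergence of an explicit test vector field, so the
   derivative of s |-> int u rho_s is an integral of the weak gradient, of size O(s^{-n/p}). *)
theory Submission
  imports Defs "HOL-Computational_Algebra.Polynomial"
begin

section \<open>Hausdorff measure is a metric outer measure\<close>

text \<open>The weights in \<open>Sigma_m\<close> are integrable densities, so a point mass is not
  one of them and the mass has to be spread over a boundary patch of positive and finite measure.
  The surface measure is given through \<open>measure_of\<close>, which yields the zero measure
  unless the outer measure is countably additive on Borel sets; hence the measure theory comes
  before all geometry. In the converse direction both the functions u_k and the points x_k vary, so
  continuity of each u_k is not enough: the modulus of continuity may depend only on the bounds for
  u_k and its gradient in L^p. A single chart at xbar provides cones with a common axis and a common
  height at all boundary points near xbar, and averages of equal height over translated cones can be
  compared directly. No limit function is extracted. A parameter \<theta> in (0,1) carries all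
  losses, namely the slack of near-minimality and the factor (1 + \<theta>)^p / (1 - \<theta>)
  caused by the shift; one large k is used for each \<theta>, and \<theta> tends to 0 at the
  end.\<close>

lemma ennreal_suminf_tail_tendsto_0:
  fixes f :: "nat \<Rightarrow> ennreal"
  assumes "(\<Sum>j. f j) < top"
  shows "(\<lambda>k. \<Sum>j. f (j + k)) \<longlonglongrightarrow> 0"
proof -
  have fin: "f j \<noteq> top" for j
    using ennreal_suminf_lessD[OF assms] by (simp add: less_top)
  define g where "g j = enn2real (f j)" for j
  have fg: "f = (\<lambda>j. ennreal (g j))" and gn: "g j \<ge> 0" for j
    using fin by (auto simp: g_def fun_eq_iff less_top)
  have sg: "summable g"
    using assms gn by (intro summable_suminf_not_top) (auto simp: fg)
  have tail: "(\<Sum>j. f (j + k)) = ennreal (suminf g - (\<Sum>j<k. g j))" for k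
  proof -
    have "(\<Sum>j. f (j + k)) = ennreal (\<Sum>j. g (j + k))"
      unfolding fg using gn sg by (intro suminf_ennreal2) (auto simp: summable_iff_shift)
    then show ?thesis using suminf_minus_initial_segment[OF sg, of k] by simp
  qed
  have "(\<lambda>k. suminf g - (\<Sum>j<k. g j)) \<longlonglongrightarrow> suminf g - suminf g"
    by (intro tendsto_intros summable_LIMSEQ sg)
  then have "(\<lambda>k. ennreal (suminf g - (\<Sum>j<k. g j))) \<longlonglongrightarrow> ennreal 0"
    by (intro tendsto_ennrealI) simp
  then show ?thesis by (simp add: tail)
qed

text \<open>Caratheodory's criterion. The part of X off F is exhausted by the sets
  \<open>S k\<close>, which have positive distance from F, up to the union of the shells
  \<open>R j\<close> with j \<ge> k. Shells whose indices differ by at least 2 are separated, so the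
  even and the odd shells each have total mass at most \<open>f X\<close>; the series over all
  shells is finite and its tails vanish.\<close>

lemma metric_outer_measure_closed:
  fixes f :: "'a::metric_space set \<Rightarrow> ennreal"
  assumes oms: "outer_measure_space UNIV f"
    and sep: "\<And>A B d. 0 < d \<Longrightarrow> (\<And>x y. x \<in> A \<Longrightarrow> y \<in> B \<Longrightarrow> d \<le> dist x y) \<Longrightarrow>
                f A + f B \<le> f (A \<union> B)"
    and F: "closed F"
  shows "F \<in> lambda_system UNIV UNIV f"
\<comment> \<open>\<open>infdist\<close> to the empty set is 0 by convention, so the shells could
  not exhaust X in this case.\<close>
proof (cases "F = {}")
  case True
  interpret algebra "UNIV :: 'a set" UNIV by (metis Pow_UNIV algebra_Pow)
  show ?thesis using lambda_system_empty oms True by (auto simp: outer_measure_space_def)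
next
  case False
  have mono: "A \<subseteq> B \<Longrightarrow> f A \<le> f B" for A B
    using oms by (auto simp: outer_measure_space_def increasing_def)
  have csub: "f (\<Union>i. A i) \<le> (\<Sum>i. f (A i))" if "disjoint_family A" for A :: "nat \<Rightarrow> 'a set"
    using oms that by (auto simp: outer_measure_space_def countably_subadditive_def)
  have sub: "f (A \<union> B) \<le> f A + f B" for A B
  proof -
    interpret algebra "UNIV :: 'a set" UNIV by (metis Pow_UNIV algebra_Pow)
    have "subadditive UNIV f"
      using oms countably_subadditive_subadditive by (auto simp: outer_measure_space_def)
    then have "f (A \<union> (B - A)) \<le> f A + f (B - A)"
      by (meson subadditiveD Diff_disjoint UNIV_I)
    also have "\<dots> \<le> f A + f B" by (intro add_left_mono mono) auto
    finally show ?thesis by simp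
  qed
  have "f (F \<inter> X) + f ((UNIV - F) \<inter> X) \<le> f X" for X
  proof (cases "f X = top")
    case fin: False
    define S where "S k = {x \<in> X. 1 / (real k + 1) \<le> infdist x F}" for k
    define R where "R k = {x \<in> X. 1 / (real k + 2) \<le> infdist x F \<and> infdist x F < 1 / (real k + 1)}" for k
    have R_sep: "\<exists>d>0. \<forall>x y. x \<in> R i \<longrightarrow> y \<in> R j \<longrightarrow> d \<le> dist x y" if "i + 2 \<le> j" for i j
    proof (intro exI conjI allI impI)
      show "1 / (real i + 2) - 1 / (real i + 3) > 0"
        using divide_strict_left_mono[of "real i + 2" "real i + 3" 1] by simp
      fix x y assume "x \<in> R i" "y \<in> R j"
      then have "1 / (real i + 2) \<le> infdist x F" "infdist y F < 1 / (real j + 1)"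
        by (auto simp: R_def)
      moreover have "1 / (real j + 1) \<le> 1 / (real i + 3)"
        using that by (intro divide_left_mono) auto
      moreover have "infdist x F \<le> infdist y F + dist x y" by (rule infdist_triangle)
      ultimately show "1 / (real i + 2) - 1 / (real i + 3) \<le> dist x y" by linarith
    qed
    have sum_le: "(\<Sum>i<n. f (R (2 * i + c))) \<le> f (\<Union>i<n. R (2 * i + c))" for n c
    proof (induction n)
      case (Suc n)
      have "\<exists>d>0. \<forall>x y. x \<in> (\<Union>i<n. R (2 * i + c)) \<longrightarrow> y \<in> R (2 * n + c) \<longrightarrow> d \<le> dist x y"
      proof (cases "n = 0")
        case True then show ?thesis by (auto intro!: exI[of _ 1])
      next
        case n: False
        have "\<forall>i\<in>{..<n}. \<exists>d>0. \<forall>x y. x \<in> R (2 * i + c) \<longrightarrow> y \<in> R (2 * n + c) \<longrightarrow> d \<le> dist x y"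
          by (intro ballI R_sep) auto
        then obtain d where d: "\<And>i. i < n \<Longrightarrow> 0 < d i"
            "\<And>i x y. i < n \<Longrightarrow> x \<in> R (2 * i + c) \<Longrightarrow> y \<in> R (2 * n + c) \<Longrightarrow> d i \<le> dist x y"
          unfolding bchoice_iff by auto
        show ?thesis
        proof (intro exI[of _ "Min (d ` {..<n})"] conjI allI impI)
          show "0 < Min (d ` {..<n})" using n d(1) by (subst Min_gr_iff) auto
          fix x y assume x: "x \<in> (\<Union>i<n. R (2 * i + c))" and y: "y \<in> R (2 * n + c)"
          then obtain i where i: "i < n" "x \<in> R (2 * i + c)" by auto
          have "Min (d ` {..<n}) \<le> d i" using i by auto
          also have "\<dots> \<le> dist x y" using d(2) i y by auto
          finally show "Min (d ` {..<n}) \<le> dist x y" .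
        qed
      qed
      then have *: "f (\<Union>i<n. R (2 * i + c)) + f (R (2 * n + c))
          \<le> f ((\<Union>i<n. R (2 * i + c)) \<union> R (2 * n + c))"
        using sep by metis
      have "(\<Sum>i<Suc n. f (R (2 * i + c))) \<le> f (\<Union>i<n. R (2 * i + c)) + f (R (2 * n + c))"
        using Suc.IH by (simp add: add_right_mono)
      also note *
      also have "(\<Union>i<n. R (2 * i + c)) \<union> R (2 * n + c) = (\<Union>i<Suc n. R (2 * i + c))"
        by (simp add: lessThan_Suc Un_commute)
      finally show ?case .
    qed simp
    have half: "(\<Sum>i. f (R (2 * i + c))) \<le> f X" for c
    proof (rule suminf_le_const)
      fix n show "(\<Sum>i<n. f (R (2 * i + c))) \<le> f X"
        by (rule order_trans[OF sum_le]) (intro mono, auto simp: R_def)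
    qed auto
    have "(\<Sum>i. f (R i)) \<le> f X + f X"
    proof (rule suminf_le_const)
      fix n
      have "(\<Sum>i<n. f (R i)) \<le> (\<Sum>i<2*n. f (R i))" by (intro sum_mono2) auto
      also have "\<dots> = (\<Sum>i<n. f (R (2 * i + 0))) + (\<Sum>i<n. f (R (2 * i + 1)))"
        by (induction n) (auto simp: algebra_simps)
      also have "\<dots> \<le> f X + f X"
        by (intro add_mono order_trans[OF sum_le] mono) (auto simp: R_def)
      finally show "(\<Sum>i<n. f (R i)) \<le> f X + f X" .
    qed auto
    also have "\<dots> < top" using fin by (simp add: less_top)
    finally have tail: "(\<lambda>k. \<Sum>j. f (R (j + k))) \<longlonglongrightarrow> 0"
      by (rule ennreal_suminf_tail_tendsto_0)
    have main: "f (F \<inter> X) + f ((UNIV - F) \<inter> X) \<le> f X + (\<Sum>j. f (R (j + k)))" for k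
    proof -
      have "(UNIV - F) \<inter> X \<subseteq> S k \<union> (\<Union>j. R (j + k))"
      proof
        fix x assume x: "x \<in> (UNIV - F) \<inter> X"
        then have pos: "infdist x F > 0"
          using F False infdist_pos_not_in_closed by fastforce
        show "x \<in> S k \<union> (\<Union>j. R (j + k))"
        proof (cases "x \<in> S k")
          case notS: False
          then have lt: "infdist x F < 1 / (real k + 1)" using x by (auto simp: S_def)
          \<comment> \<open>The shell containing x belongs to the first threshold not above its
            distance from F; for index 0 the upper bound comes from x lying outside
            \<open>S k\<close>.\<close>
          define P where "P j \<longleftrightarrow> 1 / (real (j + k) + 2) \<le> infdist x F" for j
          obtain n where n: "inverse (real (Suc n)) < infdist x F"
            using reals_Archimedean[OF pos] by auto
          have "1 / (real (n + k) + 2) \<le> inverse (real (Suc n))"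
            by (simp add: field_simps)
          with n have "P n" by (simp add: P_def)
          then have PL: "P (LEAST j. P j)" by (rule LeastI)
          define j where "j = (LEAST j. P j)"
          have "infdist x F < 1 / (real (j + k) + 1)"
          proof (cases j)
            case 0 then show ?thesis using lt by simp
          next
            case (Suc i)
            then have "\<not> P i" unfolding j_def by (metis not_less_Least lessI)
            then show ?thesis using Suc by (simp add: P_def add.commute add.left_commute not_le)
          qed
          then have "x \<in> R (j + k)" using PL x by (auto simp: R_def P_def j_def)
          then show ?thesis by auto
        qed auto
      qed
      then have "f ((UNIV - F) \<inter> X) \<le> f (S k \<union> (\<Union>j. R (j + k)))" by (rule mono)
      also have "\<dots> \<le> f (S k) + f (\<Union>j. R (j + k))" by (rule sub)
      also have "\<dots> \<le> f (S k) + (\<Sum>j. f (R (j + k)))"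
      proof (intro add_left_mono csub)
        have "R i \<inter> R j = {}" if "i < j" for i j
        proof -
          have "1 / (real j + 1) \<le> 1 / (real i + 2)"
            using that by (intro divide_left_mono) auto
          then show ?thesis by (auto simp: R_def)
        qed
        then show "disjoint_family (\<lambda>j. R (j + k))"
          unfolding disjoint_family_on_def
          by (metis add_right_cancel inf_commute linorder_neqE_nat)
      qed
      finally have le: "f ((UNIV - F) \<inter> X) \<le> f (S k) + (\<Sum>j. f (R (j + k)))" .
      have "f (F \<inter> X) + f (S k) \<le> f ((F \<inter> X) \<union> S k)"
      proof (rule sep)
        show "0 < 1 / (real k + 1)" by simp
        fix x y assume "x \<in> F \<inter> X" "y \<in> S k"
        then show "1 / (real k + 1) \<le> dist x y"
          using infdist_le[of x F y] by (auto simp: S_def dist_commute)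
      qed
      also have "\<dots> \<le> f X" by (intro mono) (auto simp: S_def)
      finally have "f (F \<inter> X) + f (S k) \<le> f X" .
      then have "f (F \<inter> X) + (f (S k) + (\<Sum>j. f (R (j + k)))) \<le> f X + (\<Sum>j. f (R (j + k)))"
        by (metis add.assoc add_right_mono)
      with le show ?thesis by (meson add_left_mono order_trans)
    qed
    have "(\<lambda>k. f X + (\<Sum>j. f (R (j + k)))) \<longlonglongrightarrow> f X + 0"
      by (intro tendsto_add tail tendsto_const)
    then show ?thesis using main by (intro LIMSEQ_le_const[of _ "f X"]) auto
  qed auto
  moreover have "f X \<le> f (F \<inter> X) + f ((UNIV - F) \<inter> X)" for X
    using sub[of "F \<inter> X" "(UNIV - F) \<inter> X"] by (simp add: Int_Un_distrib2[symmetric])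
  ultimately show ?thesis by (auto simp: lambda_system_def intro: antisym)
qed

section \<open>Hausdorff pre-measures and the measure that they induce\<close>

lemma hausdorff_weight_nonneg: "0 \<le> hausdorff_weight d C" if "bounded C"
  using that by (simp add: hausdorff_weight_def diameter_ge_0)

lemma hausdorff_weight_empty [simp]: "hausdorff_weight d {} = 0"
  by (simp add: hausdorff_weight_def)

lemma hausdorff_pre_le:
  assumes "\<And>i. bounded (C i)" "\<And>i. diameter (C i) \<le> \<delta>" "A \<subseteq> (\<Union>i. C i)"
  shows "hausdorff_pre d \<delta> A \<le> (\<Sum>i. ennreal (hausdorff_weight d (C i)))"
  unfolding hausdorff_pre_def by (rule INF_lower) (use assms in auto)

lemma hausdorff_pre_mono: "A \<subseteq> B \<Longrightarrow> hausdorff_pre d \<delta> A \<le> hausdorff_pre d \<delta> B"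
  unfolding hausdorff_pre_def by (rule INF_superset_mono) auto

lemma hausdorff_pre_antimono: "\<delta> \<le> \<delta>' \<Longrightarrow> hausdorff_pre d \<delta>' A \<le> hausdorff_pre d \<delta> A"
  unfolding hausdorff_pre_def by (rule INF_superset_mono) (auto intro: order_trans)

lemma hausdorff_pre_cover:
  assumes "hausdorff_pre d \<delta> A < c"
  obtains C where "\<And>i. bounded (C i)" "\<And>i. diameter (C i) \<le> \<delta>" "A \<subseteq> (\<Union>i. C i)"
    "(\<Sum>i. ennreal (hausdorff_weight d (C i))) < c"
  using assms unfolding hausdorff_pre_def INF_less_iff by auto

lemma hausdorff_pre_UN_le:
  fixes A :: "nat \<Rightarrow> 'a::metric_space set"
  shows "hausdorff_pre d \<delta> (\<Union>i. A i) \<le> (\<Sum>i. hausdorff_pre d \<delta> (A i))"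
proof (rule ennreal_le_epsilon)
  fix e :: real assume fin: "(\<Sum>i. hausdorff_pre d \<delta> (A i)) < top" and e: "0 < e"
  define b where "b i = ennreal (e * (1/2) ^ Suc i)" for i
  have b: "0 < b i" for i using e by (simp add: b_def)
  have fin1: "hausdorff_pre d \<delta> (A i) < top" for i
    using ennreal_suminf_lessD[OF fin] by auto
  have "\<exists>C. (\<forall>j. bounded (C j) \<and> diameter (C j) \<le> \<delta>) \<and> A i \<subseteq> (\<Union>j. C j) \<and>
      (\<Sum>j. ennreal (hausdorff_weight d (C j))) < hausdorff_pre d \<delta> (A i) + b i" for i
  proof -
    have "hausdorff_pre d \<delta> (A i) < hausdorff_pre d \<delta> (A i) + b i"
      using fin1[of i] b[of i] ennreal_add_left_cancel_less[of "hausdorff_pre d \<delta> (A i)" 0 "b i"]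
      by (metis add.right_neutral infinity_ennreal_def less_irrefl)
    then show ?thesis by (elim hausdorff_pre_cover) auto
  qed
  then obtain C where C: "\<And>i j. bounded (C i j)" "\<And>i j. diameter (C i j) \<le> \<delta>"
      "\<And>i. A i \<subseteq> (\<Union>j. C i j)"
      "\<And>i. (\<Sum>j. ennreal (hausdorff_weight d (C i j))) < hausdorff_pre d \<delta> (A i) + b i"
    by metis
  define D where "D k = C (fst (prod_decode k)) (snd (prod_decode k))" for k
  have "hausdorff_pre d \<delta> (\<Union>i. A i) \<le> (\<Sum>k. ennreal (hausdorff_weight d (D k)))"
  proof (rule hausdorff_pre_le)
    show "(\<Union>i. A i) \<subseteq> (\<Union>k. D k)"
    proof
      fix x assume "x \<in> (\<Union>i. A i)"
      then obtain i j where "x \<in> C i j" using C(3) by blast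
      then have "x \<in> D (prod_encode (i, j))" by (simp add: D_def)
      then show "x \<in> (\<Union>k. D k)" by blast
    qed
  qed (auto simp: D_def C)
  also have "\<dots> = (\<Sum>i. \<Sum>j. ennreal (hausdorff_weight d (C i j)))"
    using suminf_ennreal_2dimen[of "\<lambda>i. \<Sum>j. ennreal (hausdorff_weight d (C i j))"
        "\<lambda>(i, j). ennreal (hausdorff_weight d (C i j))"]
    by (simp add: D_def split_beta o_def)
  also have "\<dots> \<le> (\<Sum>i. hausdorff_pre d \<delta> (A i) + b i)"
    by (intro suminf_le) (auto intro: less_imp_le C)
  also have "\<dots> = (\<Sum>i. hausdorff_pre d \<delta> (A i)) + (\<Sum>i. b i)"
    by (intro suminf_add[symmetric]) auto
  also have "(\<Sum>i. b i) = ennreal e"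
  proof -
    have "(\<lambda>i. e * (1/2) ^ Suc i) sums (e * 1)"
      by (intro sums_mult power_half_series)
    then show ?thesis using e unfolding b_def by (intro suminf_ennreal_eq) auto
  qed
  finally show "hausdorff_pre d \<delta> (\<Union>i. A i) \<le> (\<Sum>i. hausdorff_pre d \<delta> (A i)) + ennreal e" .
qed

lemma hausdorff_pre_le_outer: "0 < \<delta> \<Longrightarrow> hausdorff_pre d \<delta> A \<le> hausdorff_outer d A"
  unfolding hausdorff_outer_def by (rule SUP_upper) auto

lemma hausdorff_outer_empty: "hausdorff_outer d ({} :: 'a::metric_space set) = 0"
proof -
  have "hausdorff_pre d \<delta> ({} :: 'a set) \<le> 0" if "\<delta> > 0" for \<delta>
    using hausdorff_pre_le[of "\<lambda>_. {}" \<delta> "{} :: 'a set" d] that by simp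
  then show ?thesis by (auto simp: hausdorff_outer_def intro!: antisym SUP_least)
qed

text \<open>A piece of diameter below the gap \<open>e\<close> meets at most one of the two sets, so
  a fine cover of the union divides into two covers that share no piece. Rejected pieces become {},
  whose weight is 0 even for d = 0.\<close>

lemma hausdorff_outer_separated:
  fixes A B :: "'a::metric_space set"
  assumes d: "0 < e" and sep: "\<And>x y. x \<in> A \<Longrightarrow> y \<in> B \<Longrightarrow> e \<le> dist x y"
  shows "hausdorff_outer d A + hausdorff_outer d B \<le> hausdorff_outer d (A \<union> B)"
proof -
  have pre: "hausdorff_pre d \<delta> A + hausdorff_pre d \<delta> B \<le> hausdorff_pre d \<delta> (A \<union> B)"
    if \<delta>: "0 < \<delta>" "\<delta> < e" for \<delta>
    unfolding hausdorff_pre_def[of d \<delta> "A \<union> B"]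
  proof (rule INF_greatest, clarsimp)
    fix C :: "nat \<Rightarrow> 'a set"
    assume C: "\<forall>i. bounded (C i) \<and> diameter (C i) \<le> \<delta>" "A \<subseteq> \<Union> (range C)" "B \<subseteq> \<Union> (range C)"
    define CA where "CA i = (if C i \<inter> A = {} then {} else C i)" for i
    define CB where "CB i = (if C i \<inter> B = {} then {} else C i)" for i
    have "hausdorff_pre d \<delta> A \<le> (\<Sum>i. ennreal (hausdorff_weight d (CA i)))"
    proof (intro hausdorff_pre_le)
      show "A \<subseteq> (\<Union>i. CA i)"
      proof
        fix x assume "x \<in> A"
        moreover from this obtain i where "x \<in> C i" using C by blast
        ultimately have "x \<in> CA i" by (auto simp: CA_def)
        then show "x \<in> (\<Union>i. CA i)" by blast
      qed
    qed (use C(1) \<delta> in \<open>simp_all add: CA_def\<close>)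
    moreover have "hausdorff_pre d \<delta> B \<le> (\<Sum>i. ennreal (hausdorff_weight d (CB i)))"
    proof (intro hausdorff_pre_le)
      show "B \<subseteq> (\<Union>i. CB i)"
      proof
        fix x assume "x \<in> B"
        moreover from this obtain i where "x \<in> C i" using C by blast
        ultimately have "x \<in> CB i" by (auto simp: CB_def)
        then show "x \<in> (\<Union>i. CB i)" by blast
      qed
    qed (use C(1) \<delta> in \<open>simp_all add: CB_def\<close>)
    moreover have "(\<Sum>i. ennreal (hausdorff_weight d (CA i))) + (\<Sum>i. ennreal (hausdorff_weight d (CB i)))
        = (\<Sum>i. ennreal (hausdorff_weight d (CA i)) + ennreal (hausdorff_weight d (CB i)))"
      by (intro suminf_add) auto
    moreover have "\<dots> \<le> (\<Sum>i. ennreal (hausdorff_weight d (C i)))"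
    proof (intro suminf_le)
      fix i
      have "C i \<inter> A = {} \<or> C i \<inter> B = {}"
      proof (rule ccontr)
        assume "\<not> ?thesis"
        then obtain x y where "x \<in> C i" "y \<in> C i" "x \<in> A" "y \<in> B" by auto
        moreover have "dist x y \<le> diameter (C i)"
          using C \<open>x \<in> C i\<close> \<open>y \<in> C i\<close> by (intro diameter_bounded_bound) auto
        ultimately show False using sep[of x y] C(1) \<delta> by (smt (verit))
      qed
      then show "ennreal (hausdorff_weight d (CA i)) + ennreal (hausdorff_weight d (CB i))
          \<le> ennreal (hausdorff_weight d (C i))"
        by (auto simp: CA_def CB_def)
    qed auto
    ultimately show "hausdorff_pre d \<delta> A + hausdorff_pre d \<delta> B
        \<le> (\<Sum>i. ennreal (hausdorff_weight d (C i)))"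
      by (metis (no_types, lifting) add_mono order_trans)
  qed
  have "hausdorff_pre d \<delta> A + hausdorff_pre d \<delta>' B \<le> hausdorff_outer d (A \<union> B)"
    if "0 < \<delta>" "0 < \<delta>'" for \<delta> \<delta>'
  proof -
    \<comment> \<open>The two suprema range over independent scales. A common finer scale only
      increases both pre-measures, and below \<open>e\<close> the splitting applies.\<close>
    define \<eta> where "\<eta> = min (min \<delta> \<delta>') (e / 2)"
    have "0 < \<eta>" "\<eta> < e" "\<eta> \<le> \<delta>" "\<eta> \<le> \<delta>'" using that d by (auto simp: \<eta>_def)
    then show ?thesis
      using pre[of \<eta>] hausdorff_pre_antimono[of \<eta> \<delta> d A] hausdorff_pre_antimono[of \<eta> \<delta>' d B]
        hausdorff_pre_le_outer[of \<eta> d "A \<union> B"]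
      by (meson add_mono order_trans)
  qed
  then have "hausdorff_pre d \<delta> A + hausdorff_outer d B \<le> hausdorff_outer d (A \<union> B)" if "0 < \<delta>" for \<delta>
    using that unfolding hausdorff_outer_def[of d B]
    by (simp add: ennreal_SUP_add_right SUP_le_iff)
  then show ?thesis
    unfolding hausdorff_outer_def[of d A]
    by (simp add: ennreal_SUP_add_left[symmetric] SUP_le_iff)
qed

lemma outer_measure_space_hausdorff:
  "outer_measure_space UNIV (hausdorff_outer d :: 'a::metric_space set \<Rightarrow> ennreal)"
  unfolding outer_measure_space_def
proof (intro conjI)
  show "positive UNIV (hausdorff_outer d :: 'a set \<Rightarrow> ennreal)"
    by (simp add: positive_def hausdorff_outer_empty)
  show "increasing UNIV (hausdorff_outer d :: 'a set \<Rightarrow> ennreal)"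
    unfolding increasing_def hausdorff_outer_def
    by (auto intro!: SUP_mono hausdorff_pre_mono)
  show "countably_subadditive UNIV (hausdorff_outer d :: 'a set \<Rightarrow> ennreal)"
    unfolding countably_subadditive_def
  proof clarify
    fix A :: "nat \<Rightarrow> 'a set"
    show "hausdorff_outer d (\<Union> (range A)) \<le> (\<Sum>i. hausdorff_outer d (A i))"
      unfolding hausdorff_outer_def[of d "\<Union> (range A)"]
    proof (rule SUP_least)
      fix \<delta> :: real assume "\<delta> \<in> {0<..}"
      then have "(\<Sum>i. hausdorff_pre d \<delta> (A i)) \<le> (\<Sum>i. hausdorff_outer d (A i))"
        by (intro suminf_le hausdorff_pre_le_outer) auto
      with hausdorff_pre_UN_le[of d \<delta> A]
      show "hausdorff_pre d \<delta> (\<Union> (range A)) \<le> (\<Sum>i. hausdorff_outer d (A i))"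
        by (rule order_trans)
    qed
  qed
qed

lemma space_hausdorff_measure [simp]: "space (hausdorff_measure d) = UNIV"
  by (simp add: hausdorff_measure_def space_measure_of_conv)

lemma sets_hausdorff_measure [simp, measurable_cong]: "sets (hausdorff_measure d) = sets borel"
  using sets.sigma_sets_eq[of borel]
  by (simp add: hausdorff_measure_def sets_measure_of_conv)

text \<open>The Caratheodory-measurable sets form a sigma-algebra that contains the closed sets,
  hence the Borel sets, and there the outer measure is countably additive, as
  \<open>measure_of\<close> demands.\<close>

lemma emeasure_hausdorff_measure:
  fixes A :: "'a::metric_space set"
  assumes "A \<in> sets borel"
  shows "emeasure (hausdorff_measure d) A = hausdorff_outer d A"
proof -
  interpret S: sigma_algebra "UNIV :: 'a set" UNIV by (metis Pow_UNIV sigma_algebra_Pow)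
  let ?L = "lambda_system UNIV UNIV (hausdorff_outer d :: 'a set \<Rightarrow> ennreal)"
  have ms: "measure_space UNIV ?L (hausdorff_outer d)"
    by (rule S.caratheodory_lemma[OF outer_measure_space_hausdorff])
  then have sa: "sigma_algebra UNIV ?L" by (simp add: measure_space_def)
  have "S \<in> ?L" if "closed S" for S
  proof (rule metric_outer_measure_closed[OF outer_measure_space_hausdorff _ that])
    fix A B :: "'a set" and e :: real
    assume "0 < e" "\<And>x y. x \<in> A \<Longrightarrow> y \<in> B \<Longrightarrow> e \<le> dist x y"
    then show "hausdorff_outer d A + hausdorff_outer d B \<le> hausdorff_outer d (A \<union> B)"
      by (rule hausdorff_outer_separated)
  qed
  then have "{S :: 'a set. closed S} \<subseteq> ?L" by blast
  then have "sigma_sets UNIV {S :: 'a set. closed S} \<subseteq> ?L"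
    by (rule sigma_algebra.sigma_sets_subset[OF sa])
  then have sub: "sets borel \<subseteq> ?L"
    by (simp add: borel_eq_closed)
  have "measure_space UNIV (sets borel) (hausdorff_outer d :: 'a set \<Rightarrow> ennreal)"
    by (rule measure_down[OF ms _ sub]) (metis sets.sigma_algebra_axioms space_borel)
  then show ?thesis
    unfolding hausdorff_measure_def
    by (intro emeasure_measure_of_sigma assms) (auto simp: measure_space_def)
qed

section \<open>Lipschitz epigraphs\<close>

text \<open>For a unit vector \<open>e\<close>, the orthogonal projection onto the hyperplane over
  which the boundary is a graph.\<close>

definition orth :: "'a::euclidean_space \<Rightarrow> 'a \<Rightarrow> 'a" where
  "orth e y = y - (y \<bullet> e) *\<^sub>R e"

lemma orth_add: "orth e (x + y) = orth e x + orth e y"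
  and orth_diff: "orth e (x - y) = orth e x - orth e y"
  and orth_scaleR: "orth e (t *\<^sub>R x) = t *\<^sub>R orth e x"
  by (simp_all add: orth_def algebra_simps)

lemma orth_self: "norm e = 1 \<Longrightarrow> orth e e = 0"
  by (simp add: orth_def norm_eq_1)

lemma orth_decomp: "y = orth e y + (y \<bullet> e) *\<^sub>R e"
  by (simp add: orth_def)

lemma norm_orth_le:
  assumes "norm e = 1"
  shows "norm (orth e y) \<le> norm y"
proof -
  have "(norm (orth e y))\<^sup>2 = (norm y)\<^sup>2 - (y \<bullet> e)\<^sup>2"
    using assms unfolding power2_norm_eq_inner orth_def norm_eq_1
    by (simp add: inner_diff inner_commute power2_eq_square algebra_simps)
  then have "(norm (orth e y))\<^sup>2 \<le> (norm y)\<^sup>2" by simp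
  then show ?thesis by (rule power2_le_imp_le) simp
qed

lemma abs_inner_unit_le: "norm e = 1 \<Longrightarrow> \<bar>y \<bullet> e\<bar> \<le> norm y"
  using Cauchy_Schwarz_ineq2[of y e] by simp

text \<open>The form in which boundary regularity enters the geometry. Heights are compared with
  projected differences rather than with \<open>dist y y'\<close>, so two points of the graph with
  close projections are close themselves; the packing count relies on this.\<close>

locale lipschitz_epigraph =
  fixes \<Omega> :: "'a::euclidean_space set" and z e :: 'a and r \<Lambda> :: real and \<gamma> :: "'a \<Rightarrow> real"
  assumes open_domain: "open \<Omega>" and r_pos: "0 < r" and unit: "norm e = 1" and Lip_nonneg: "0 \<le> \<Lambda>"
    and Lip: "\<And>y y'. y \<in> ball z r \<Longrightarrow> y' \<in> ball z r \<Longrightarrow>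
      \<bar>\<gamma> (orth e y) - \<gamma> (orth e y')\<bar> \<le> \<Lambda> * norm (orth e y - orth e y')"
    and epi: "\<Omega> \<inter> ball z r = {y \<in> ball z r. \<gamma> (orth e y) < y \<bullet> e}"
begin

lemma mem_iff:
  assumes "y \<in> ball z r"
  shows "y \<in> \<Omega> \<longleftrightarrow> \<gamma> (orth e y) < y \<bullet> e"
proof -
  have "y \<in> \<Omega> \<longleftrightarrow> y \<in> \<Omega> \<inter> ball z r" using assms by simp
  also have "\<dots> \<longleftrightarrow> \<gamma> (orth e y) < y \<bullet> e" unfolding epi using assms by simp
  finally show ?thesis .
qed

lemma Lip':
  assumes "y \<in> ball z r" "y' \<in> ball z r"
  shows "\<bar>\<gamma> (orth e y) - \<gamma> (orth e y')\<bar> \<le> \<Lambda> * dist y y'"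
proof -
  have "norm (orth e y - orth e y') \<le> dist y y'"
    using norm_orth_le[OF unit, of "y - y'"] by (simp add: dist_norm orth_diff)
  then have "\<Lambda> * norm (orth e y - orth e y') \<le> \<Lambda> * dist y y'"
    using Lip_nonneg by (rule mult_left_mono)
  with Lip[OF assms] show ?thesis by (rule order_trans)
qed

lemma frontier_iff:
  assumes y: "y \<in> ball z r"
  shows "y \<in> frontier \<Omega> \<longleftrightarrow> \<gamma> (orth e y) = y \<bullet> e"
proof
  assume fr: "y \<in> frontier \<Omega>"
  then have "y \<notin> \<Omega>" using open_domain by (simp add: frontier_def interior_open)
  then have ge: "y \<bullet> e \<le> \<gamma> (orth e y)" using mem_iff[OF y] by simp
  moreover have "\<gamma> (orth e y) \<le> y \<bullet> e"
  proof (rule ccontr)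
    assume "\<not> ?thesis"
    then have pos: "0 < \<gamma> (orth e y) - y \<bullet> e" by simp
    \<comment> \<open>A move by \<open>dist y w\<close> raises the height by at most that amount and
      lowers the graph by at most \<Lambda> times it. The gap closes at rate at most \<Lambda> + 1,
      so no point of \<Omega> in the chart lies within this radius.\<close>
    define d where "d = (\<gamma> (orth e y) - y \<bullet> e) / (\<Lambda> + 1)"
    have d: "0 < d" using pos Lip_nonneg by (simp add: d_def)
    have "y \<in> closure \<Omega>" using fr by (simp add: frontier_def)
    moreover have "open (ball z r \<inter> ball y d)" by auto
    moreover have "y \<in> ball z r \<inter> ball y d" using y d by auto
    ultimately have "(ball z r \<inter> ball y d) \<inter> \<Omega> \<noteq> {}"
      using open_Int_closure_eq_empty[of "ball z r \<inter> ball y d" \<Omega>] by blast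
    then obtain w where w: "w \<in> \<Omega>" "w \<in> ball z r" "dist y w < d" by auto
    then have "\<gamma> (orth e w) < w \<bullet> e" using mem_iff by blast
    moreover have "w \<bullet> e \<le> y \<bullet> e + dist y w"
      using abs_inner_unit_le[OF unit, of "w - y"] by (simp add: inner_diff_left dist_norm norm_minus_commute)
    moreover have "\<gamma> (orth e y) \<le> \<gamma> (orth e w) + \<Lambda> * dist y w" using Lip'[OF y w(2)] by simp
    ultimately have "\<gamma> (orth e y) - y \<bullet> e < (\<Lambda> + 1) * dist y w" by (simp add: algebra_simps)
    also have "\<dots> \<le> (\<Lambda> + 1) * d" using w(3) Lip_nonneg by (intro mult_left_mono) auto
    also have "\<dots> = \<gamma> (orth e y) - y \<bullet> e" using Lip_nonneg by (simp add: d_def)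
    finally show False by simp
  qed
  ultimately show "\<gamma> (orth e y) = y \<bullet> e" by simp
next
  assume eq: "\<gamma> (orth e y) = y \<bullet> e"
  have "y \<notin> \<Omega>" using eq mem_iff[OF y] by simp
  moreover have "y \<in> closure \<Omega>"
    unfolding closure_approachable
  proof clarify
    fix d :: real assume d: "0 < d"
    define t where "t = min (d / 2) ((r - dist z y) / 2)"
    have t: "0 < t" "t < d" "t < r - dist z y" using d y by (auto simp: t_def min_less_iff_disj)
    have "y + t *\<^sub>R e \<in> ball z r"
      using t unit dist_triangle[of z "y + t *\<^sub>R e" y] by (simp add: dist_norm)
    moreover have "\<gamma> (orth e (y + t *\<^sub>R e)) < (y + t *\<^sub>R e) \<bullet> e"
      using t unit eq by (simp add: orth_add orth_scaleR orth_self inner_add_left norm_eq_1)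
    ultimately have "y + t *\<^sub>R e \<in> \<Omega>" using mem_iff by blast
    moreover have "dist (y + t *\<^sub>R e) y < d" using t unit by (simp add: dist_norm)
    ultimately show "\<exists>w\<in>\<Omega>. dist w y < d" by blast
  qed
  ultimately show "y \<in> frontier \<Omega>" using open_domain by (simp add: frontier_def interior_open)
qed

text \<open>As s varies, these balls sweep out a truncated cone with vertex x. A point of the ball
  is displaced sideways by at most s, over which the graph rises by at most \<Lambda> s, while its
  height grows by at least (\<Lambda> + 2) s - s; the margin s keeps it strictly above the graph.
  Its distance to x is at most (\<Lambda> + 3) s, which keeps it in the chart.\<close>

lemma cone_subset:
  assumes x: "x \<in> frontier \<Omega>" "dist z x < r / 2" and s: "0 < s" "s * (\<Lambda> + 3) < r / 2"
  shows "cball (x + s *\<^sub>R ((\<Lambda> + 2) *\<^sub>R e)) s \<subseteq> \<Omega>"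
proof
  fix y assume "y \<in> cball (x + s *\<^sub>R ((\<Lambda> + 2) *\<^sub>R e)) s"
  define v where "v = y - (x + s *\<^sub>R ((\<Lambda> + 2) *\<^sub>R e))"
  have v: "norm v \<le> s" using \<open>y \<in> cball _ _\<close> by (simp add: v_def dist_norm norm_minus_commute)
  have y: "y = x + (s * (\<Lambda> + 2)) *\<^sub>R e + v" by (simp add: v_def)
  have xb: "x \<in> ball z r" using x(2) r_pos by simp
  have "norm (y - x) \<le> s * (\<Lambda> + 2) + s"
    using norm_triangle_ineq[of "(s * (\<Lambda> + 2)) *\<^sub>R e" v] v unit s(1) Lip_nonneg by (simp add: y)
  then have "dist x y < r / 2" using s(2) by (simp add: dist_norm norm_minus_commute algebra_simps)
  then have yb: "y \<in> ball z r" using x(2) dist_triangle[of z y x] by simp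
  have "orth e y - orth e x = orth e v"
    by (simp add: y orth_add orth_scaleR orth_self unit)
  then have "\<gamma> (orth e y) \<le> \<gamma> (orth e x) + \<Lambda> * norm (orth e v)" using Lip[OF yb xb] by simp
  also have "\<dots> \<le> x \<bullet> e + \<Lambda> * s"
    using frontier_iff[OF xb] x(1) norm_orth_le[OF unit, of v] v Lip_nonneg
    by (intro add_mono mult_left_mono) auto
  also have "\<dots> < x \<bullet> e + s * (\<Lambda> + 2) + v \<bullet> e"
    using abs_inner_unit_le[OF unit, of v] v s(1) by (simp add: algebra_simps)
  also have "\<dots> = y \<bullet> e" using unit by (simp add: y inner_add_left norm_eq_1)
  finally show "y \<in> \<Omega>" using mem_iff[OF yb] by simp
qed

end

lemma C1_holder_boundary_lipschitz_epigraph: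
  fixes \<Omega> :: "'a::euclidean_space set"
  assumes "open \<Omega>" "C1_holder_boundary \<epsilon> \<Omega>" "0 < \<epsilon>" "z \<in> frontier \<Omega>"
  obtains e r \<Lambda> \<gamma> where "lipschitz_epigraph \<Omega> z e r \<Lambda> \<gamma>"
proof -
  obtain r e \<gamma> D L where r: "0 < r" and *: "norm e = 1 \<and>
        (\<forall>y. (\<gamma> has_derivative (\<lambda>h. D y \<bullet> h)) (at y)) \<and>
        (\<forall>y y'. norm (D y - D y') \<le> L * dist y y' powr \<epsilon>) \<and>
        \<Omega> \<inter> ball z r = {y \<in> ball z r. \<gamma> (y - (y \<bullet> e) *\<^sub>R e) < y \<bullet> e}"
    using bspec[OF assms(2)[unfolded C1_holder_boundary_def] assms(4)] by blast
  have e: "norm e = 1"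
    and der: "\<And>y. (\<gamma> has_derivative (\<lambda>h. D y \<bullet> h)) (at y)"
    and hold: "\<And>y y'. norm (D y - D y') \<le> L * dist y y' powr \<epsilon>"
    and epi: "\<Omega> \<inter> ball z r = {y \<in> ball z r. \<gamma> (y - (y \<bullet> e) *\<^sub>R e) < y \<bullet> e}"
    using * by simp_all
  \<comment> \<open>Hoelder continuity bounds the gradient on the projected ball by its norm at the
    centre plus an oscillation term; \<open>\<bar>L\<bar>\<close> appears because L comes with no
    sign.\<close>
  define \<Lambda> where "\<Lambda> = norm (D (orth e z)) + \<bar>L\<bar> * r powr \<epsilon>"
  have bnd: "norm (D y) \<le> \<Lambda>" if "y \<in> ball (orth e z) r" for y
  proof -
    have "norm (D y) \<le> norm (D (orth e z)) + norm (D y - D (orth e z))"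
      using norm_triangle_sub[of "D y"] by (simp add: add.commute)
    also have "norm (D y - D (orth e z)) \<le> L * dist y (orth e z) powr \<epsilon>" by (rule hold)
    also have "\<dots> \<le> \<bar>L\<bar> * r powr \<epsilon>"
      using that assms(3) by (intro mult_mono powr_mono2) (auto simp: dist_commute)
    finally show ?thesis by (simp add: \<Lambda>_def)
  qed
  have inb: "orth e y \<in> ball (orth e z) r" if "y \<in> ball z r" for y
    using that norm_orth_le[OF e, of "z - y"] by (simp add: dist_norm orth_diff)
  have "lipschitz_epigraph \<Omega> z e r \<Lambda> \<gamma>"
  proof
    fix y y' assume y: "y \<in> ball z r" "y' \<in> ball z r"
    have "norm (\<gamma> (orth e y) - \<gamma> (orth e y')) \<le> \<Lambda> * norm (orth e y - orth e y')"
    proof (rule differentiable_bound[OF convex_ball[of "orth e z" r]])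
      fix w assume w: "w \<in> ball (orth e z) r"
      show "(\<gamma> has_derivative (\<lambda>h. D w \<bullet> h)) (at w within ball (orth e z) r)"
        using der by (rule has_derivative_at_withinI)
      have "onorm (\<lambda>h. D w \<bullet> h) \<le> norm (D w)"
        by (rule onorm_le) (simp add: Cauchy_Schwarz_ineq2)
      then show "onorm (\<lambda>h. D w \<bullet> h) \<le> \<Lambda>" using bnd[OF w] by simp
    qed (use inb y in auto)
    then show "\<bar>\<gamma> (orth e y) - \<gamma> (orth e y')\<bar> \<le> \<Lambda> * norm (orth e y - orth e y')" by simp
  next
    show "0 \<le> \<Lambda>" by (simp add: \<Lambda>_def)
    show "\<Omega> \<inter> ball z r = {y \<in> ball z r. \<gamma> (orth e y) < y \<bullet> e}" using epi by (simp add: orth_def)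
  qed (use assms r e in auto)
  then show ?thesis by (rule that)
qed

section \<open>Hausdorff measure of Lipschitz graphs\<close>

lemma hausdorff_pre_finite_cover_le:
  fixes C :: "'b \<Rightarrow> 'a::metric_space set"
  assumes S: "finite S" and b: "\<And>x. x \<in> S \<Longrightarrow> bounded (C x)" and d: "\<And>x. x \<in> S \<Longrightarrow> diameter (C x) \<le> \<delta>"
    and sub: "A \<subseteq> (\<Union>x\<in>S. C x)" and \<delta>: "0 \<le> \<delta>"
  shows "hausdorff_pre k \<delta> A \<le> (\<Sum>x\<in>S. ennreal (hausdorff_weight k (C x)))"
proof -
  obtain h where h: "bij_betw h {0..<card S} S" using ex_bij_betw_nat_finite[OF S] by auto
  define E where "E i = (if i < card S then C (h i) else {})" for i
  have hS: "h i \<in> S" if "i < card S" for i using h that by (auto simp: bij_betw_def)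
  have "A \<subseteq> (\<Union>i. E i)"
  proof
    fix y assume "y \<in> A"
    then obtain x where x: "x \<in> S" "y \<in> C x" using sub by blast
    then obtain i where "i < card S" "h i = x"
      using h by (auto simp: bij_betw_def) (metis atLeastLessThan_iff imageE)
    then have "y \<in> E i" using x by (simp add: E_def)
    then show "y \<in> (\<Union>i. E i)" by blast
  qed
  then have "hausdorff_pre k \<delta> A \<le> (\<Sum>i. ennreal (hausdorff_weight k (E i)))"
    using b d \<delta> hS by (intro hausdorff_pre_le) (auto simp: E_def)
  also have "\<dots> = (\<Sum>i\<in>{0..<card S}. ennreal (hausdorff_weight k (E i)))"
    by (rule suminf_finite) (auto simp: E_def)
  also have "\<dots> = (\<Sum>i\<in>{0..<card S}. ennreal (hausdorff_weight k (C (h i))))"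
    by (rule sum.cong) (auto simp: E_def)
  also have "\<dots> = (\<Sum>x\<in>S. ennreal (hausdorff_weight k (C x)))"
    by (rule sum.reindex_bij_betw[OF h])
  finally show ?thesis .
qed

text \<open>Thickening a piece of a cover by segments in direction \<open>e\<close> turns its
  (n-1)-dimensional size into a volume. The closure makes the tube of a bounded piece compact, hence
  measurable, even if the piece is not.\<close>

definition tube :: "'a::euclidean_space \<Rightarrow> 'a set \<Rightarrow> 'a set" where
  "tube e C = (\<lambda>(q, t). q + t *\<^sub>R e) ` (closure C \<times> {-1..1})"

lemma compact_tube: "bounded C \<Longrightarrow> compact (tube e C)"
  unfolding tube_def
  by (intro compact_continuous_image compact_Times)
     (auto intro!: continuous_intros simp: split_beta)

text \<open>Balls of radius 2 d, centred at multiples of d along the axis, contain the tube. At most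
  5 / d of them are needed, each of volume of order d^n, which leaves the power d^(n-1).\<close>

lemma measure_tube_le:
  fixes e :: "'a::euclidean_space"
  assumes e: "norm e = 1" and C: "bounded C" "C \<noteq> {}" and d: "diameter C < d" "d \<le> 1"
  shows "measure lborel (tube e C) \<le> 5 * 2 ^ DIM('a) * unit_ball_vol DIM('a) * d ^ (DIM('a) - 1)"
proof -
  let ?n = "DIM('a)"
  obtain c where c: "c \<in> C" using C(2) by auto
  have d0: "0 < d" using diameter_ge_0[OF C(1)] d(1) by simp
  define J where "J = \<lceil>1 / d\<rceil>"
  have "0 < 1 / d" using d0 by simp
  then have J0: "0 \<le> J" unfolding J_def by linarith
  have "closure C \<subseteq> cball c d"
  proof (rule closure_minimal)
    show "C \<subseteq> cball c d"
      using diameter_bounded_bound[OF C(1) c] d(1) by fastforce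
  qed simp
  have sub: "tube e C \<subseteq> (\<Union>j\<in>{-J..J}. cball (c + (j * d) *\<^sub>R e) (2 * d))"
  proof
    fix y assume "y \<in> tube e C"
    then obtain q t where y: "y = q + t *\<^sub>R e" and q: "q \<in> closure C" and t: "-1 \<le> t" "t \<le> 1"
      by (auto simp: tube_def)
    have "1 / d \<le> J" by (simp add: J_def)
    define j where "j = \<lfloor>t / d\<rfloor>"
    have "t / d \<le> 1 / d" "- (1 / d) \<le> t / d" using t d0 by (simp_all add: field_simps)
    then have "t / d \<le> J" "- J \<le> t / d" using \<open>1 / d \<le> J\<close> by auto
    then have jJ: "j \<in> {-J..J}" unfolding j_def by (auto simp: le_floor_iff floor_le_iff)
    have "of_int j \<le> t / d" "t / d < of_int j + 1" by (auto simp: j_def)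
    then have tj: "\<bar>t - j * d\<bar> \<le> d" using d0 by (simp add: field_simps)
    have "norm (q - c) \<le> d" using q \<open>closure C \<subseteq> cball c d\<close> by (auto simp: dist_norm norm_minus_commute)
    moreover have "norm ((t - j * d) *\<^sub>R e) \<le> d" using e tj by simp
    moreover have "y - (c + (j * d) *\<^sub>R e) = (q - c) + (t - j * d) *\<^sub>R e" by (simp add: y algebra_simps)
    then have "norm (y - (c + (j * d) *\<^sub>R e)) \<le> norm (q - c) + norm ((t - j * d) *\<^sub>R e)"
      by (simp only: norm_triangle_ineq)
    ultimately have "norm (y - (c + (j * d) *\<^sub>R e)) \<le> 2 * d" by linarith
    then show "y \<in> (\<Union>j\<in>{-J..J}. cball (c + (j * d) *\<^sub>R e) (2 * d))"
      using jJ by (auto simp: dist_norm norm_minus_commute)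
  qed
  have "measure lborel (tube e C) \<le> measure lborel (\<Union>j\<in>{-J..J}. cball (c + (j * d) *\<^sub>R e) (2 * d))"
    using compact_tube[OF C(1), of e] sub
    by (intro measure_mono_fmeasurable) (auto simp: compact_imp_closed borel_closed intro!: fmeasurable_compact compact_UN)
  also have "\<dots> \<le> (\<Sum>j\<in>{-J..J}. measure lborel (cball (c + (j * d) *\<^sub>R e) (2 * d)))"
    by (intro measure_UNION_le) auto
  also have "\<dots> = real (card {-J..J}) * (unit_ball_vol ?n * (2 * d) ^ ?n)"
    using d0 by (simp add: content_cball)
  also have "\<dots> \<le> 5 / d * (unit_ball_vol ?n * (2 * d) ^ ?n)"
  proof (rule mult_right_mono)
    \<comment> \<open>The number of balls is 2 J + 1 \<le> 2 / d + 3 \<le> 5 / d, as d \<le>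
      1.\<close>
    have "real_of_int J \<le> 1 / d + 1" unfolding J_def by linarith
    moreover have "1 \<le> 1 / d" using d0 d(2) by simp
    moreover have "real (card {-J..J}) = 2 * real_of_int J + 1" using J0 by simp
    ultimately show "real (card {-J..J}) \<le> 5 / d" by simp
  qed (use d0 in auto)
  also have "\<dots> = 5 * 2 ^ ?n * unit_ball_vol ?n * d ^ (?n - 1)"
    using d0 by (cases ?n) (simp_all add: power_mult_distrib)
  finally show ?thesis .
qed

text \<open>The ball count requires d strictly above the diameter, which may be 0; letting d
  decrease to the diameter recovers the weight. For n = 1 both sides follow the convention 0^0 =
  1.\<close>

lemma measure_tube_le_hausdorff_weight:
  fixes e :: "'a::euclidean_space"
  assumes e: "norm e = 1" and C: "bounded C" "diameter C < 1"
  shows "measure lborel (tube e C) \<le> 5 * 2 ^ DIM('a) * unit_ball_vol DIM('a) * 2 ^ (DIM('a) - 1)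
    / unit_ball_vol (real (DIM('a) - 1)) * hausdorff_weight (DIM('a) - 1) C"
proof (cases "C = {}")
  case True then show ?thesis by (simp add: tube_def)
next
  case False
  let ?n = "DIM('a)" and ?K = "5 * 2 ^ DIM('a) * unit_ball_vol DIM('a)"
  have "((\<lambda>d. ?K * d ^ (?n - 1)) \<longlongrightarrow> ?K * diameter C ^ (?n - 1)) (at_right (diameter C))"
    by (intro tendsto_intros)
  moreover have "\<forall>\<^sub>F d in at_right (diameter C). measure lborel (tube e C) \<le> ?K * d ^ (?n - 1)"
    using eventually_at_right_real[OF C(2)]
    by eventually_elim (rule measure_tube_le[OF e C(1) False], auto)
  ultimately have "measure lborel (tube e C) \<le> ?K * diameter C ^ (?n - 1)"
    by (intro tendsto_lowerbound[where F = "at_right (diameter C)"]) auto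
  also have "\<dots> = ?K * 2 ^ (?n - 1) / unit_ball_vol (real (?n - 1)) * hausdorff_weight (?n - 1) C"
  proof -
    define v where "v = unit_ball_vol (real (?n - 1))"
    have "0 < v" by (simp add: v_def unit_ball_vol_pos)
    moreover have "hausdorff_weight (?n - 1) C = v * (diameter C ^ (?n - 1) / 2 ^ (?n - 1))"
      using False by (simp add: hausdorff_weight_def v_def power_divide)
    ultimately show ?thesis unfolding v_def[symmetric] by simp
  qed
  finally show ?thesis .
qed

section \<open>Boundary patches have positive and finite surface measure\<close>

context lipschitz_epigraph
begin

text \<open>Sliding \<open>w\<close> along \<open>e\<close> onto the graph yields a frontier point
  \<open>q\<close>. Both the length of the slide and the distance from \<open>q\<close> to
  \<open>y\<close> are below (\<Lambda> + 1) \<rho>, so the slide fits into the tube and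
  \<open>q\<close> is caught by the cover.\<close>

lemma ball_subset_tubes:
  assumes y: "y \<in> frontier \<Omega>" "y \<in> ball z r" and \<rho>: "0 < \<rho>" "(\<Lambda> + 1) * \<rho> \<le> 1"
    and sub: "ball y ((\<Lambda> + 1) * \<rho>) \<subseteq> ball z r"
    and cov: "frontier \<Omega> \<inter> ball y ((\<Lambda> + 1) * \<rho>) \<subseteq> (\<Union>i. C i)"
  shows "ball y \<rho> \<subseteq> (\<Union>i. tube e (C i))"
proof
  fix w assume "w \<in> ball y \<rho>"
  then have w: "dist y w < \<rho>" by simp
  have \<rho>le: "\<rho> \<le> (\<Lambda> + 1) * \<rho>" using \<rho>(1) Lip_nonneg by (simp add: algebra_simps)
  have wb: "w \<in> ball z r" using w \<rho>le sub by (auto simp: subset_iff)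
  have ye: "\<gamma> (orth e y) = y \<bullet> e" using frontier_iff y by blast
  define t where "t = \<gamma> (orth e w) - w \<bullet> e"
  define q where "q = w + t *\<^sub>R e"
  have oq: "orth e q = orth e w" by (simp add: q_def orth_add orth_scaleR orth_self unit)
  have qe: "q \<bullet> e = \<gamma> (orth e w)" using unit by (simp add: q_def t_def inner_add_left norm_eq_1)
  have lip: "\<bar>\<gamma> (orth e w) - y \<bullet> e\<bar> \<le> \<Lambda> * dist y w"
    using Lip'[OF wb y(2)] ye by (simp add: dist_commute)
  have "\<bar>t\<bar> \<le> \<bar>\<gamma> (orth e w) - y \<bullet> e\<bar> + \<bar>(y - w) \<bullet> e\<bar>"
    by (simp add: t_def inner_diff_left)
  also have "\<dots> \<le> \<Lambda> * dist y w + dist y w"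
    using lip abs_inner_unit_le[OF unit, of "y - w"] by (simp add: dist_norm)
  also have "\<dots> = (\<Lambda> + 1) * dist y w" by (simp add: algebra_simps)
  also have "\<dots> < (\<Lambda> + 1) * \<rho>" using w Lip_nonneg by (intro mult_strict_left_mono) auto
  finally have t: "\<bar>t\<bar> \<le> 1" using \<rho>(2) by simp
  have "q - y = orth e (w - y) + (\<gamma> (orth e w) - y \<bullet> e) *\<^sub>R e"
    using orth_decomp[of q e] orth_decomp[of y e] oq qe by (simp add: orth_diff algebra_simps)
  then have "norm (q - y) \<le> norm (orth e (w - y)) + \<bar>\<gamma> (orth e w) - y \<bullet> e\<bar>"
    using norm_triangle_ineq[of "orth e (w - y)" "(\<gamma> (orth e w) - y \<bullet> e) *\<^sub>R e"] unit by simp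
  also have "\<dots> \<le> dist y w + \<Lambda> * dist y w"
    using lip norm_orth_le[OF unit, of "w - y"] by (simp add: dist_norm norm_minus_commute)
  also have "\<dots> = (\<Lambda> + 1) * dist y w" by (simp add: algebra_simps)
  also have "\<dots> < (\<Lambda> + 1) * \<rho>" using w Lip_nonneg by (intro mult_strict_left_mono) auto
  finally have qb: "q \<in> ball y ((\<Lambda> + 1) * \<rho>)" by (simp add: dist_norm norm_minus_commute)
  then have "q \<in> frontier \<Omega>" using frontier_iff[of q] sub oq qe by auto
  with qb cov obtain i where "q \<in> C i" by blast
  then have "q \<in> closure (C i)" using closure_subset by blast
  moreover have "w = q + (- t) *\<^sub>R e" by (simp add: q_def)
  ultimately have "w \<in> tube e (C i)"
    unfolding tube_def using t by (intro image_eqI[of _ _ "(q, - t)"]) auto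
  then show "w \<in> (\<Union>i. tube e (C i))" by blast
qed

text \<open>The tubes over any fine cover of the patch contain one fixed ball, so the volume of this
  ball bounds the total weight from below, whatever the cover.\<close>

lemma hausdorff_outer_frontier_pos:
  assumes y: "y \<in> frontier \<Omega>" "y \<in> ball z r" and d: "0 < d"
  shows "0 < hausdorff_outer (DIM('a) - 1) (frontier \<Omega> \<inter> ball y d)"
proof -
  let ?n = "DIM('a)"
  define K where "K = 5 * 2 ^ ?n * unit_ball_vol ?n * 2 ^ (?n - 1) / unit_ball_vol (real (?n - 1))"
  have K: "0 < K" by (simp add: K_def unit_ball_vol_pos)
  \<comment> \<open>The bound 1 limits the slide along a tube, \<open>d\<close> keeps the projected
    points in the covered patch, and the last term keeps everything in the chart.\<close>
  define s where "s = min 1 (min d (r - dist z y))"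
  have s: "0 < s" "s \<le> 1" "s \<le> d" "s \<le> r - dist z y" using d y by (auto simp: s_def)
  define \<rho> where "\<rho> = s / (\<Lambda> + 1)"
  have \<rho>: "0 < \<rho>" "(\<Lambda> + 1) * \<rho> = s" using s(1) Lip_nonneg by (auto simp: \<rho>_def)
  have sub: "ball y s \<subseteq> ball z r"
  proof
    fix w assume "w \<in> ball y s"
    then show "w \<in> ball z r" using s(4) dist_triangle[of z w y] by simp
  qed
  have bound: "ennreal (measure lborel (ball y \<rho>)) \<le> ennreal K * (\<Sum>i. ennreal (hausdorff_weight (?n - 1) (C i)))"
    if C: "\<forall>i. bounded (C i) \<and> diameter (C i) \<le> 1/2" "frontier \<Omega> \<inter> ball y d \<subseteq> (\<Union>i. C i)" for C
  proof -
    have "ball y \<rho> \<subseteq> (\<Union>i. tube e (C i))"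
    proof (rule ball_subset_tubes[OF y \<rho>(1)])
      show "frontier \<Omega> \<inter> ball y ((\<Lambda> + 1) * \<rho>) \<subseteq> (\<Union>i. C i)"
        using C(2) s(3) \<rho>(2) by (auto simp: subset_iff)
    qed (use \<rho> s sub in auto)
    moreover have tb: "tube e (C i) \<in> sets lborel" for i
      using compact_tube[of "C i" e] C(1) by (simp add: borel_compact)
    ultimately have "emeasure lborel (ball y \<rho>) \<le> emeasure lborel (\<Union>i. tube e (C i))"
      by (intro emeasure_mono) auto
    also have "\<dots> \<le> (\<Sum>i. emeasure lborel (tube e (C i)))"
      using tb by (intro emeasure_subadditive_countably) auto
    also have "\<dots> \<le> (\<Sum>i. ennreal K * ennreal (hausdorff_weight (?n - 1) (C i)))"
    proof (intro suminf_le)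
      fix i
      have "emeasure lborel (tube e (C i)) = ennreal (measure lborel (tube e (C i)))"
        using emeasure_compact_finite[OF compact_tube[of "C i" e]] C(1)
        by (intro emeasure_eq_ennreal_measure) (simp add: less_top)
      also have "\<dots> \<le> ennreal (K * hausdorff_weight (?n - 1) (C i))"
      proof (rule ennreal_leI)
        have "diameter (C i) \<le> 1 / 2" using C(1) by blast
        then show "measure lborel (tube e (C i)) \<le> K * hausdorff_weight (?n - 1) (C i)"
          using measure_tube_le_hausdorff_weight[OF unit, of "C i"] C(1) by (simp add: K_def)
      qed
      also have "\<dots> = ennreal K * ennreal (hausdorff_weight (?n - 1) (C i))"
        using K C(1) by (intro ennreal_mult) (auto intro: hausdorff_weight_nonneg)
      finally show "emeasure lborel (tube e (C i)) \<le> ennreal K * ennreal (hausdorff_weight (?n - 1) (C i))" .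
    qed auto
    also have "\<dots> = ennreal K * (\<Sum>i. ennreal (hausdorff_weight (?n - 1) (C i)))"
      by (rule ennreal_suminf_cmult)
    also have "emeasure lborel (ball y \<rho>) = ennreal (measure lborel (ball y \<rho>))"
      using emeasure_lborel_ball_finite[of y \<rho>] by (intro emeasure_eq_ennreal_measure) auto
    finally show ?thesis .
  qed
  have pos: "0 < measure lborel (ball y \<rho>)" using \<rho>(1) by (simp add: content_ball_pos)
  have "ennreal (measure lborel (ball y \<rho>) / K) \<le> hausdorff_pre (?n - 1) (1/2) (frontier \<Omega> \<inter> ball y d)"
    unfolding hausdorff_pre_def
  proof (rule INF_greatest, clarify)
    fix C :: "nat \<Rightarrow> 'a set"
    assume C: "\<forall>i. bounded (C i) \<and> diameter (C i) \<le> 1/2" "frontier \<Omega> \<inter> ball y d \<subseteq> (\<Union>i. C i)"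
    have "ennreal (measure lborel (ball y \<rho>) / K) = ennreal (measure lborel (ball y \<rho>)) / ennreal K"
      using K by (simp add: divide_ennreal)
    also have "\<dots> \<le> ennreal K * (\<Sum>i. ennreal (hausdorff_weight (?n - 1) (C i))) / ennreal K"
      using bound[OF C] by (rule divide_right_mono_ennreal)
    also have "\<dots> = (\<Sum>i. ennreal (hausdorff_weight (?n - 1) (C i)))"
      unfolding mult.commute[of "ennreal K"] by (rule ennreal_mult_divide_eq) (use K in auto)
    finally show "ennreal (measure lborel (ball y \<rho>) / K) \<le> (\<Sum>i. ennreal (hausdorff_weight (?n - 1) (C i)))" .
  qed
  also have "\<dots> \<le> hausdorff_outer (?n - 1) (frontier \<Omega> \<inter> ball y d)"
    by (rule hausdorff_pre_le_outer) simp
  finally have "ennreal (measure lborel (ball y \<rho>) / K) \<le> hausdorff_outer (?n - 1) (frontier \<Omega> \<inter> ball y d)" .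
  moreover have "0 < ennreal (measure lborel (ball y \<rho>) / K)" using pos K by simp
  ultimately show ?thesis by (rule less_le_trans[rotated])
qed

text \<open>A volume count. Over each point of \<open>S\<close> stands a column of about 1 / \<tau>
  balls of radius \<tau>, spaced by 2 \<tau> along \<open>e\<close>, of total volume of order
  \<tau>^(n-1). The columns are disjoint and lie in one fixed ball.\<close>

lemma card_separated_le:
  fixes \<tau> :: real
  assumes S: "finite S" "S \<subseteq> frontier \<Omega> \<inter> ball z r" and \<tau>: "0 < \<tau>" "\<tau> \<le> 1"
    and sep: "\<And>x y. x \<in> S \<Longrightarrow> y \<in> S \<Longrightarrow> x \<noteq> y \<Longrightarrow> 2 * (\<Lambda> + 1) * \<tau> \<le> dist x y"
  shows "card S * \<tau> ^ (DIM('a) - 1) \<le> (r + 5) ^ DIM('a)"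
proof -
  let ?n = "DIM('a)"
  define J where "J = nat \<lceil>1 / \<tau>\<rceil>"
  have "0 < 1 / \<tau>" using \<tau>(1) by simp
  then have J: "1 / \<tau> \<le> J" "J \<le> 1 / \<tau> + 1" unfolding J_def by linarith+
  define B where "B p = ball (fst p + (2 * real (snd p) * \<tau>) *\<^sub>R e) \<tau>" for p :: "'a \<times> nat"
  have disj: "disjoint_family_on B (S \<times> {..<J})"
    unfolding disjoint_family_on_def
  proof (intro ballI impI)
    fix p q assume p: "p \<in> S \<times> {..<J}" and q: "q \<in> S \<times> {..<J}" and ne: "p \<noteq> q"
    obtain x i y j where pq: "p = (x, i)" "q = (y, j)" by (metis surj_pair)
    have xS: "x \<in> S" "y \<in> S" using p q pq by auto
    show "B p \<inter> B q = {}"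
    proof (rule ccontr)
      assume "B p \<inter> B q \<noteq> {}"
      then obtain w where "dist (x + (2 * real i * \<tau>) *\<^sub>R e) w < \<tau>" "dist (y + (2 * real j * \<tau>) *\<^sub>R e) w < \<tau>"
        by (auto simp: B_def pq)
      then have lt: "dist (x + (2 * real i * \<tau>) *\<^sub>R e) (y + (2 * real j * \<tau>) *\<^sub>R e) < 2 * \<tau>"
        using dist_triangle2[of "x + (2 * real i * \<tau>) *\<^sub>R e" "y + (2 * real j * \<tau>) *\<^sub>R e" w] by simp
      define v where "v = x + (2 * real i * \<tau>) *\<^sub>R e - (y + (2 * real j * \<tau>) *\<^sub>R e)"
      have v: "norm v < 2 * \<tau>" using lt by (simp add: v_def dist_norm)
      show False
      proof (cases "x = y")
        case True
        then have "i \<noteq> j" using ne pq by simp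
        then have "1 \<le> \<bar>real i - real j\<bar>" by linarith
        moreover have "v = (2 * \<tau> * (real i - real j)) *\<^sub>R e" using True by (simp add: v_def algebra_simps)
        then have "norm v = 2 * \<tau> * \<bar>real i - real j\<bar>" using \<tau>(1) unit by (simp add: abs_mult)
        ultimately show False using v \<tau>(1) by simp
      next
        case False
        \<comment> \<open>Overlapping balls force the projections of x and y closer than 2 \<tau>;
          on the graph this puts x and y closer than 2 (\<Lambda> + 1) \<tau>, against the
          separation.\<close>
        have "orth e v = orth e x - orth e y"
          by (simp add: v_def orth_diff orth_add orth_scaleR orth_self unit)
        then have o: "norm (orth e x - orth e y) < 2 * \<tau>" using norm_orth_le[OF unit, of v] v by simp
        have b: "x \<in> ball z r" "y \<in> ball z r" "x \<in> frontier \<Omega>" "y \<in> frontier \<Omega>" using xS S(2) by auto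
        then have g: "\<gamma> (orth e x) = x \<bullet> e" "\<gamma> (orth e y) = y \<bullet> e" using frontier_iff by blast+
        have "x - y = (orth e x - orth e y) + (x \<bullet> e - y \<bullet> e) *\<^sub>R e"
          using orth_decomp[of x e] orth_decomp[of y e] by (simp add: algebra_simps)
        then have "dist x y \<le> norm (orth e x - orth e y) + \<bar>x \<bullet> e - y \<bullet> e\<bar>"
          using norm_triangle_ineq[of "orth e x - orth e y" "(x \<bullet> e - y \<bullet> e) *\<^sub>R e"] unit by (simp add: dist_norm)
        also have "\<dots> \<le> (\<Lambda> + 1) * norm (orth e x - orth e y)"
          using Lip[OF b(1,2)] g by (simp add: algebra_simps)
        also have "\<dots> < (\<Lambda> + 1) * (2 * \<tau>)" using o Lip_nonneg by (intro mult_strict_left_mono) auto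
        finally show False using sep[OF xS False] by simp
      qed
    qed
  qed
  \<comment> \<open>Centres rise by at most 2 (1 / \<tau> + 1) \<tau> \<le> 4 above the patch, and
    the radius \<tau> adds at most 1.\<close>
  have sub: "(\<Union>p\<in>S \<times> {..<J}. B p) \<subseteq> ball z (r + 5)"
  proof
    fix w assume "w \<in> (\<Union>p\<in>S \<times> {..<J}. B p)"
    then obtain x i where x: "x \<in> S" and i: "i < J" and w: "dist (x + (2 * real i * \<tau>) *\<^sub>R e) w < \<tau>"
      by (auto simp: B_def)
    have "real i \<le> real J" using i by simp
    then have "2 * real i * \<tau> \<le> 2 * (1 / \<tau> + 1) * \<tau>" using J(2) \<tau>(1) by (intro mult_right_mono) auto
    also have "\<dots> \<le> 4" using \<tau> by (simp add: algebra_simps)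
    finally have "norm ((2 * real i * \<tau>) *\<^sub>R e) \<le> 4" using unit \<tau>(1) by simp
    then have "dist x (x + (2 * real i * \<tau>) *\<^sub>R e) \<le> 4" by (simp add: dist_norm)
    moreover have "dist z x < r" using x S(2) by auto
    ultimately have "dist z w < r + 5"
      using w \<tau>(2) dist_triangle[of z w x] dist_triangle[of x w "x + (2 * real i * \<tau>) *\<^sub>R e"] by linarith
    then show "w \<in> ball z (r + 5)" by simp
  qed
  have "real (card S * J) * (unit_ball_vol ?n * \<tau> ^ ?n) = (\<Sum>p\<in>S \<times> {..<J}. measure lborel (B p))"
    using \<tau>(1) by (simp add: B_def content_ball card_cartesian_product)
  also have "\<dots> = measure lborel (\<Union>p\<in>S \<times> {..<J}. B p)"
  proof (rule measure_finite_Union[symmetric])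
    show "disjoint_family_on B (S \<times> {..<J})" by (rule disj)
  qed (use S(1) emeasure_lborel_ball_finite in \<open>auto simp: B_def less_top[symmetric]\<close>)
  also have "\<dots> \<le> measure lborel (ball z (r + 5))"
    using S(1) sub emeasure_lborel_ball_finite[of z "r + 5"]
    by (intro measure_mono_fmeasurable fmeasurableI) (auto simp: B_def)
  also have "\<dots> = unit_ball_vol ?n * (r + 5) ^ ?n" using r_pos by (simp add: content_ball)
  finally have "real (card S) * real J * \<tau> ^ ?n \<le> (r + 5) ^ ?n"
    using unit_ball_vol_pos[of "real ?n"] by (simp add: mult.left_commute mult.commute)
  moreover have "real (card S) * \<tau> ^ (?n - 1) \<le> real (card S) * real J * \<tau> ^ ?n"
  proof -
    have "\<tau> ^ (?n - 1) = 1 / \<tau> * \<tau> ^ ?n" using \<tau>(1) by (cases ?n) auto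
    also have "\<dots> \<le> real J * \<tau> ^ ?n" using J(1) \<tau>(1) by (intro mult_right_mono) auto
    finally show ?thesis by (simp add: mult.assoc mult_left_mono)
  qed
  ultimately show ?thesis by simp
qed

text \<open>The balls about a maximal separated subset of the patch cover it, and the packing count
  bounds their number. The powers of \<tau> cancel, so the bound \<open>K\<close> is the same for
  all \<delta>.\<close>

lemma hausdorff_outer_frontier_finite:
  "hausdorff_outer (DIM('a) - 1) (frontier \<Omega> \<inter> ball z r) < \<infinity>"
proof -
  let ?n = "DIM('a)" and ?G = "frontier \<Omega> \<inter> ball z r"
  define K where "K = (r + 5) ^ ?n * (unit_ball_vol (real (?n - 1)) * (2 * (\<Lambda> + 1)) ^ (?n - 1))"
  have "hausdorff_pre (?n - 1) \<delta> ?G \<le> ennreal K" if \<delta>: "0 < \<delta>" for \<delta>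
  proof -
    \<comment> \<open>Chosen so that balls of radius 2 (\<Lambda> + 1) \<tau> have diameter at most
      \<delta>; the cap 1 is what the packing count asks for.\<close>
    define \<tau> where "\<tau> = min 1 (\<delta> / (4 * (\<Lambda> + 1)))"
    have \<tau>: "0 < \<tau>" "\<tau> \<le> 1" "\<tau> \<le> \<delta> / (4 * (\<Lambda> + 1))" using \<delta> Lip_nonneg by (auto simp: \<tau>_def)
    define d where "d = 2 * (\<Lambda> + 1) * \<tau>"
    have d: "0 < d" using \<tau>(1) Lip_nonneg by (simp add: d_def)
    have "\<tau> * (4 * (\<Lambda> + 1)) \<le> \<delta>" using \<tau>(3) Lip_nonneg by (simp add: pos_le_divide_eq)
    then have d\<delta>: "2 * d \<le> \<delta>" by (simp add: d_def algebra_simps)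
    define P where "P S \<longleftrightarrow> finite S \<and> S \<subseteq> ?G \<and> (\<forall>x\<in>S. \<forall>y\<in>S. x \<noteq> y \<longrightarrow> d \<le> dist x y)" for S
    have card: "card S * \<tau> ^ (?n - 1) \<le> (r + 5) ^ ?n" if "P S" for S
    proof (rule card_separated_le)
      show "finite S" "S \<subseteq> ?G" using that by (auto simp: P_def)
      show "2 * (\<Lambda> + 1) * \<tau> \<le> dist x y" if "x \<in> S" "y \<in> S" "x \<noteq> y" for x y
        using that \<open>P S\<close> by (auto simp: P_def d_def)
    qed (use \<tau> in auto)
    have "\<exists>S. P S \<and> (\<forall>S'. P S' \<longrightarrow> card S' \<le> card S)"
    proof (rule ex_has_greatest_nat[where f = card and k = "{}"])
      show "P {}" by (simp add: P_def)
      show "\<forall>S. P S \<longrightarrow> card S < nat \<lceil>(r + 5) ^ ?n / \<tau> ^ (?n - 1)\<rceil> + 1"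
      proof (intro allI impI)
        fix S assume "P S"
        then have "real (card S) \<le> (r + 5) ^ ?n / \<tau> ^ (?n - 1)"
          using card[of S] \<tau>(1) by (simp add: pos_le_divide_eq)
        then show "card S < nat \<lceil>(r + 5) ^ ?n / \<tau> ^ (?n - 1)\<rceil> + 1" by linarith
      qed
    qed
    then obtain S where S: "P S" "\<And>S'. P S' \<Longrightarrow> card S' \<le> card S" by blast
    have cov: "?G \<subseteq> (\<Union>x\<in>S. cball x d)"
    proof
      fix w assume w: "w \<in> ?G"
      show "w \<in> (\<Union>x\<in>S. cball x d)"
      proof (rule ccontr)
        assume "\<not> ?thesis"
        then have far: "d < dist x w" if "x \<in> S" for x using that by auto
        then have "w \<notin> S" using d by force
        have "P (insert w S)"
          using S(1) w far unfolding P_def by (auto simp: dist_commute less_imp_le)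
        then have "card (insert w S) \<le> card S" by (rule S(2))
        then show False using \<open>w \<notin> S\<close> S(1) by (simp add: P_def)
      qed
    qed
    have "hausdorff_pre (?n - 1) \<delta> ?G \<le> (\<Sum>x\<in>S. ennreal (hausdorff_weight (?n - 1) (cball x d)))"
      using S(1) d d\<delta> \<delta> cov unfolding P_def
      by (intro hausdorff_pre_finite_cover_le) (auto simp: diameter_cball)
    also have "\<dots> = ennreal (card S * (unit_ball_vol (real (?n - 1)) * d ^ (?n - 1)))"
      using d by (simp add: hausdorff_weight_def diameter_cball ennreal_mult ennreal_of_nat_eq_real_of_nat)
    also have "\<dots> \<le> ennreal K"
    proof (rule ennreal_leI)
      have "card S * (unit_ball_vol (real (?n - 1)) * d ^ (?n - 1)) =
          (card S * \<tau> ^ (?n - 1)) * (unit_ball_vol (real (?n - 1)) * (2 * (\<Lambda> + 1)) ^ (?n - 1))"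
        by (simp add: d_def power_mult_distrib)
      also have "\<dots> \<le> K"
        unfolding K_def using Lip_nonneg by (intro mult_right_mono card S) auto
      finally show "card S * (unit_ball_vol (real (?n - 1)) * d ^ (?n - 1)) \<le> K" .
    qed
    finally show ?thesis .
  qed
  then have "hausdorff_outer (?n - 1) ?G \<le> ennreal K"
    unfolding hausdorff_outer_def by (intro SUP_least) auto
  also have "\<dots> < \<infinity>" by simp
  finally show ?thesis .
qed

end

section \<open>Smooth bump functions\<close>

text \<open>A syntactic class made to be closed under directional derivatives. The rule
  \<open>comp\<close> takes a whole sequence \<open>H\<close> in which each member is the derivative
  of the previous one, so the chain rule leads from \<open>H j\<close> to \<open>H (Suc j)\<close>
  without leaving the class.\<close>

inductive smooth_fun :: "('a::real_inner \<Rightarrow> real) \<Rightarrow> bool" where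
  const: "smooth_fun (\<lambda>_. c)"
| inner: "smooth_fun (\<lambda>x. x \<bullet> v)"
| add: "smooth_fun f \<Longrightarrow> smooth_fun g \<Longrightarrow> smooth_fun (\<lambda>x. f x + g x)"
| mult: "smooth_fun f \<Longrightarrow> smooth_fun g \<Longrightarrow> smooth_fun (\<lambda>x. f x * g x)"
| comp: "(\<And>k t. (H k has_real_derivative H (Suc k) t) (at t)) \<Longrightarrow> smooth_fun f \<Longrightarrow>
    smooth_fun (\<lambda>x. H j (f x))"

lemma smooth_fun_has_derivative:
  assumes "smooth_fun f"
  shows "\<exists>D. (\<forall>b. smooth_fun (\<lambda>x. D x b)) \<and> (\<forall>x. (f has_derivative D x) (at x))"
  using assms
proof induction
  case (const c)
  show ?case by (rule exI[of _ "\<lambda>_ _. 0"]) (auto intro: smooth_fun.const)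
next
  case (inner v)
  show ?case
    by (rule exI[of _ "\<lambda>_ h. h \<bullet> v"])
       (auto intro!: smooth_fun.const derivative_eq_intros)
next
  case (add f g)
  then obtain D E where D: "\<And>b. smooth_fun (\<lambda>x. D x b)" "\<And>x. (f has_derivative D x) (at x)"
    and E: "\<And>b. smooth_fun (\<lambda>x. E x b)" "\<And>x. (g has_derivative E x) (at x)" by blast
  show ?case
    by (rule exI[of _ "\<lambda>x h. D x h + E x h"])
       (intro conjI allI smooth_fun.add has_derivative_add D E)
next
  case (mult f g)
  then obtain D E where D: "\<And>b. smooth_fun (\<lambda>x. D x b)" "\<And>x. (f has_derivative D x) (at x)"
    and E: "\<And>b. smooth_fun (\<lambda>x. E x b)" "\<And>x. (g has_derivative E x) (at x)" by blast
  show ?case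
    by (rule exI[of _ "\<lambda>x h. f x * E x h + D x h * g x"])
       (intro conjI allI smooth_fun.add smooth_fun.mult has_derivative_mult D E mult.hyps)
next
  case (comp H f j)
  obtain D where D: "\<And>b. smooth_fun (\<lambda>x. D x b)" "\<And>x. (f has_derivative D x) (at x)"
    using comp.IH by blast
  have "smooth_fun (\<lambda>x. H (Suc j) (f x))"
    by (rule smooth_fun.comp[where H = H and f = f and j = "Suc j", OF comp.hyps(1,2)])
  moreover have "((\<lambda>x. H j (f x)) has_derivative (\<lambda>h. H (Suc j) (f x) * D x h)) (at x)" for x
    using diff_chain_at[OF D(2), of "H j" "\<lambda>h. H (Suc j) (f x) * h" x] comp.hyps(1)[of j "f x"]
    by (simp add: o_def has_field_derivative_def)
  ultimately show ?case
    by (intro exI[of _ "\<lambda>x h. H (Suc j) (f x) * D x h"] conjI allI smooth_fun.mult D(1))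
qed

lemma smooth_fun_differentiable: "smooth_fun f \<Longrightarrow> f differentiable (at x)"
  by (meson smooth_fun_has_derivative differentiable_def)

lemma smooth_fun_continuous_on: "smooth_fun f \<Longrightarrow> continuous_on S f"
  by (simp add: differentiable_imp_continuous_within smooth_fun_differentiable
      continuous_at_imp_continuous_on)

lemma smooth_fun_frechet_derivative:
  assumes "smooth_fun f"
  shows "smooth_fun (\<lambda>x. frechet_derivative f (at x) b)"
proof -
  obtain D where D: "\<forall>b. smooth_fun (\<lambda>x. D x b)" "\<forall>x. (f has_derivative D x) (at x)"
    using smooth_fun_has_derivative[OF assms] by blast
  have "frechet_derivative f (at x) = D x" for x
    using frechet_derivative_at[of f "D x" x] D(2) by simp
  then show ?thesis using D(1) by simp
qed

lemma smooth_fun_C_k: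
  fixes f :: "'a::euclidean_space \<Rightarrow> real"
  shows "smooth_fun f \<Longrightarrow> C_k k f"
  by (induction k arbitrary: f)
     (auto intro: smooth_fun_continuous_on smooth_fun_differentiable smooth_fun_frechet_derivative)

lemma smooth_fun_sum:
  assumes "finite A" "\<And>i. i \<in> A \<Longrightarrow> smooth_fun (f i)"
  shows "smooth_fun (\<lambda>x. \<Sum>i\<in>A. f i x)"
  using assms
proof (induction A rule: finite_induct)
  case (insert i A)
  then have "smooth_fun (\<lambda>x. f i x + (\<Sum>i\<in>A. f i x))" by (intro smooth_fun.add) auto
  then show ?case using insert.hyps by simp
qed (simp add: smooth_fun.const)

lemma smooth_fun_affine: "smooth_fun f \<Longrightarrow> smooth_fun (\<lambda>y. f (a *\<^sub>R y + w))"
proof (induction rule: smooth_fun.induct)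
  case (inner v)
  have "smooth_fun (\<lambda>y. a * (y \<bullet> v) + w \<bullet> v)"
    by (intro smooth_fun.add smooth_fun.mult smooth_fun.const smooth_fun.inner)
  then show ?case by (simp add: inner_add_left)
next
  case (comp H f j)
  show ?case by (rule smooth_fun.comp[where H = H, OF comp.hyps(1) comp.IH])
qed (simp_all add: smooth_fun.const smooth_fun.add smooth_fun.mult)

lemma smooth_fun_norm_power2:
  fixes c :: "'a::euclidean_space"
  shows "smooth_fun (\<lambda>x. (norm (x - c))\<^sup>2)"
proof -
  have "smooth_fun (\<lambda>x::'a. \<Sum>b\<in>Basis. (x \<bullet> b + - (c \<bullet> b)) * (x \<bullet> b + - (c \<bullet> b)))"
    by (intro smooth_fun_sum smooth_fun.intros finite_Basis)
  then show ?thesis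
    by (subst power2_norm_eq_inner, subst euclidean_inner) (simp add: inner_diff_left)
qed

text \<open>P = 1 gives the flat function exp(-1/t). Polynomial factors make the family stable under
  differentiation: z = 1/t satisfies z' = -z^2, so P turns into z^2 (P - P').\<close>

definition flat_exp :: "real poly \<Rightarrow> real \<Rightarrow> real" where
  "flat_exp P t = (if 0 < t then poly P (1 / t) * exp (- (1 / t)) else 0)"

lemma flat_exp_tendsto_0:
  fixes P :: "real poly"
  shows "((\<lambda>t. poly P (1 / t) * exp (- (1 / t))) \<longlongrightarrow> 0) (at_right 0)"
proof -
  have "((\<lambda>z. \<Sum>i\<le>degree P. coeff P i * (z ^ i / exp z)) \<longlongrightarrow> (\<Sum>i\<le>degree P. coeff P i * 0)) at_top"
    by (intro tendsto_sum tendsto_mult_left) (rule tendsto_power_div_exp_0)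
  then have "((\<lambda>z. poly P z * exp (- z)) \<longlongrightarrow> 0) at_top"
    by (simp add: poly_altdef exp_minus sum_distrib_right divide_inverse mult.assoc)
  then have "((\<lambda>t. poly P (inverse t) * exp (- inverse t)) \<longlongrightarrow> 0) (at_right 0)"
    by (rule filterlim_compose[OF _ filterlim_inverse_at_top_right])
  then show ?thesis by (simp add: inverse_eq_divide)
qed

lemma has_real_derivative_flat_exp:
  "(flat_exp P has_real_derivative flat_exp ([:0, 0, 1:] * (P - pderiv P)) t) (at t)"
proof -
  consider "t > 0" | "t < 0" | "t = 0" by linarith
  then show ?thesis
  proof cases
    case 1
    have "((\<lambda>t. poly P (1 / t) * exp (- (1 / t))) has_real_derivative
        flat_exp ([:0, 0, 1:] * (P - pderiv P)) t) (at t)"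
      using 1 by (auto intro!: derivative_eq_intros poly_DERIV[THEN DERIV_chain2]
          simp: flat_exp_def field_simps power2_eq_square)
    then show ?thesis
      by (rule DERIV_cong_ev[THEN iffD1, rotated 3])
         (use 1 in \<open>auto simp: flat_exp_def intro!: eventually_mono[OF eventually_nhds_in_open[of "{0<..}"]]\<close>)
  next
    case 2
    have "((\<lambda>t. 0) has_real_derivative 0) (at t)" by simp
    then show ?thesis
      by (rule DERIV_cong_ev[THEN iffD1, rotated 3])
         (use 2 in \<open>auto simp: flat_exp_def intro!: eventually_mono[OF eventually_nhds_in_open[of "{..<0}"]]\<close>)
  next
    case 3
    \<comment> \<open>The difference quotient at 0 is again a member of the family, with polynomial
      z P, so the one limit above serves all derivatives.\<close>
    have "((\<lambda>h. flat_exp P h / h) \<longlongrightarrow> 0) (at_right 0)"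
    proof (rule Lim_transform_eventually[OF flat_exp_tendsto_0[of "[:0, 1:] * P"]])
      show "\<forall>\<^sub>F h in at_right 0. poly ([:0, 1:] * P) (1 / h) * exp (- (1 / h)) = flat_exp P h / h"
        by (rule eventually_mono[OF eventually_at_right_less[of 0]]) (auto simp: flat_exp_def)
    qed
    moreover have "((\<lambda>h. flat_exp P h / h) \<longlongrightarrow> 0) (at_left 0)"
      by (rule Lim_transform_eventually[OF tendsto_const])
         (auto simp: flat_exp_def eventually_at_left_field intro!: exI[of _ "-1"])
    ultimately have "((\<lambda>h. flat_exp P h / h) \<longlongrightarrow> 0) (at 0)"
      by (simp add: filterlim_split_at)
    then show ?thesis using 3 by (simp add: DERIV_def flat_exp_def)
  qed
qed

text \<open>The standard mollifier on the unit ball about \<open>c\<close>, unnormalized. The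
  squared norm is a polynomial in the coordinates, hence smooth also at the centre.\<close>

definition bump :: "'a::euclidean_space \<Rightarrow> 'a \<Rightarrow> real" where
  "bump c z = flat_exp 1 (1 - (norm (z - c))\<^sup>2)"

lemma smooth_fun_bump: "smooth_fun (bump c)"
proof -
  \<comment> \<open>The successive derivatives of \<open>flat_exp 1\<close>, as the rule
    \<open>comp\<close> requires.\<close>
  define H where "H k = flat_exp (((\<lambda>P. [:0, 0, 1:] * (P - pderiv P)) ^^ k) 1)" for k
  have H: "(H k has_real_derivative H (Suc k) t) (at t)" for k t
    using has_real_derivative_flat_exp by (simp add: H_def)
  have "smooth_fun (\<lambda>z. 1 + (-1) * (norm (z - c))\<^sup>2)"
    by (rule smooth_fun.add[OF smooth_fun.const smooth_fun.mult[OF smooth_fun.const smooth_fun_norm_power2]])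
  then have "smooth_fun (\<lambda>z. H 0 (1 + (-1) * (norm (z - c))\<^sup>2))"
    by (rule smooth_fun.comp[where H = H, OF H])
  then show ?thesis by (simp add: H_def bump_def[abs_def])
qed

lemma bump_nonneg: "0 \<le> bump c z"
  by (simp add: bump_def flat_exp_def)

lemma bump_le_1: "bump c z \<le> 1"
  by (simp add: bump_def flat_exp_def)

lemma bump_pos_iff: "0 < bump c z \<longleftrightarrow> dist c z < 1"
proof -
  have "0 < 1 - (norm (z - c))\<^sup>2 \<longleftrightarrow> norm (z - c) < 1"
    by (simp add: power_less_one_iff)
  then show ?thesis by (simp add: bump_def flat_exp_def dist_norm norm_minus_commute)
qed

lemma bump_eq_0: "1 \<le> dist c z \<Longrightarrow> bump c z = 0"
  using bump_pos_iff[of c z] bump_nonneg[of c z] by linarith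

section \<open>Weak gradients and test functions\<close>

lemma has_integral_UNIV_iff_support:
  fixes f :: "'a::euclidean_space \<Rightarrow> 'b::banach"
  assumes "\<And>x. x \<notin> S \<Longrightarrow> f x = 0"
  shows "(f has_integral i) UNIV \<longleftrightarrow> (f has_integral i) S"
proof -
  have "f = (\<lambda>x. if x \<in> S then f x else 0)" using assms by auto
  then show ?thesis using has_integral_restrict_UNIV[of S f i] by simp
qed

lemma has_integral_UNIV_affinity:
  fixes f :: "'a::euclidean_space \<Rightarrow> real"
  assumes "(f has_integral i) UNIV" "\<And>x. x \<notin> cbox a b \<Longrightarrow> f x = 0" "m > 0"
  shows "((\<lambda>x. f (m *\<^sub>R x + c)) has_integral i / m ^ DIM('a)) UNIV"
proof -
  have "((\<lambda>x. f (m *\<^sub>R x + c)) has_integral (i /\<^sub>R m ^ DIM('a)))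
      (cbox ((a - c) /\<^sub>R m) ((b - c) /\<^sub>R m))"
    using assms has_integral_UNIV_iff_support[where S = "cbox a b" and f = f]
    by (intro has_integral_affinity') auto
  moreover have "f (m *\<^sub>R x + c) = 0" if "x \<notin> cbox ((a - c) /\<^sub>R m) ((b - c) /\<^sub>R m)" for x
  proof (rule assms(2), rule notI)
    assume "m *\<^sub>R x + c \<in> cbox a b"
    then have "x \<in> cbox ((a - c) /\<^sub>R m) ((b - c) /\<^sub>R m)"
      using \<open>m > 0\<close> by (auto simp: mem_box inner_simps field_simps)
    with that show False ..
  qed
  ultimately show ?thesis
    by (simp add: has_integral_UNIV_iff_support[where S = "cbox ((a - c) /\<^sub>R m) ((b - c) /\<^sub>R m)"]
        divide_inverse mult.commute)
qed

text \<open>Links the Lebesgue integral over \<Omega> in \<open>has_weak_gradient\<close> to the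
  gauge integral on the whole space, where affine substitution and differentiation under the
  integral take place.\<close>

lemma continuous_compact_support:
  fixes f :: "'a::euclidean_space \<Rightarrow> real"
  assumes "continuous_on UNIV f" "bounded {x. f x \<noteq> 0}" "{x. f x \<noteq> 0} \<subseteq> \<Omega>" "\<Omega> \<in> sets lebesgue"
  shows integrable_continuous_compact_support: "integrable (lebesgue_on \<Omega>) f"
    and has_integral_continuous_compact_support: "(f has_integral (LINT x|lebesgue_on \<Omega>. f x)) UNIV"
proof -
  obtain a where a: "{x. f x \<noteq> 0} \<subseteq> cbox (-a) a"
    using bounded_subset_cbox_symmetric[OF assms(2)] .
  have "f absolutely_integrable_on cbox (-a) a"
    by (intro absolutely_integrable_continuous continuous_on_subset[OF assms(1)]) auto
  moreover have "(\<lambda>x. indicator (cbox (-a) a) x *\<^sub>R f x) = f"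
    using a by (auto simp: fun_eq_iff indicator_def)
  ultimately have int: "integrable lebesgue f" by (simp add: set_integrable_def)
  have eq: "(\<lambda>x. indicator \<Omega> x *\<^sub>R f x) = f"
    using assms(3) by (auto simp: fun_eq_iff indicator_def)
  show "integrable (lebesgue_on \<Omega>) f"
    using int assms(4) eq by (simp add: integrable_restrict_space)
  have "(LINT x|lebesgue_on \<Omega>. f x) = (LINT x|lebesgue. f x)"
    using assms(4) eq by (simp add: integral_restrict_space)
  then show "(f has_integral (LINT x|lebesgue_on \<Omega>. f x)) UNIV"
    using has_integral_integral_lebesgue[OF int] by simp
qed

lemma integrable_continuous_bounded:
  fixes f :: "'a::euclidean_space \<Rightarrow> 'b::euclidean_space"
  assumes "continuous_on UNIV f" "bounded K" "K \<in> sets lebesgue"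
  shows "integrable (lebesgue_on K) f"
proof -
  obtain a where a: "K \<subseteq> cbox (-a) a"
    using bounded_subset_cbox_symmetric[OF assms(2)] .
  have "f absolutely_integrable_on cbox (-a) a"
    by (intro absolutely_integrable_continuous continuous_on_subset[OF assms(1)]) auto
  then have "f absolutely_integrable_on K"
    by (rule set_integrable_subset) (use a assms(3) in auto)
  then show ?thesis using assms(3) by (simp add: set_integrable_def integrable_restrict_space)
qed

lemma test_function_supp:
  assumes "\<phi> \<in> test_functions \<Omega>"
  shows "bounded {x. \<phi> x \<noteq> 0}" "closure {x. \<phi> x \<noteq> 0} \<subseteq> \<Omega>"
  using assms by (auto simp: test_functions_def intro: bounded_subset[OF compact_imp_bounded closure_subset])

lemma frechet_derivative_eq_0_outside_closure:
  fixes \<phi> :: "'a::real_normed_vector \<Rightarrow> 'b::real_normed_vector"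
  assumes x: "x \<notin> closure {x. \<phi> x \<noteq> 0}"
  shows "frechet_derivative \<phi> (at x) = (\<lambda>_. 0)"
proof -
  have "(\<phi> has_derivative (\<lambda>_. 0)) (at x)"
  proof (rule has_derivative_transform_within_open[OF has_derivative_const])
    show "open (- closure {x. \<phi> x \<noteq> 0})" by auto
    show "x \<in> - closure {x. \<phi> x \<noteq> 0}" using x by simp
    show "0 = \<phi> y" if "y \<in> - closure {x. \<phi> x \<noteq> 0}" for y
      using that closure_subset[of "{x. \<phi> x \<noteq> 0}"] by auto
  qed
  from frechet_derivative_at[OF this] show ?thesis by simp
qed

lemma test_function_has_derivative:
  assumes "\<phi> \<in> test_functions \<Omega>"
  shows "(\<phi> has_derivative frechet_derivative \<phi> (at x)) (at x)"
proof -
  have "C_k 1 \<phi>" using assms by (auto simp: test_functions_def)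
  then show ?thesis by (simp add: frechet_derivative_works)
qed

lemma test_function_continuous_on:
  assumes "\<phi> \<in> test_functions \<Omega>"
  shows "continuous_on S \<phi>" and "b \<in> Basis \<Longrightarrow> continuous_on S (\<lambda>x. frechet_derivative \<phi> (at x) b)"
proof -
  have "C_k 0 \<phi>" "C_k 1 \<phi>" using assms unfolding test_functions_def by blast+
  then show "continuous_on S \<phi>" "b \<in> Basis \<Longrightarrow> continuous_on S (\<lambda>x. frechet_derivative \<phi> (at x) b)"
    by (auto intro: continuous_on_subset)
qed

text \<open>By translation invariance the integral of \<psi>(x + t b) over x is constant for |t|
  \<le> 1; its t-derivative at 0, taken under the integral sign, is the integral in
  question.\<close>

lemma integral_directional_derivative_eq_0:
  fixes \<psi> :: "'a::euclidean_space \<Rightarrow> real"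
  assumes der: "\<And>x. (\<psi> has_derivative D x) (at x)"
    and cont: "continuous_on UNIV (\<lambda>x. D x b)"
    and bdd: "bounded {x. \<psi> x \<noteq> 0}"
  shows "((\<lambda>x. D x b) has_integral 0) UNIV"
proof -
  have cpsi: "continuous_on S \<psi>" for S
    using der by (meson has_derivative_continuous continuous_at_imp_continuous_on)
  have Dzero: "D x b = 0" if "x \<notin> closure {x. \<psi> x \<noteq> 0}" for x
    using frechet_derivative_eq_0_outside_closure[OF that] frechet_derivative_at[OF der[of x]] by simp
  have cpt: "compact (closure {x. \<psi> x \<noteq> 0})" using bdd by simp
  then have bdd': "bounded (closure {x. \<psi> x \<noteq> 0})" by (rule compact_imp_bounded)
  obtain R where R: "\<And>x. x \<in> closure {x. \<psi> x \<noteq> 0} \<Longrightarrow> norm x \<le> R"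
    using bdd' by (auto simp: bounded_iff)
  \<comment> \<open>One box for all translates with |t| \<le> 1, so that every integral is over the
    same compact set.\<close>
  obtain a where a: "cball (0::'a) (R + norm b) \<subseteq> cbox (-a) a"
    using bounded_subset_cbox_symmetric[OF bounded_cball] .
  have out: "x + t *\<^sub>R b \<notin> closure {x. \<psi> x \<noteq> 0}" if "x \<notin> cbox (-a) a" "\<bar>t\<bar> \<le> 1" for x t
  proof
    assume "x + t *\<^sub>R b \<in> closure {x. \<psi> x \<noteq> 0}"
    then have "norm (x + t *\<^sub>R b) \<le> R" by (rule R)
    moreover have "norm (t *\<^sub>R b) \<le> norm b" using that by (simp add: mult_left_le_one_le)
    moreover have "norm x \<le> norm (x + t *\<^sub>R b) + norm (t *\<^sub>R b)"
      using norm_triangle_ineq4[of "x + t *\<^sub>R b" "t *\<^sub>R b"] by simp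
    ultimately have "x \<in> cball 0 (R + norm b)" by simp
    with a have "x \<in> cbox (-a) a" by (rule subsetD)
    with that show False by simp
  qed
  have psi0: "\<psi> (x + t *\<^sub>R b) = 0" if "x \<notin> cbox (-a) a" "\<bar>t\<bar> \<le> 1" for x t
    using out[OF that] closure_subset[of "{x. \<psi> x \<noteq> 0}"] by auto
  have "\<psi> integrable_on cbox (-a) a" by (intro integrable_continuous cpsi)
  then have i: "(\<psi> has_integral integral (cbox (-a) a) \<psi>) UNIV"
    using psi0[of _ 0] has_integral_UNIV_iff_support[of "cbox (-a) a" \<psi>]
    by (simp add: integrable_integral)
  have const: "integral (cbox (-a) a) (\<lambda>x. \<psi> (x + t *\<^sub>R b)) = integral (cbox (-a) a) \<psi>" if "\<bar>t\<bar> \<le> 1" for t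
  proof -
    have "((\<lambda>x. \<psi> (x + t *\<^sub>R b)) has_integral integral (cbox (-a) a) \<psi>) UNIV"
      using has_integral_UNIV_affinity[OF i, of "-a" a 1 "t *\<^sub>R b"] psi0[of _ 0] by simp
    moreover have "\<psi> (x + t *\<^sub>R b) = 0" if "x \<notin> cbox (-a) a" for x
      using psi0[OF that] \<open>\<bar>t\<bar> \<le> 1\<close> by simp
    ultimately show ?thesis
      using has_integral_UNIV_iff_support[of "cbox (-a) a" "\<lambda>x. \<psi> (x + t *\<^sub>R b)"]
      by (simp add: integral_unique)
  qed
  have "((\<lambda>t. integral (cbox (-a) a) (\<lambda>x. \<psi> (x + t *\<^sub>R b))) has_field_derivative
      integral (cbox (-a) a) (\<lambda>x. D (x + 0 *\<^sub>R b) b)) (at 0 within {-1..1})"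
  proof (rule leibniz_rule_field_derivative)
    fix t :: real and x
    have lin: "linear (D (x + t *\<^sub>R b))" using der by (rule has_derivative_linear)
    have "((\<lambda>t. x + t *\<^sub>R b) has_derivative (\<lambda>h. h *\<^sub>R b)) (at t within {-1..1})"
      by (auto intro!: derivative_eq_intros)
    from has_derivative_compose[OF this der]
    have "((\<lambda>t. \<psi> (x + t *\<^sub>R b)) has_derivative (\<lambda>h. D (x + t *\<^sub>R b) (h *\<^sub>R b))) (at t within {-1..1})" .
    moreover have "D (x + t *\<^sub>R b) (h *\<^sub>R b) = D (x + t *\<^sub>R b) b * h" for h
      using linear_cmul[OF lin, of h b] by simp
    ultimately show "((\<lambda>t. \<psi> (x + t *\<^sub>R b)) has_field_derivative D (x + t *\<^sub>R b) b) (at t within {-1..1})"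
      by (simp add: has_field_derivative_def)
  next
    fix t :: real
    show "(\<lambda>x. \<psi> (x + t *\<^sub>R b)) integrable_on cbox (-a) a"
      by (intro integrable_continuous continuous_on_compose2[OF cpsi[of UNIV]]) (auto intro!: continuous_intros)
  next
    show "continuous_on ({-1..1} \<times> cbox (-a) a) (\<lambda>(t, x). D (x + t *\<^sub>R b) b)"
      unfolding split_beta
      by (intro continuous_on_compose2[OF cont]) (auto intro!: continuous_intros)
  qed auto
  moreover have "((\<lambda>t. integral (cbox (-a) a) (\<lambda>x. \<psi> (x + t *\<^sub>R b))) has_field_derivative 0)
      (at 0 within {-1..1})"
    by (rule has_field_derivative_transform_within[OF DERIV_const[of "integral (cbox (-a) a) \<psi>"], of 1])
       (auto simp: const)
  ultimately have "integral (cbox (-a) a) (\<lambda>x. D (x + 0 *\<^sub>R b) b) = 0"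
    using at_within_Icc_at[of "-1" "0::real" 1] by (auto intro: DERIV_unique)
  moreover have "(\<lambda>x. D x b) integrable_on cbox (-a) a"
    by (intro integrable_continuous continuous_on_subset[OF cont]) auto
  ultimately have "((\<lambda>x. D x b) has_integral 0) (cbox (-a) a)"
    by (simp add: has_integral_integral)
  moreover have "D x b = 0" if "x \<notin> cbox (-a) a" for x
    using out[OF that, of 0] Dzero by simp
  ultimately show ?thesis
    using has_integral_UNIV_iff_support[of "cbox (-a) a" "\<lambda>x. D x b"] by simp
qed

text \<open>The product of the affine function and \<phi> has compact support, so its directional
  derivative integrates to 0, and the product rule gives the identity. Linear competitors use this,
  and v = 0 covers the constants by which functions are shifted.\<close>

lemma has_weak_gradient_affine:
  fixes \<Omega> :: "'a::euclidean_space set"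
  assumes "open \<Omega>"
  shows "has_weak_gradient (\<lambda>x. x \<bullet> v + c) (\<lambda>_. v) \<Omega>"
  unfolding has_weak_gradient_def
proof (intro conjI allI impI ballI)
  fix K :: "'a set" assume K: "compact K \<and> K \<subseteq> \<Omega>"
  show "integrable (lebesgue_on K) (\<lambda>x. x \<bullet> v + c)"
    using K by (intro integrable_continuous_bounded continuous_intros)
      (auto intro: compact_imp_bounded simp: compact_imp_closed)
  show "integrable (lebesgue_on K) (\<lambda>_. v)"
    using K by (intro integrable_continuous_bounded continuous_intros)
      (auto intro: compact_imp_bounded simp: compact_imp_closed)
next
  fix \<phi> and b :: 'a assume phi: "\<phi> \<in> test_functions \<Omega>" and b: "b \<in> Basis"
  note supp = test_function_supp[OF phi]
  define f1 where "f1 x = (x \<bullet> v + c) * frechet_derivative \<phi> (at x) b" for x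
  define f2 where "f2 x = (v \<bullet> b) * \<phi> x" for x
  have f1: "(f1 has_integral (LINT x|lebesgue_on \<Omega>. f1 x)) UNIV"
  proof (rule has_integral_continuous_compact_support)
    have sub: "{x. f1 x \<noteq> 0} \<subseteq> closure {x. \<phi> x \<noteq> 0}"
      using frechet_derivative_eq_0_outside_closure by (fastforce simp: f1_def)
    show "bounded {x. f1 x \<noteq> 0}"
      by (rule bounded_subset[OF bounded_closure[OF supp(1)] sub])
    show "{x. f1 x \<noteq> 0} \<subseteq> \<Omega>" using sub supp(2) by (rule subset_trans)
    show "continuous_on UNIV f1"
      unfolding f1_def by (intro continuous_intros test_function_continuous_on[OF phi] b)
  qed (use assms in auto)
  have f2: "(f2 has_integral (LINT x|lebesgue_on \<Omega>. f2 x)) UNIV"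
  proof (rule has_integral_continuous_compact_support)
    have sub: "{x. f2 x \<noteq> 0} \<subseteq> {x. \<phi> x \<noteq> 0}" by (auto simp: f2_def)
    show "bounded {x. f2 x \<noteq> 0}" by (rule bounded_subset[OF supp(1) sub])
    show "{x. f2 x \<noteq> 0} \<subseteq> \<Omega>" using sub supp(2) closure_subset by (meson subset_trans)
    show "continuous_on UNIV f2"
      unfolding f2_def by (intro continuous_intros test_function_continuous_on[OF phi])
  qed (use assms in auto)
  have "((\<lambda>x. (x \<bullet> v + c) * frechet_derivative \<phi> (at x) b + (b \<bullet> v) * \<phi> x) has_integral 0) UNIV"
  proof (rule integral_directional_derivative_eq_0[where \<psi> = "\<lambda>x. (x \<bullet> v + c) * \<phi> x"
        and D = "\<lambda>x h. (x \<bullet> v + c) * frechet_derivative \<phi> (at x) h + (h \<bullet> v) * \<phi> x"])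
    fix x
    show "((\<lambda>x. (x \<bullet> v + c) * \<phi> x) has_derivative
        (\<lambda>h. (x \<bullet> v + c) * frechet_derivative \<phi> (at x) h + (h \<bullet> v) * \<phi> x)) (at x)"
      by (auto intro!: derivative_eq_intros test_function_has_derivative[OF phi])
    show "continuous_on UNIV (\<lambda>x. (x \<bullet> v + c) * frechet_derivative \<phi> (at x) b + (b \<bullet> v) * \<phi> x)"
      by (intro continuous_intros test_function_continuous_on[OF phi] b)
    show "bounded {x. (x \<bullet> v + c) * \<phi> x \<noteq> 0}"
      by (rule bounded_subset[OF supp(1)]) auto
  qed
  moreover have "((\<lambda>x. f1 x + f2 x) has_integral
      (LINT x|lebesgue_on \<Omega>. f1 x) + (LINT x|lebesgue_on \<Omega>. f2 x)) UNIV"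
    by (rule has_integral_add[OF f1 f2])
  ultimately have "(LINT x|lebesgue_on \<Omega>. f1 x) + (LINT x|lebesgue_on \<Omega>. f2 x) = 0"
    unfolding f1_def f2_def by (simp add: inner_commute has_integral_unique)
  then show "(LINT x|lebesgue_on \<Omega>. (x \<bullet> v + c) * frechet_derivative \<phi> (at x) b)
      = - (LINT x|lebesgue_on \<Omega>. (v \<bullet> b) * \<phi> x)"
    by (simp add: f1_def f2_def)
qed

section \<open>A Morrey estimate on cones\<close>

lemma smooth_fun_in_test_functions:
  assumes "smooth_fun f" "{x. f x \<noteq> 0} \<subseteq> K" "compact K" "K \<subseteq> \<Omega>"
  shows "f \<in> test_functions \<Omega>"
proof -
  have "closure {x. f x \<noteq> 0} \<subseteq> K"
    using assms by (intro closure_minimal) (auto intro: compact_imp_closed)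
  moreover have "compact (closure {x. f x \<noteq> 0})"
    using assms compact_imp_bounded bounded_subset by (metis compact_closure)
  ultimately show ?thesis
    using assms smooth_fun_C_k by (auto simp: test_functions_def)
qed

text \<open>The components of the vector field whose divergence is minus the \<open>s\<close>-derivative of the
  rescaled bump \<open>bump c ((y - x) / s) / s ^ n\<close>.\<close>

definition cone_field :: "'a::euclidean_space \<Rightarrow> 'a \<Rightarrow> real \<Rightarrow> 'a \<Rightarrow> 'a \<Rightarrow> real" where
  "cone_field c x s b y = ((y - x) \<bullet> b) * bump c ((1 / s) *\<^sub>R (y - x)) / s ^ (DIM('a) + 1)"

lemma scaled_bump_eq_0:
  assumes "0 < s" "y \<notin> cball (x + s *\<^sub>R c) s"
  shows "bump c ((1 / s) *\<^sub>R (y - x)) = 0"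
proof (rule bump_eq_0)
  have "s *\<^sub>R (c - (1 / s) *\<^sub>R (y - x)) = x + s *\<^sub>R c - y"
    using assms(1) by (simp add: algebra_simps)
  then have "s * dist c ((1 / s) *\<^sub>R (y - x)) = dist (x + s *\<^sub>R c) y"
    using assms(1) by (metis abs_of_pos dist_norm norm_scaleR)
  then have "s * 1 \<le> s * dist c ((1 / s) *\<^sub>R (y - x))" using assms(2) by simp
  then show "1 \<le> dist c ((1 / s) *\<^sub>R (y - x))" using assms(1) by (simp only: mult_le_cancel_left_pos)
qed

lemma cball_cone_subset:
  fixes x c :: "'a::real_normed_vector"
  assumes "0 \<le> s"
  shows "cball (x + s *\<^sub>R c) s \<subseteq> cball x (s * (norm c + 1))"
proof
  fix y assume "y \<in> cball (x + s *\<^sub>R c) s"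
  then have "norm (x + s *\<^sub>R c - y) \<le> s" by (simp add: dist_norm)
  moreover have "norm (x - y) \<le> norm (x + s *\<^sub>R c - y) + norm (s *\<^sub>R c)"
    using norm_triangle_ineq4[of "x + s *\<^sub>R c - y" "s *\<^sub>R c"] by simp
  ultimately show "y \<in> cball x (s * (norm c + 1))" using assms by (simp add: dist_norm algebra_simps)
qed

lemma smooth_fun_scaled_bump: "smooth_fun (\<lambda>y. bump c ((1 / s) *\<^sub>R (y - x)))"
  using smooth_fun_affine[OF smooth_fun_bump[of c], of "1 / s" "- ((1 / s) *\<^sub>R x)"]
  by (simp add: scaleR_diff_right)

lemma smooth_fun_cone_field: "smooth_fun (cone_field c x s b)"
proof -
  have "smooth_fun (\<lambda>y. (y \<bullet> b + - (x \<bullet> b)) * bump c ((1 / s) *\<^sub>R (y - x)) * (1 / s ^ (DIM('a) + 1)))"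
    by (intro smooth_fun.mult smooth_fun.add smooth_fun.inner smooth_fun.const smooth_fun_scaled_bump)
  then show ?thesis by (simp add: cone_field_def[abs_def] inner_diff_left)
qed

lemma cone_field_supp: "0 < s \<Longrightarrow> {y. cone_field c x s b y \<noteq> 0} \<subseteq> cball (x + s *\<^sub>R c) s"
  using scaled_bump_eq_0 by (fastforce simp: cone_field_def)

lemma has_derivative_bump: "(bump c has_derivative frechet_derivative (bump c) (at z)) (at z)"
  using smooth_fun_differentiable[OF smooth_fun_bump] frechet_derivative_works by blast

lemma frechet_derivative_cone_field:
  fixes c :: "'a::euclidean_space"
  assumes "0 < s" "b \<in> Basis"
  shows "frechet_derivative (cone_field c x s b) (at y) b =
    (bump c ((1 / s) *\<^sub>R (y - x))
      + ((y - x) \<bullet> b) * (frechet_derivative (bump c) (at ((1 / s) *\<^sub>R (y - x))) b / s)) / s ^ (DIM('a) + 1)"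
proof -
  define z where "z y = (1 / s) *\<^sub>R (y - x)" for y
  define B where "B = frechet_derivative (bump c) (at (z y))"
  have lin: "linear B" unfolding B_def by (rule has_derivative_linear[OF has_derivative_bump])
  have "(z has_derivative (\<lambda>h. (1 / s) *\<^sub>R h)) (at y)"
    unfolding z_def by (auto intro!: derivative_eq_intros)
  from has_derivative_compose[OF this has_derivative_bump]
  have dB: "((\<lambda>y. bump c (z y)) has_derivative (\<lambda>h. B ((1 / s) *\<^sub>R h))) (at y)"
    unfolding B_def .
  have "((\<lambda>y. ((y - x) \<bullet> b) * bump c (z y) / s ^ (DIM('a) + 1)) has_derivative
      (\<lambda>h. (((y - x) \<bullet> b) * B ((1 / s) *\<^sub>R h) + (h \<bullet> b) * bump c (z y)) / s ^ (DIM('a) + 1))) (at y)"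
    using dB assms(1) by (auto intro!: derivative_eq_intros simp del: power_Suc)
  then have "(cone_field c x s b has_derivative
      (\<lambda>h. (((y - x) \<bullet> b) * B ((1 / s) *\<^sub>R h) + (h \<bullet> b) * bump c (z y)) / s ^ (DIM('a) + 1))) (at y)"
    by (simp add: cone_field_def[abs_def] z_def)
  from frechet_derivative_at[OF this, symmetric] show ?thesis
    using assms(2) linear_cmul[OF lin, of "1 / s" b]
    by (simp add: z_def B_def add.commute del: power_Suc)
qed

text \<open>The continuity equation of a dilation: as s grows, the mass of the rescaled bump moves
  with velocity (y - x) / s, and \<open>cone_field\<close> has density times velocity as its
  components.\<close>

lemma scaled_bump_has_derivative_scale:
  fixes c :: "'a::euclidean_space"
  assumes "0 < s"
  shows "((\<lambda>s. bump c ((1 / s) *\<^sub>R (y - x)) / s ^ DIM('a)) has_real_derivative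
    - (\<Sum>b\<in>Basis. frechet_derivative (cone_field c x s b) (at y) b)) (at s)"
proof -
  let ?n = "DIM('a)"
  define z where "z s = (1 / s) *\<^sub>R (y - x)" for s
  define B where "B = frechet_derivative (bump c) (at (z s))"
  have lin: "linear B" unfolding B_def by (rule has_derivative_linear[OF has_derivative_bump])
  have "((\<lambda>s. 1 / s) has_real_derivative (- (1 / s\<^sup>2))) (at s)"
    using assms by (auto intro!: derivative_eq_intros simp: power2_eq_square)
  then have "((\<lambda>s. 1 / s) has_derivative (\<lambda>h. - (1 / s\<^sup>2) * h)) (at s)"
    by (simp only: has_field_derivative_def)
  then have "(z has_derivative (\<lambda>h. (- (1 / s\<^sup>2) * h) *\<^sub>R (y - x))) (at s)"
    unfolding z_def by (rule has_derivative_scaleR_left)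
  from has_derivative_compose[OF this has_derivative_bump]
  have "((\<lambda>s. bump c (z s)) has_derivative (\<lambda>h. B ((- (1 / s\<^sup>2) * h) *\<^sub>R (y - x)))) (at s)"
    unfolding B_def .
  moreover have "B ((- (1 / s\<^sup>2) * h) *\<^sub>R (y - x)) = (- (1 / s\<^sup>2) * B (y - x)) * h" for h
    by (subst linear_cmul[OF lin]) simp
  ultimately have dB: "((\<lambda>s. bump c (z s)) has_real_derivative (- (1 / s\<^sup>2) * B (y - x))) (at s)"
    by (simp only: has_field_derivative_def)
  have dn: "((\<lambda>s. 1 / s ^ ?n) has_real_derivative (- (real ?n / s ^ (?n + 1)))) (at s)"
  proof (cases ?n)
    case (Suc k)
    have "((\<lambda>s. 1 / s ^ Suc k) has_real_derivative (- (real (Suc k) * s ^ k / (s ^ Suc k * s ^ Suc k)))) (at s)"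
      using assms by (auto intro!: derivative_eq_intros simp del: power_Suc)
    moreover have "real (Suc k) * s ^ k / (s ^ Suc k * s ^ Suc k) = real (Suc k) / s ^ (Suc k + 1)"
      using assms by (simp add: field_simps)
    ultimately show ?thesis using Suc by simp
  qed simp
  have "((\<lambda>s. bump c (z s) * (1 / s ^ ?n)) has_real_derivative
      (bump c (z s) * (- (real ?n / s ^ (?n + 1))) + (- (1 / s\<^sup>2) * B (y - x)) * (1 / s ^ ?n))) (at s)"
    using DERIV_mult[OF dB dn] by (simp add: algebra_simps)
  moreover have "(\<Sum>b\<in>Basis. frechet_derivative (cone_field c x s b) (at y) b) =
      bump c (z s) * (real ?n / s ^ (?n + 1)) + (1 / s\<^sup>2) * B (y - x) * (1 / s ^ ?n)"
  proof -
    have "B (y - x) = B (\<Sum>b\<in>Basis. ((y - x) \<bullet> b) *\<^sub>R b)" by (simp add: euclidean_representation)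
    also have "\<dots> = (\<Sum>b\<in>Basis. ((y - x) \<bullet> b) * B b)"
      by (simp add: linear_sum[OF lin] linear_cmul[OF lin])
    finally have Byx: "B (y - x) = (\<Sum>b\<in>Basis. ((y - x) \<bullet> b) * B b)" .
    have "(\<Sum>b\<in>Basis. frechet_derivative (cone_field c x s b) (at y) b) =
      (\<Sum>b\<in>(Basis :: 'a set). (bump c (z s) + ((y - x) \<bullet> b) * (B b / s)) / s ^ (?n + 1))"
      using assms by (intro sum.cong) (simp_all add: frechet_derivative_cone_field z_def B_def)
    also have "\<dots> = (real ?n * bump c (z s) + B (y - x) / s) / s ^ (?n + 1)"
      unfolding Byx by (simp add: sum_divide_distrib[symmetric] sum.distrib)
    also have "\<dots> = bump c (z s) * (real ?n / s ^ (?n + 1)) + (1 / s\<^sup>2) * B (y - x) * (1 / s ^ ?n)"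
      using assms by (simp add: field_simps power2_eq_square)
    finally show ?thesis .
  qed
  ultimately show ?thesis by (simp add: z_def)
qed

text \<open>An integral of u over the ball of radius s about x + s c, not divided by the integral of
  the bump. In these variables s = 0 is allowed and returns the value at the vertex.\<close>

definition cone_average :: "('a::euclidean_space \<Rightarrow> real) \<Rightarrow> 'a \<Rightarrow> 'a \<Rightarrow> real \<Rightarrow> real" where
  "cone_average u c x s = integral UNIV (\<lambda>z. u (x + s *\<^sub>R z) * bump c z)"

text \<open>Moves the dependence on s out of the argument of u, which has only a weak gradient, into
  the smooth kernel.\<close>

lemma cone_average_eq:
  fixes c :: "'a::euclidean_space"
  assumes u: "continuous_on UNIV u" and s: "0 < s" and a: "cball (x + s *\<^sub>R c) s \<subseteq> cbox (-a) a"
  shows "cone_average u c x s =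
    integral (cbox (-a) a) (\<lambda>y. u y * (bump c ((1 / s) *\<^sub>R (y - x)) / s ^ DIM('a)))"
proof -
  define f where "f y = u y * bump c ((1 / s) *\<^sub>R (y - x))" for y
  have f0: "f y = 0" if "y \<notin> cbox (-a) a" for y
    using scaled_bump_eq_0[OF s] subsetD[OF a] that unfolding f_def by (metis mult_zero_right)
  have cf: "continuous_on S f" for S
    unfolding f_def
    by (intro continuous_intros continuous_on_subset[OF u] smooth_fun_continuous_on[OF smooth_fun_scaled_bump]) auto
  have "(f has_integral integral (cbox (-a) a) f) UNIV"
    using has_integral_UNIV_iff_support[of "cbox (-a) a" f] f0 cf
    by (simp add: integrable_continuous integrable_integral)
  then have "((\<lambda>z. f (s *\<^sub>R z + x)) has_integral integral (cbox (-a) a) f / s ^ DIM('a)) UNIV"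
    using f0 s by (rule has_integral_UNIV_affinity)
  then have "cone_average u c x s = integral (cbox (-a) a) f / s ^ DIM('a)"
    using s by (simp add: f_def cone_average_def add.commute integral_unique)
  then show ?thesis by (simp add: f_def[abs_def])
qed

lemma has_real_derivative_cone_average:
  fixes c :: "'a::euclidean_space"
  assumes \<Omega>: "open \<Omega>" and u: "continuous_on UNIV u" and g: "has_weak_gradient u g \<Omega>"
    and s: "0 < s" and cone: "cball (x + s *\<^sub>R c) s \<subseteq> \<Omega>"
  shows "(cone_average u c x has_real_derivative
    (\<Sum>b\<in>Basis. LINT y|lebesgue_on \<Omega>. (g y \<bullet> b) * cone_field c x s b y)) (at s)"
proof -
  let ?n = "DIM('a)"
  \<comment> \<open>A compact neighbourhood of s away from 0, as differentiation under the integral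
    requires.\<close>
  define U where "U = {s / 2..2 * s}"
  have Upos: "0 < t" if "t \<in> U" for t using that s by (auto simp: U_def)
  obtain a where a: "cball x (2 * s * (norm c + 1)) \<subseteq> cbox (-a) a"
    using bounded_subset_cbox_symmetric[OF bounded_cball] .
  have supp: "cball (x + t *\<^sub>R c) t \<subseteq> cbox (-a) a" if "t \<in> U" for t
  proof -
    have "cball (x + t *\<^sub>R c) t \<subseteq> cball x (t * (norm c + 1))"
      using Upos[OF that] by (intro cball_cone_subset) simp
    also have "\<dots> \<subseteq> cball x (2 * s * (norm c + 1))"
      using that by (intro subset_cball mult_right_mono) (auto simp: U_def)
    finally show ?thesis using a by simp
  qed
  define d where "d t y = (\<Sum>b\<in>Basis. frechet_derivative (cone_field c x t b) (at y) b)" for t y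
  have sU: "s \<in> U" using s by (simp add: U_def)
  have "((\<lambda>t. integral (cbox (-a) a) (\<lambda>y. u y * (bump c ((1 / t) *\<^sub>R (y - x)) / t ^ ?n)))
      has_field_derivative integral (cbox (-a) a) (\<lambda>y. u y * - d s y)) (at s within U)"
  proof (rule leibniz_rule_field_derivative)
    fix t y assume "t \<in> U"
    from scaled_bump_has_derivative_scale[OF Upos[OF this], of c y x]
    have "((\<lambda>t. u y * (bump c ((1 / t) *\<^sub>R (y - x)) / t ^ ?n)) has_real_derivative u y * - d t y) (at t)"
      unfolding d_def by (rule DERIV_cmult)
    then show "((\<lambda>t. u y * (bump c ((1 / t) *\<^sub>R (y - x)) / t ^ ?n)) has_real_derivative u y * - d t y) (at t within U)"
      by (rule has_field_derivative_at_within)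
  next
    fix t assume "t \<in> U"
    show "(\<lambda>y. u y * (bump c ((1 / t) *\<^sub>R (y - x)) / t ^ ?n)) integrable_on cbox (-a) a"
      using Upos[OF \<open>t \<in> U\<close>]
      by (intro integrable_continuous continuous_intros continuous_on_subset[OF u]
          smooth_fun_continuous_on[OF smooth_fun_scaled_bump]) auto
  next
    \<comment> \<open>The closed form of the derivative makes its joint continuity in scale and
      point visible.\<close>
    have "continuous_on (U \<times> cbox (-a) a) (\<lambda>q. u (snd q) * - (\<Sum>b\<in>Basis.
        (bump c ((1 / fst q) *\<^sub>R (snd q - x)) + ((snd q - x) \<bullet> b) *
          (frechet_derivative (bump c) (at ((1 / fst q) *\<^sub>R (snd q - x))) b / fst q)) / fst q ^ (?n + 1)))"
      by (intro continuous_intros continuous_on_compose2[OF u]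
          continuous_on_compose2[OF smooth_fun_continuous_on[OF smooth_fun_bump, of UNIV]]
          continuous_on_compose2[OF smooth_fun_continuous_on[OF smooth_fun_frechet_derivative[OF smooth_fun_bump], of UNIV]])
         (use Upos in fastforce)+
    then show "continuous_on (U \<times> cbox (-a) a) (\<lambda>(t, y). u y * - d t y)"
      by (rule continuous_on_eq)
         (auto simp: d_def frechet_derivative_cone_field[OF Upos] split_beta intro!: sum.cong)
  qed (use sU in \<open>auto simp: U_def\<close>)
  moreover have "at s within U = at s"
    using s unfolding U_def by (intro at_within_Icc_at) auto
  ultimately have "((\<lambda>t. integral (cbox (-a) a) (\<lambda>y. u y * (bump c ((1 / t) *\<^sub>R (y - x)) / t ^ ?n)))
      has_real_derivative integral (cbox (-a) a) (\<lambda>y. u y * - d s y)) (at s)"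
    by simp
  then have deriv: "(cone_average u c x has_real_derivative integral (cbox (-a) a) (\<lambda>y. u y * - d s y)) (at s)"
  proof (rule has_field_derivative_transform_within_open[where S = "{s / 2<..<2 * s}"])
    fix t assume "t \<in> {s / 2<..<2 * s}"
    then have "t \<in> U" by (auto simp: U_def)
    then show "integral (cbox (-a) a) (\<lambda>y. u y * (bump c ((1 / t) *\<^sub>R (y - x)) / t ^ ?n)) = cone_average u c x t"
      using cone_average_eq[OF u Upos supp] by simp
  qed (use s in auto)
  \<comment> \<open>Here the inclusion of the cone in \<Omega> enters: at the scale s itself the
    components of the field are test functions, and the weak gradient replaces the
    divergence.\<close>
  have test: "cone_field c x s b \<in> test_functions \<Omega>" for b
    by (rule smooth_fun_in_test_functions[OF smooth_fun_cone_field cone_field_supp[OF s] compact_cball cone])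
  have int: "((\<lambda>y. u y * frechet_derivative (cone_field c x s b) (at y) b) has_integral
      - (LINT y|lebesgue_on \<Omega>. (g y \<bullet> b) * cone_field c x s b y)) (cbox (-a) a)"
    if b: "b \<in> Basis" for b
  proof -
    have cl: "closure {y. cone_field c x s b y \<noteq> 0} \<subseteq> cball (x + s *\<^sub>R c) s"
      by (rule closure_minimal[OF cone_field_supp[OF s] closed_cball])
    then have sub: "{y. u y * frechet_derivative (cone_field c x s b) (at y) b \<noteq> 0} \<subseteq> cball (x + s *\<^sub>R c) s"
      using frechet_derivative_eq_0_outside_closure by (fastforce simp: mem_Collect_eq)
    have "((\<lambda>y. u y * frechet_derivative (cone_field c x s b) (at y) b) has_integral
        (LINT y|lebesgue_on \<Omega>. u y * frechet_derivative (cone_field c x s b) (at y) b)) UNIV"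
    proof (rule has_integral_continuous_compact_support)
      show "continuous_on UNIV (\<lambda>y. u y * frechet_derivative (cone_field c x s b) (at y) b)"
        by (intro continuous_intros u smooth_fun_continuous_on smooth_fun_frechet_derivative smooth_fun_cone_field)
    qed (use sub cone \<Omega> bounded_subset[OF bounded_cball] in auto)
    moreover have "(LINT y|lebesgue_on \<Omega>. u y * frechet_derivative (cone_field c x s b) (at y) b) =
        - (LINT y|lebesgue_on \<Omega>. (g y \<bullet> b) * cone_field c x s b y)"
      using g test b by (simp add: has_weak_gradient_def)
    moreover have "u y * frechet_derivative (cone_field c x s b) (at y) b = 0" if "y \<notin> cbox (-a) a" for y
      using that sub supp[OF sU] by blast
    ultimately show ?thesis
      using has_integral_UNIV_iff_support[of "cbox (-a) a" "\<lambda>y. u y * frechet_derivative (cone_field c x s b) (at y) b"]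
      by simp
  qed
  have "((\<lambda>y. - (\<Sum>b\<in>Basis. u y * frechet_derivative (cone_field c x s b) (at y) b)) has_integral
      - (\<Sum>b\<in>Basis. - (LINT y|lebesgue_on \<Omega>. (g y \<bullet> b) * cone_field c x s b y))) (cbox (-a) a)"
    by (intro has_integral_neg has_integral_sum int) auto
  moreover have "(\<lambda>y. u y * - d s y) = (\<lambda>y. - (\<Sum>b\<in>Basis. u y * frechet_derivative (cone_field c x s b) (at y) b))"
    by (simp add: d_def sum_distrib_left)
  ultimately have "((\<lambda>y. u y * - d s y) has_integral
      (\<Sum>b\<in>Basis. LINT y|lebesgue_on \<Omega>. (g y \<bullet> b) * cone_field c x s b y)) (cbox (-a) a)"
    by (simp only: sum_negf minus_minus)
  then have "integral (cbox (-a) a) (\<lambda>y. u y * - d s y) =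
      (\<Sum>b\<in>Basis. LINT y|lebesgue_on \<Omega>. (g y \<bullet> b) * cone_field c x s b y)"
    by (rule integral_unique)
  with deriv show ?thesis by simp
qed

text \<open>A substitute for Hoelder's inequality: integrated over a ball of radius \<open>s\<close>, both terms
  scale alike for \<open>T = s powr (- n / p)\<close>.\<close>

lemma le_add_powr_split:
  fixes a T p :: real
  assumes "0 \<le> a" "0 < T" "1 \<le> p"
  shows "a \<le> T + T powr (1 - p) * a powr p"
proof (cases "a \<le> T")
  case False
  then have "a powr (1 - p) \<le> T powr (1 - p)" using assms by (intro powr_mono2') auto
  then have "a powr (1 - p) * a powr p \<le> T powr (1 - p) * a powr p" by (rule mult_right_mono) simp
  moreover have "a powr (1 - p) * a powr p = a" using False assms by (simp add: powr_add[symmetric])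
  ultimately show ?thesis using assms by simp
qed (use assms in \<open>simp add: add_increasing2\<close>)

text \<open>If \<open>f\<close> is not integrable its integral is 0 by convention, so domination
  alone gives the bound.\<close>

lemma integral_abs_le_integral:
  fixes f h :: "'a::euclidean_space \<Rightarrow> real"
  assumes "integrable M h" "\<And>x. x \<in> space M \<Longrightarrow> \<bar>f x\<bar> \<le> h x"
  shows "\<bar>\<integral>x. f x \<partial>M\<bar> \<le> (\<integral>x. h x \<partial>M)"
proof (cases "integrable M f")
  case True then show ?thesis using assms by (intro integral_abs_bound_integral)
next
  case False
  have "0 \<le> (\<integral>x. h x \<partial>M)" using assms(2) by (intro Bochner_Integration.integral_nonneg) (meson abs_ge_zero order_trans)
  then show ?thesis using False by (simp add: not_integrable_integral_eq)
qed

lemma abs_cone_field_le: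
  fixes c :: "'a::euclidean_space"
  assumes "0 < s" "b \<in> Basis"
  shows "\<bar>cone_field c x s b y\<bar> \<le> (norm c + 1) / s ^ DIM('a) * indicator (cball (x + s *\<^sub>R c) s) y"
proof (cases "y \<in> cball (x + s *\<^sub>R c) s")
  case True
  then have "dist x y \<le> s * (norm c + 1)" using cball_cone_subset[of s x c] assms(1) by (auto simp: subset_iff)
  then have "\<bar>(y - x) \<bullet> b\<bar> \<le> s * (norm c + 1)"
    using Basis_le_norm[OF assms(2), of "y - x"] by (simp add: dist_norm norm_minus_commute)
  then have "\<bar>(y - x) \<bullet> b\<bar> * bump c ((1 / s) *\<^sub>R (y - x)) \<le> s * (norm c + 1) * 1"
    by (intro mult_mono bump_le_1 bump_nonneg) (use assms in auto)
  then have "\<bar>cone_field c x s b y\<bar> \<le> s * (norm c + 1) / s ^ (DIM('a) + 1)"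
    using assms(1) bump_nonneg[of c] unfolding cone_field_def
    by (simp add: abs_mult divide_right_mono del: power_Suc)
  also have "\<dots> = (norm c + 1) / s ^ DIM('a)" using assms(1) by simp
  finally show ?thesis using True by simp
next
  case False
  then have "cone_field c x s b y = 0" using cone_field_supp[OF assms(1)] by blast
  then show ?thesis using assms(1) by (auto simp: indicator_def)
qed

text \<open>The field has size of order s^(-n) on a ball of volume of order s^n. Splitting the
  gradient at the level T = s^(-n/p) gives two contributions of order T, a power that is integrable
  at 0 when p > n.\<close>

lemma cone_average_deriv_bound:
  fixes c :: "'a::euclidean_space"
  assumes \<Omega>: "open \<Omega>" and g: "g \<in> Lp p \<Omega>" and p: "1 \<le> p"
    and M: "(LINT y|lebesgue_on \<Omega>. norm (g y) powr p) \<le> M"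
    and s: "0 < s" and cone: "cball (x + s *\<^sub>R c) s \<subseteq> \<Omega>"
  shows "\<bar>\<Sum>b\<in>Basis. LINT y|lebesgue_on \<Omega>. (g y \<bullet> b) * cone_field c x s b y\<bar>
    \<le> DIM('a) * (norm c + 1) * (unit_ball_vol DIM('a) + M) * s powr (- (DIM('a) / p))"
proof -
  let ?n = "DIM('a)" and ?A = "cball (x + s *\<^sub>R c) s"
  define T where "T = s powr (- (?n / p))"
  have T: "0 < T" using s by (simp add: T_def)
  define H where "H y = (norm c + 1) / s ^ ?n *
      (T * indicator ?A y + T powr (1 - p) * norm (g y) powr p)" for y
  have meas: "\<Omega> \<in> sets lebesgue" "?A \<in> sets lebesgue" using \<Omega> by auto
  have intA: "integrable (lebesgue_on \<Omega>) (indicator ?A :: 'a \<Rightarrow> real)"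
    using meas cone emeasure_lborel_cball_finite[of "x + s *\<^sub>R c" s]
    by (simp add: integrable_indicator_iff emeasure_restrict_space sets_restrict_space_iff space_restrict_space
        Int_absorb2)
  have LA: "(LINT y|lebesgue_on \<Omega>. indicator ?A y) = unit_ball_vol ?n * s ^ ?n"
    using meas cone s by (simp add: measure_restrict_space space_restrict_space Int_absorb2 content_cball)
  have intg: "integrable (lebesgue_on \<Omega>) (\<lambda>y. norm (g y) powr p)" using g by (simp add: Lp_def)
  have intH: "integrable (lebesgue_on \<Omega>) H"
    unfolding H_def by (intro integrable_mult_right Bochner_Integration.integrable_add intA intg)
  have "\<bar>LINT y|lebesgue_on \<Omega>. (g y \<bullet> b) * cone_field c x s b y\<bar> \<le> (LINT y|lebesgue_on \<Omega>. H y)"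
    if b: "b \<in> Basis" for b
  proof (rule integral_abs_le_integral[OF intH])
    fix y
    have "\<bar>(g y \<bullet> b) * cone_field c x s b y\<bar> \<le> norm (g y) * ((norm c + 1) / s ^ ?n * indicator ?A y)"
      unfolding abs_mult by (intro mult_mono abs_cone_field_le Basis_le_norm b s) auto
    also have "\<dots> = (norm c + 1) / s ^ ?n * (norm (g y) * indicator ?A y)" by simp
    also have "\<dots> \<le> H y"
      unfolding H_def
    proof (intro mult_left_mono)
      show "norm (g y) * indicator ?A y \<le> T * indicator ?A y + T powr (1 - p) * norm (g y) powr p"
        using le_add_powr_split[OF _ T p, of "norm (g y)"] by (auto simp: indicator_def)
    qed (use s in auto)
    finally show "\<bar>(g y \<bullet> b) * cone_field c x s b y\<bar> \<le> H y" .
  qed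
  also have "(LINT y|lebesgue_on \<Omega>. H y) = (norm c + 1) / s ^ ?n * (T * (LINT y|lebesgue_on \<Omega>. indicator ?A y)
      + T powr (1 - p) * (LINT y|lebesgue_on \<Omega>. norm (g y) powr p))"
    unfolding H_def using intA intg by (simp add: integrable_mult_right)
  also have "\<dots> \<le> (norm c + 1) / s ^ ?n * (T * (unit_ball_vol ?n * s ^ ?n) + T powr (1 - p) * M)"
    unfolding LA using s M by (intro mult_left_mono add_left_mono) auto
  also have "T powr (1 - p) = s ^ ?n * T"
  proof -
    have "T powr (1 - p) = s powr (?n + - (?n / p))"
    proof -
      have "- (?n / p) * (1 - p) = ?n + - (?n / p)" using p by (simp add: field_simps)
      then show ?thesis by (simp only: T_def powr_powr)
    qed
    then show ?thesis using s by (simp only: powr_add T_def powr_realpow)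
  qed
  also have "(norm c + 1) / s ^ ?n * (T * (unit_ball_vol ?n * s ^ ?n) + s ^ ?n * T * M)
      = (norm c + 1) * (unit_ball_vol ?n + M) * T"
    using s by (simp add: field_simps)
  finally have each: "\<bar>LINT y|lebesgue_on \<Omega>. (g y \<bullet> b) * cone_field c x s b y\<bar>
      \<le> (norm c + 1) * (unit_ball_vol ?n + M) * T" if "b \<in> Basis" for b using that .
  have "\<bar>\<Sum>b\<in>Basis. LINT y|lebesgue_on \<Omega>. (g y \<bullet> b) * cone_field c x s b y\<bar> \<le>
      (\<Sum>b\<in>(Basis::'a set). (norm c + 1) * (unit_ball_vol ?n + M) * T)"
    by (rule order_trans[OF sum_abs sum_mono[OF each]])
  then show ?thesis by (simp add: T_def mult.assoc)
qed

text \<open>Both (K / \<alpha>) s^\<alpha> - F and (K / \<alpha>) s^\<alpha> + F are nondecreasing.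
  At 0 only continuity is asked, as the derivative may blow up there.\<close>

lemma abs_increment_le_powr:
  fixes F :: "real \<Rightarrow> real"
  assumes "0 \<le> h" "continuous_on {0..h} F" "0 < \<alpha>"
    and der: "\<And>s. 0 < s \<Longrightarrow> s < h \<Longrightarrow> (F has_real_derivative D s) (at s)"
    and bnd: "\<And>s. 0 < s \<Longrightarrow> s < h \<Longrightarrow> \<bar>D s\<bar> \<le> K * s powr (\<alpha> - 1)"
  shows "\<bar>F h - F 0\<bar> \<le> K / \<alpha> * h powr \<alpha>"
proof -
  have c: "continuous_on {0..h} (\<lambda>s. K / \<alpha> * s powr \<alpha>)"
    using assms(3) by (intro continuous_intros continuous_on_powr') auto
  have d: "((\<lambda>s. K / \<alpha> * s powr \<alpha>) has_real_derivative K * s powr (\<alpha> - 1)) (at s)" if "0 < s" for s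
    using that assms(3) by (auto intro!: derivative_eq_intros)
  have "K / \<alpha> * 0 powr \<alpha> - F 0 \<le> K / \<alpha> * h powr \<alpha> - F h"
  proof (rule DERIV_nonneg_imp_increasing_open[OF assms(1)])
    fix s assume s: "0 < s" "s < h"
    show "\<exists>y. ((\<lambda>s. K / \<alpha> * s powr \<alpha> - F s) has_real_derivative y) (at s) \<and> 0 \<le> y"
    proof (intro exI conjI)
      show "((\<lambda>s. K / \<alpha> * s powr \<alpha> - F s) has_real_derivative K * s powr (\<alpha> - 1) - D s) (at s)"
        by (rule DERIV_diff[OF d[OF s(1)] der[OF s]])
    qed (use bnd[OF s] in auto)
  qed (intro continuous_on_diff c assms(2))
  moreover have "K / \<alpha> * 0 powr \<alpha> + F 0 \<le> K / \<alpha> * h powr \<alpha> + F h"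
  proof (rule DERIV_nonneg_imp_increasing_open[OF assms(1)])
    fix s assume s: "0 < s" "s < h"
    show "\<exists>y. ((\<lambda>s. K / \<alpha> * s powr \<alpha> + F s) has_real_derivative y) (at s) \<and> 0 \<le> y"
    proof (intro exI conjI)
      show "((\<lambda>s. K / \<alpha> * s powr \<alpha> + F s) has_real_derivative K * s powr (\<alpha> - 1) + D s) (at s)"
        by (rule DERIV_add[OF d[OF s(1)] der[OF s]])
    qed (use bnd[OF s] in auto)
  qed (intro continuous_on_add c assms(2))
  ultimately show ?thesis by (auto simp: abs_le_iff)
qed

section \<open>Averages down to the vertex, and equicontinuity at the boundary\<close>

lemma bump_eq_0_outside_cbox:
  fixes c :: "'a::euclidean_space"
  obtains a where "c \<in> box (-a) a" "\<And>z. z \<notin> cbox (-a) a \<Longrightarrow> bump c z = 0"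
proof -
  obtain a where a: "cball c 1 \<subseteq> box (-a) a"
    using bounded_subset_box_symmetric[OF bounded_cball] .
  have "bump c z = 0" if "z \<notin> cbox (-a) a" for z
  proof (rule bump_eq_0)
    have "z \<notin> cball c 1" using a that box_subset_cbox by blast
    then show "1 \<le> dist c z" by simp
  qed
  moreover have "c \<in> box (-a) a" using a by (rule subsetD) simp
  ultimately show ?thesis by (intro that[of a])
qed

lemma continuous_on_cone_average:
  fixes c :: "'a::euclidean_space"
  assumes u: "continuous_on UNIV u"
  shows "continuous_on S (cone_average u c x)"
proof -
  obtain a where a: "\<And>z. z \<notin> cbox (-a) a \<Longrightarrow> bump c z = 0"
    using bump_eq_0_outside_cbox[of c] by metis
  have "cone_average u c x = (\<lambda>s. integral (cbox (-a) a) (\<lambda>z. u (x + s *\<^sub>R z) * bump c z))"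
  proof
    fix s
    have "continuous_on UNIV (\<lambda>z. u (x + s *\<^sub>R z) * bump c z)"
      by (intro continuous_intros continuous_on_compose2[OF u] smooth_fun_continuous_on[OF smooth_fun_bump]) auto
    then have "(\<lambda>z. u (x + s *\<^sub>R z) * bump c z) integrable_on cbox (-a) a"
      by (intro integrable_continuous) (rule continuous_on_subset, auto)
    then show "cone_average u c x s = integral (cbox (-a) a) (\<lambda>z. u (x + s *\<^sub>R z) * bump c z)"
      unfolding cone_average_def
      by (intro integral_unique) (subst has_integral_UNIV_iff_support[of "cbox (-a) a"], auto simp: a integrable_integral)
  qed
  then show ?thesis
    by (simp, intro integral_continuous_on_param)
       (auto intro!: continuous_intros continuous_on_compose2[OF u]
         continuous_on_compose2[OF smooth_fun_continuous_on[OF smooth_fun_bump, of UNIV]] simp: split_beta)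
qed

lemma integral_bump_pos: "0 < integral UNIV (bump c)"
proof -
  obtain a where a: "c \<in> box (-a) a" "\<And>z. z \<notin> cbox (-a) a \<Longrightarrow> bump c z = 0"
    using bump_eq_0_outside_cbox[of c] by metis
  have cont: "continuous_on (cbox (-a) a) (bump c)" by (rule smooth_fun_continuous_on[OF smooth_fun_bump])
  then have "(bump c has_integral integral (cbox (-a) a) (bump c)) (cbox (-a) a)"
    by (intro integrable_integral integrable_continuous)
  moreover from this have "integral UNIV (bump c) = integral (cbox (-a) a) (bump c)"
    using has_integral_UNIV_iff_support[of "cbox (-a) a" "bump c"] a by (intro integral_unique) auto
  ultimately have I: "(bump c has_integral integral UNIV (bump c)) (cbox (-a) a)" by simp
  have "0 \<le> integral UNIV (bump c)"
    by (rule has_integral_nonneg[OF I]) (simp add: bump_nonneg)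
  moreover have "integral UNIV (bump c) \<noteq> 0"
  proof
    assume "integral UNIV (bump c) = 0"
    with I have "(bump c has_integral 0) (cbox (-a) a)" by simp
    then have "bump c c = 0"
      using a(1) box_subset_cbox by (intro has_integral_0_cbox_imp_0[OF cont bump_nonneg]) auto
    moreover have "0 < bump c c" by (simp add: bump_pos_iff)
    ultimately show False by simp
  qed
  ultimately show ?thesis by simp
qed

lemma cone_average_0: "cone_average u c x 0 = u x * integral UNIV (bump c)"
  by (simp add: cone_average_def)

text \<open>The Morrey estimate: the bound s^(-n/p) for the derivative is integrated from the vertex
  up to height h. The constant involves neither x nor u, which makes the later modulus of continuity
  uniform.\<close>

lemma cone_estimate:
  fixes c :: "'a::euclidean_space" and p :: real
  assumes \<Omega>: "open \<Omega>" and u: "continuous_on UNIV u" and w: "has_weak_gradient u g \<Omega>"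
    and g: "g \<in> Lp p \<Omega>" and p: "1 \<le> p" "DIM('a) < p"
    and M: "(LINT y|lebesgue_on \<Omega>. norm (g y) powr p) \<le> M"
    and h: "0 \<le> h" and cone: "\<And>s. 0 < s \<Longrightarrow> s \<le> h \<Longrightarrow> cball (x + s *\<^sub>R c) s \<subseteq> \<Omega>"
  shows "\<bar>cone_average u c x h - u x * integral UNIV (bump c)\<bar>
    \<le> DIM('a) * (norm c + 1) * (unit_ball_vol DIM('a) + M) / (1 - DIM('a) / p) * h powr (1 - DIM('a) / p)"
  unfolding cone_average_0[symmetric]
proof (rule abs_increment_le_powr[OF h continuous_on_cone_average[OF u]])
  show "0 < 1 - DIM('a) / p" using p by simp
  fix s assume s: "0 < s" "s < h"
  show "(cone_average u c x has_real_derivative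
    (\<Sum>b\<in>Basis. LINT y|lebesgue_on \<Omega>. (g y \<bullet> b) * cone_field c x s b y)) (at s)"
    using s by (intro has_real_derivative_cone_average \<Omega> u w cone) auto
  show "\<bar>\<Sum>b\<in>Basis. LINT y|lebesgue_on \<Omega>. (g y \<bullet> b) * cone_field c x s b y\<bar>
    \<le> DIM('a) * (norm c + 1) * (unit_ball_vol DIM('a) + M) * s powr (1 - DIM('a) / p - 1)"
    using cone_average_deriv_bound[OF \<Omega> g p(1) M s(1) cone] s by simp
qed

lemma uniformly_continuous_bump:
  assumes "0 < e"
  obtains d where "0 < d" "\<And>z z'. dist z z' < d \<Longrightarrow> \<bar>bump c z - bump c z'\<bar> < e"
proof -
  \<comment> \<open>Radius 3 leaves room: if two points are closer than 1 and one is outside this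
    ball, both are outside the support of the bump.\<close>
  have "uniformly_continuous_on (cball c 3) (bump c)"
    by (intro compact_uniformly_continuous smooth_fun_continuous_on[OF smooth_fun_bump] compact_cball)
  then obtain d where d: "0 < d" "\<And>z z'. z \<in> cball c 3 \<Longrightarrow> z' \<in> cball c 3 \<Longrightarrow> dist z' z < d \<Longrightarrow> dist (bump c z') (bump c z) < e"
    using assms unfolding uniformly_continuous_on_def by metis
  have "\<bar>bump c z - bump c z'\<bar> < e" if *: "dist z z' < min d 1" for z z'
  proof (cases "z \<in> cball c 3 \<and> z' \<in> cball c 3")
    case True then show ?thesis using d(2)[of z' z] * by (auto simp: dist_real_def)
  next
    case False
    then have "1 \<le> dist c z" "1 \<le> dist c z'"
      using * dist_triangle[of c z z'] dist_triangle[of c z' z] by (auto simp: dist_commute)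
    then show ?thesis using assms by (simp add: bump_eq_0)
  qed
  then show ?thesis using d(1) by (intro that[of "min d 1"]) auto
qed

lemma has_weak_gradient_cong:
  assumes "\<And>x. x \<in> \<Omega> \<Longrightarrow> u x = v x" "has_weak_gradient u g \<Omega>"
  shows "has_weak_gradient v g \<Omega>"
  unfolding has_weak_gradient_def
proof (intro conjI allI impI ballI)
  fix K assume K: "compact K \<and> K \<subseteq> \<Omega>"
  then have "integrable (lebesgue_on K) u" using assms(2) by (auto simp: has_weak_gradient_def)
  moreover have "integrable (lebesgue_on K) u = integrable (lebesgue_on K) v"
    using K assms(1) by (intro Bochner_Integration.integrable_cong) auto
  ultimately show "integrable (lebesgue_on K) v" by simp
  show "integrable (lebesgue_on K) g" using assms(2) K by (auto simp: has_weak_gradient_def)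
next
  fix \<phi> and b :: 'a assume "\<phi> \<in> test_functions \<Omega>" "b \<in> Basis"
  then have "(LINT x|lebesgue_on \<Omega>. u x * frechet_derivative \<phi> (at x) b) =
      - (LINT x|lebesgue_on \<Omega>. (g x \<bullet> b) * \<phi> x)"
    using assms(2) by (simp add: has_weak_gradient_def)
  moreover have "(LINT x|lebesgue_on \<Omega>. u x * frechet_derivative \<phi> (at x) b) =
      (LINT x|lebesgue_on \<Omega>. v x * frechet_derivative \<phi> (at x) b)"
    using assms(1) by (intro Bochner_Integration.integral_cong) auto
  ultimately show "(LINT x|lebesgue_on \<Omega>. v x * frechet_derivative \<phi> (at x) b) =
      - (LINT x|lebesgue_on \<Omega>. (g x \<bullet> b) * \<phi> x)" by simp
qed

text \<open>At a fixed height the two kernels differ by at most \<eta> / h^n, and |v| \<le> 1 +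
  |v|^p bounds the L^1 norm of v.\<close>

lemma cone_average_diff_le:
  fixes c :: "'a::euclidean_space" and p :: real
  assumes \<Omega>: "open \<Omega>" "bounded \<Omega>" and v: "continuous_on UNIV v"
    and vL: "v \<in> Lp p \<Omega>" and v1: "(LINT y|lebesgue_on \<Omega>. \<bar>v y\<bar> powr p) \<le> 1" and p: "1 \<le> p"
    and h: "0 < h" and cone: "cball (x + h *\<^sub>R c) h \<subseteq> \<Omega>" "cball (x' + h *\<^sub>R c) h \<subseteq> \<Omega>"
    and \<eta>: "\<And>z z'. dist z z' < d \<Longrightarrow> \<bar>bump c z - bump c z'\<bar> < \<eta>" and d: "dist x x' < h * d"
  shows "\<bar>cone_average v c x h - cone_average v c x' h\<bar> \<le> (measure lebesgue \<Omega> + 1) / h ^ DIM('a) * \<eta>"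
proof -
  let ?n = "DIM('a)"
  obtain a where a: "\<Omega> \<subseteq> cbox (-a) a" using bounded_subset_cbox_symmetric[OF \<Omega>(2)] .
  define f where "f x y = v y * (bump c ((1 / h) *\<^sub>R (y - x)) / h ^ ?n)" for x y
  have cf: "continuous_on S (f x)" for S x
    unfolding f_def using h
    by (intro continuous_intros continuous_on_subset[OF v] smooth_fun_continuous_on[OF smooth_fun_scaled_bump]) auto
  have f0: "f x y = 0" if "y \<notin> cball (x + h *\<^sub>R c) h" for x y
    using scaled_bump_eq_0[OF h that] by (simp add: f_def)
  have avg: "cone_average v c x h = (LINT y|lebesgue_on \<Omega>. f x y) \<and> integrable (lebesgue_on \<Omega>) (f x)"
    if x: "cball (x + h *\<^sub>R c) h \<subseteq> \<Omega>" for x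
  proof
    have sub: "{y. f x y \<noteq> 0} \<subseteq> cball (x + h *\<^sub>R c) h" using f0[of _ x] by blast
    have bdd: "bounded {y. f x y \<noteq> 0}" by (rule bounded_subset[OF bounded_cball sub])
    show "integrable (lebesgue_on \<Omega>) (f x)"
      using bdd sub x \<Omega>(1) by (intro integrable_continuous_compact_support cf) auto
    have "(f x has_integral (LINT y|lebesgue_on \<Omega>. f x y)) UNIV"
      using bdd sub x \<Omega>(1) by (intro has_integral_continuous_compact_support cf) auto
    moreover have "f x y = 0" if "y \<notin> cbox (-a) a" for y
      using f0[of y x] that x a by blast
    ultimately have "(f x has_integral (LINT y|lebesgue_on \<Omega>. f x y)) (cbox (-a) a)"
      using has_integral_UNIV_iff_support[of "cbox (-a) a" "f x"] by simp
    moreover have "cone_average v c x h = integral (cbox (-a) a) (f x)"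
      unfolding f_def by (rule cone_average_eq[OF v h subset_trans[OF x a]])
    ultimately show "cone_average v c x h = (LINT y|lebesgue_on \<Omega>. f x y)"
      by (simp add: integral_unique)
  qed
  have int1: "integrable (lebesgue_on \<Omega>) (\<lambda>y. 1 :: real)"
    using \<Omega> by (intro integrable_continuous_bounded continuous_on_const) auto
  have intv: "integrable (lebesgue_on \<Omega>) (\<lambda>y. \<bar>v y\<bar> powr p)" using vL by (simp add: Lp_def)
  have "\<bar>LINT y|lebesgue_on \<Omega>. f x y - f x' y\<bar> \<le> (LINT y|lebesgue_on \<Omega>. \<eta> / h ^ ?n * (1 + \<bar>v y\<bar> powr p))"
  proof (rule integral_abs_le_integral)
    show "integrable (lebesgue_on \<Omega>) (\<lambda>y. \<eta> / h ^ ?n * (1 + \<bar>v y\<bar> powr p))"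
      by (intro integrable_mult_right Bochner_Integration.integrable_add int1 intv)
    fix y
    have "dist ((1 / h) *\<^sub>R (y - x)) ((1 / h) *\<^sub>R (y - x')) = dist x x' / h"
      using h by (simp add: dist_norm scaleR_diff_right[symmetric] norm_minus_commute divide_inverse)
    also have "\<dots> < d" using d h by (simp add: divide_less_eq mult.commute)
    finally have "\<bar>bump c ((1 / h) *\<^sub>R (y - x)) - bump c ((1 / h) *\<^sub>R (y - x'))\<bar> \<le> \<eta>"
      using \<eta> by (intro less_imp_le)
    then have "\<bar>v y\<bar> * \<bar>bump c ((1 / h) *\<^sub>R (y - x)) - bump c ((1 / h) *\<^sub>R (y - x'))\<bar> / h ^ ?n
        \<le> (1 + \<bar>v y\<bar> powr p) * \<eta> / h ^ ?n"
      using le_add_powr_split[of "\<bar>v y\<bar>" 1 p] p h by (intro divide_right_mono mult_mono) auto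
    then show "\<bar>f x y - f x' y\<bar> \<le> \<eta> / h ^ ?n * (1 + \<bar>v y\<bar> powr p)"
      using h by (simp add: f_def abs_mult right_diff_distrib[symmetric] diff_divide_distrib[symmetric] mult.commute)
  qed
  also have "(LINT y|lebesgue_on \<Omega>. \<eta> / h ^ ?n * (1 + \<bar>v y\<bar> powr p)) =
      \<eta> / h ^ ?n * (measure lebesgue \<Omega> + (LINT y|lebesgue_on \<Omega>. \<bar>v y\<bar> powr p))"
    using int1 intv \<Omega>(1) by (simp add: measure_restrict_space space_restrict_space)
  also have "\<dots> \<le> \<eta> / h ^ ?n * (measure lebesgue \<Omega> + 1)"
  proof (intro mult_left_mono add_left_mono v1)
    have "0 < d" using d h zero_le_dist[of x x'] by (smt (verit) zero_less_mult_pos)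
    then have "0 < \<eta>" using \<eta>[of 0 0] by simp
    then show "0 \<le> \<eta> / h ^ ?n" using h by simp
  qed
  finally show ?thesis using avg[OF cone(1)] avg[OF cone(2)] by (simp add: mult.commute)
qed

text \<open>Passes from \<open>u x\<close> to \<open>u xbar\<close> through the averages of height h
  at both vertices, with an error \<open>e * Z / 3\<close> in each of the three steps. The height is
  fixed first, to make the Morrey errors small; then d is chosen for this h. Neither depends on u, g
  or x.\<close>

lemma sobolev_equicontinuous:
  fixes c xbar :: "'a::euclidean_space" and p :: real
  assumes \<Omega>: "open \<Omega>" "bounded \<Omega>" and p: "1 \<le> p" "DIM('a) < p" and h0: "0 < h0"
    and X: "xbar \<in> X" "X \<subseteq> closure \<Omega>"
    and cone: "\<And>x s. x \<in> X \<Longrightarrow> 0 < s \<Longrightarrow> s \<le> h0 \<Longrightarrow> cball (x + s *\<^sub>R c) s \<subseteq> \<Omega>" and e: "0 < e"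
  obtains d where "0 < d"
    "\<And>u g x. (u, g) \<in> sobolev p \<Omega> \<Longrightarrow> continuous_on (closure \<Omega>) u \<Longrightarrow>
      (LINT y|lebesgue_on \<Omega>. \<bar>u y\<bar> powr p) \<le> 1 \<Longrightarrow>
      (LINT y|lebesgue_on \<Omega>. norm (g y) powr p) \<le> M \<Longrightarrow> x \<in> X \<Longrightarrow> dist x xbar < d \<Longrightarrow>
      \<bar>u x - u xbar\<bar> \<le> e"
proof -
  let ?n = "DIM('a)"
  define Z where "Z = integral UNIV (bump c)"
  have Z: "0 < Z" by (simp add: Z_def integral_bump_pos)
  define \<alpha> where "\<alpha> = 1 - ?n / p"
  have \<alpha>: "0 < \<alpha>" using p by (simp add: \<alpha>_def)
  define C where "C = ?n * (norm c + 1) * (unit_ball_vol ?n + M) / \<alpha>"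
  \<comment> \<open>A positive majorant of \<open>C\<close>, whose sign is open since M is
    arbitrary. Below, \<open>B\<close> is the size of h^\<alpha> for which \<open>K * B\<close>
    equals \<open>e * Z / 3\<close>.\<close>
  define K where "K = \<bar>C\<bar> + 1"
  have K: "0 < K" "C \<le> K" by (auto simp: K_def)
  define B where "B = e * Z / (3 * K)"
  have B: "0 < B" using e Z K by (simp add: B_def)
  define h where "h = min h0 (B powr (1 / \<alpha>))"
  have h: "0 < h" "h \<le> h0" using h0 B by (auto simp: h_def)
  have "h powr \<alpha> \<le> (B powr (1 / \<alpha>)) powr \<alpha>" using h \<alpha> by (intro powr_mono2) (auto simp: h_def)
  then have "h powr \<alpha> \<le> B" using \<alpha> B by (simp add: powr_powr)
  then have "C * h powr \<alpha> \<le> K * B" using K by (intro mult_mono) auto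
  then have Ch: "C * h powr \<alpha> \<le> e * Z / 3" using K by (simp add: B_def)
  define \<eta> where "\<eta> = e * Z / 3 * h ^ ?n / (measure lebesgue \<Omega> + 1)"
  have mpos: "0 < measure lebesgue \<Omega> + 1" by (simp add: add_nonneg_pos)
  have \<eta>: "0 < \<eta>" using e Z h mpos by (simp add: \<eta>_def)
  obtain d where d: "0 < d" "\<And>z z'. dist z z' < d \<Longrightarrow> \<bar>bump c z - bump c z'\<bar> < \<eta>"
    using uniformly_continuous_bump[OF \<eta>] by metis
  show ?thesis
  proof (rule that)
    show "0 < h * d" using h d by simp
    fix u g x
    assume ug: "(u, g) \<in> sobolev p \<Omega>" and cu: "continuous_on (closure \<Omega>) u"
      and u1: "(LINT y|lebesgue_on \<Omega>. \<bar>u y\<bar> powr p) \<le> 1"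
      and gM: "(LINT y|lebesgue_on \<Omega>. norm (g y) powr p) \<le> M"
      and x: "x \<in> X" and xd: "dist x xbar < h * d"
    have "compact (u ` closure \<Omega>)" using \<Omega>(2) cu by (intro compact_continuous_image) auto
    then obtain R where "\<And>y. y \<in> closure \<Omega> \<Longrightarrow> norm (u y) \<le> R"
      using compact_imp_bounded bounded_iff by (metis imageI)
    then have R: "\<And>y. y \<in> closure \<Omega> \<Longrightarrow> norm (u y) \<le> max R 0" by force
    \<comment> \<open>Averages are taken of functions continuous on the whole space. The extension
      agrees with u on the closure of \<Omega>, and the weak gradient is used inside \<Omega>
      only.\<close>
    obtain v where v: "continuous_on UNIV v" "\<And>y. y \<in> closure \<Omega> \<Longrightarrow> v y = u y"
    proof (rule Tietze[OF cu, of UNIV "max R 0"])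
      fix v assume "continuous_on UNIV v" "\<And>y. y \<in> closure \<Omega> \<Longrightarrow> v y = u y"
      then show thesis by (rule that)
    qed (use R in auto)
    have eq: "u y = v y" if "y \<in> \<Omega>" for y using v(2) that closure_subset by (metis subsetD)
    have w: "has_weak_gradient v g \<Omega>" and gL: "g \<in> Lp p \<Omega>"
      using ug has_weak_gradient_cong[OF eq] by (auto simp: sobolev_def)
    have vL: "v \<in> Lp p \<Omega>"
    proof -
      have "integrable (lebesgue_on \<Omega>) (\<lambda>y. norm (v y) powr p) = integrable (lebesgue_on \<Omega>) (\<lambda>y. norm (u y) powr p)"
        using eq by (intro Bochner_Integration.integrable_cong) auto
      moreover have "v \<in> borel_measurable (lebesgue_on \<Omega>) \<longleftrightarrow> u \<in> borel_measurable (lebesgue_on \<Omega>)"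
        using eq by (intro measurable_cong) auto
      ultimately show ?thesis using ug by (auto simp: sobolev_def Lp_def)
    qed
    have v1: "(LINT y|lebesgue_on \<Omega>. \<bar>v y\<bar> powr p) \<le> 1"
    proof -
      have "(LINT y|lebesgue_on \<Omega>. \<bar>v y\<bar> powr p) = (LINT y|lebesgue_on \<Omega>. \<bar>u y\<bar> powr p)"
        using eq by (intro Bochner_Integration.integral_cong) auto
      with u1 show ?thesis by simp
    qed
    have est: "\<bar>cone_average v c y h - v y * Z\<bar> \<le> e * Z / 3" if "y \<in> X" for y
    proof -
      have "\<bar>cone_average v c y h - v y * Z\<bar> \<le> C * h powr \<alpha>"
        unfolding Z_def C_def \<alpha>_def
        using h cone[OF that] by (intro cone_estimate[OF \<Omega>(1) v(1) w gL p gM]) auto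
      with Ch show ?thesis by simp
    qed
    have "\<bar>cone_average v c x h - cone_average v c xbar h\<bar> \<le> (measure lebesgue \<Omega> + 1) / h ^ ?n * \<eta>"
      using cone[OF x h] cone[OF X(1) h]
      by (intro cone_average_diff_le[OF \<Omega> v(1) vL v1 p(1) h(1) _ _ d(2) xd]) auto
    also have "\<dots> = e * Z / 3"
    proof -
      have "V / w * (t * w / V) = t" if "0 < V" "0 < w" for t V w :: real using that by simp
      from this[OF mpos, of "h ^ ?n" "e * Z / 3"] show ?thesis using h by (simp only: \<eta>_def zero_less_power)
    qed
    finally have "\<bar>v x * Z - v xbar * Z\<bar> \<le> e * Z"
      using est[OF x] est[OF X(1)] by linarith
    then have "\<bar>v x - v xbar\<bar> * Z \<le> e * Z" using Z by (simp add: abs_mult left_diff_distrib[symmetric])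
    then have "\<bar>v x - v xbar\<bar> \<le> e" using Z by simp
    then show "\<bar>u x - u xbar\<bar> \<le> e" using v(2) X x by (metis subsetD)
  qed
qed

section \<open>Competitors in the variational problems\<close>

text \<open>Either |c| \<le> \<theta> |a - c|, or |a - c| is at most |c| / \<theta>. The coefficient
  of the main term tends to 1 with \<theta>, at the price of a large coefficient on the small
  term.\<close>

lemma abs_powr_le_powr_diff:
  fixes a c \<theta> p :: real
  assumes "0 < \<theta>" "0 < p"
  shows "\<bar>a\<bar> powr p \<le> (1 + \<theta>) powr p * \<bar>a - c\<bar> powr p + (1 + 1 / \<theta>) powr p * \<bar>c\<bar> powr p"
proof (cases "\<bar>c\<bar> \<le> \<theta> * \<bar>a - c\<bar>")
  case True
  then have "\<bar>a\<bar> \<le> (1 + \<theta>) * \<bar>a - c\<bar>" by (simp add: algebra_simps)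
  then have "\<bar>a\<bar> powr p \<le> ((1 + \<theta>) * \<bar>a - c\<bar>) powr p" using assms by (intro powr_mono2) auto
  then show ?thesis using assms by (simp add: powr_mult add_increasing2)
next
  case False
  then have "\<bar>a - c\<bar> \<le> 1 / \<theta> * \<bar>c\<bar>" using assms by (simp add: field_simps)
  then have "\<bar>a\<bar> \<le> (1 + 1 / \<theta>) * \<bar>c\<bar>" by (simp add: algebra_simps)
  then have "\<bar>a\<bar> powr p \<le> ((1 + 1 / \<theta>) * \<bar>c\<bar>) powr p" using assms by (intro powr_mono2) auto
  then show ?thesis using assms by (simp add: powr_mult add_increasing)
qed

section \<open>Scaling and shifting Sobolev functions\<close>

lemma lebesgue_integral_powr_nonneg: "0 \<le> (LINT y|M. \<bar>f y :: real\<bar> powr p)"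
  by (intro Bochner_Integration.integral_nonneg) auto

lemma admissible_pos:
  assumes "(u, g) \<in> admissible p \<Omega>"
  shows "0 < (LINT y|lebesgue_on \<Omega>. \<bar>u y\<bar> powr p)"
proof -
  have int: "integrable (lebesgue_on \<Omega>) (\<lambda>y. \<bar>u y\<bar> powr p)"
    and ne: "\<not> (AE y in lebesgue_on \<Omega>. u y = 0)"
    using assms by (auto simp: admissible_def sobolev_def Lp_def)
  have "(LINT y|lebesgue_on \<Omega>. \<bar>u y\<bar> powr p) \<noteq> 0"
    using ne by (subst integral_nonneg_eq_0_iff_AE[OF int]) auto
  then show ?thesis using lebesgue_integral_powr_nonneg[of "lebesgue_on \<Omega>" u p] by linarith
qed

lemma Lp_scaleR:
  fixes f :: "'a::euclidean_space \<Rightarrow> 'b::euclidean_space"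
  assumes "f \<in> Lp p \<Omega>"
  shows "(\<lambda>x. a *\<^sub>R f x) \<in> Lp p \<Omega>"
  using assms by (auto simp: Lp_def powr_mult)

lemma has_weak_gradient_scale:
  assumes "has_weak_gradient u g \<Omega>"
  shows "has_weak_gradient (\<lambda>x. a * u x) (\<lambda>x. a *\<^sub>R g x) \<Omega>"
  using assms by (auto simp: has_weak_gradient_def mult.assoc)

lemma admissible_scale:
  assumes "(u, g) \<in> admissible p \<Omega>" "a \<noteq> 0"
  shows "((\<lambda>x. a * u x), (\<lambda>x. a *\<^sub>R g x)) \<in> admissible p \<Omega>"
  using assms Lp_scaleR[of u p \<Omega> a] Lp_scaleR[of g p \<Omega> a] has_weak_gradient_scale[of u g \<Omega> a]
  by (auto simp: admissible_def sobolev_def intro!: continuous_intros)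

lemma Lp_integrable:
  fixes f :: "'a::euclidean_space \<Rightarrow> 'b::euclidean_space"
  assumes "open \<Omega>" "bounded \<Omega>" "f \<in> Lp p \<Omega>" "1 \<le> p"
  shows "integrable (lebesgue_on \<Omega>) f"
proof (rule Bochner_Integration.integrable_bound)
  show "integrable (lebesgue_on \<Omega>) (\<lambda>x. 1 + norm (f x) powr p)"
  proof (rule Bochner_Integration.integrable_add)
    show "integrable (lebesgue_on \<Omega>) (\<lambda>x. 1 :: real)"
      using assms by (intro integrable_continuous_bounded) auto
  qed (use assms in \<open>simp add: Lp_def\<close>)
  show "AE x in lebesgue_on \<Omega>. norm (f x) \<le> norm (1 + norm (f x) powr p)"
    using le_add_powr_split[of "norm (f x)" 1 p for x] assms(4) by (auto simp: abs_of_nonneg)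
qed (use assms in \<open>auto simp: Lp_def\<close>)

lemma Lp_minus_const:
  fixes u :: "'a::euclidean_space \<Rightarrow> real"
  assumes "open \<Omega>" "bounded \<Omega>" "u \<in> Lp p \<Omega>" "1 \<le> p"
  shows "(\<lambda>x. u x - c) \<in> Lp p \<Omega>"
proof -
  have meas: "u \<in> borel_measurable (lebesgue_on \<Omega>)" using assms by (simp add: Lp_def)
  have "integrable (lebesgue_on \<Omega>) (\<lambda>x. norm (u x - c) powr p)"
  proof (rule Bochner_Integration.integrable_bound)
    show "integrable (lebesgue_on \<Omega>) (\<lambda>x. 2 powr p * norm (u x) powr p + 2 powr p * \<bar>c\<bar> powr p)"
    proof (rule Bochner_Integration.integrable_add)
      show "integrable (lebesgue_on \<Omega>) (\<lambda>x. 2 powr p * \<bar>c\<bar> powr p)"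
        using assms by (intro integrable_continuous_bounded) auto
    qed (use assms in \<open>simp add: Lp_def\<close>)
    have "\<bar>u x - c\<bar> powr p \<le> 2 powr p * \<bar>u x\<bar> powr p + 2 powr p * \<bar>c\<bar> powr p" for x
      using abs_powr_le_powr_diff[of 1 p "u x - c" "- c"] assms(4) by simp
    then show "AE x in lebesgue_on \<Omega>. norm (norm (u x - c) powr p)
        \<le> norm (2 powr p * norm (u x) powr p + 2 powr p * \<bar>c\<bar> powr p)"
      by (auto simp: abs_of_nonneg)
  qed (use meas in measurable)
  then show ?thesis using meas by (simp add: Lp_def)
qed

text \<open>Splitting the integral against a derivative of \<phi> requires both parts to be
  integrable: u is, as \<Omega> is bounded, and derivatives of test functions are bounded and
  measurable.\<close>

lemma has_weak_gradient_minus_const: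
  fixes u :: "'a::euclidean_space \<Rightarrow> real"
  assumes \<Omega>: "open \<Omega>" "bounded \<Omega>" and u: "u \<in> Lp p \<Omega>" "1 \<le> p" and w: "has_weak_gradient u g \<Omega>"
  shows "has_weak_gradient (\<lambda>x. u x - c) g \<Omega>"
proof -
  have w0: "has_weak_gradient (\<lambda>x. c) (\<lambda>_. 0) \<Omega>" using has_weak_gradient_affine[OF \<Omega>(1), of 0 c] by simp
  show ?thesis
    unfolding has_weak_gradient_def
  proof (intro conjI allI impI ballI)
    fix K assume K: "compact K \<and> K \<subseteq> \<Omega>"
    then show "integrable (lebesgue_on K) (\<lambda>x. u x - c)" "integrable (lebesgue_on K) g"
      using w w0 by (auto simp: has_weak_gradient_def intro!: Bochner_Integration.integrable_diff)
  next
    fix \<phi> and b :: 'a assume phi: "\<phi> \<in> test_functions \<Omega>" and b: "b \<in> Basis"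
    define D where "D x = frechet_derivative \<phi> (at x) b" for x
    have cD: "continuous_on UNIV D" unfolding D_def using test_function_continuous_on[OF phi] b by blast
    have D0: "D x = 0" if "x \<notin> closure {x. \<phi> x \<noteq> 0}" for x
      using frechet_derivative_eq_0_outside_closure[OF that] by (simp add: D_def)
    have "compact (closure {x. \<phi> x \<noteq> 0})" using phi by (simp add: test_functions_def)
    then have "bounded (D ` closure {x. \<phi> x \<noteq> 0})"
      by (intro compact_imp_bounded compact_continuous_image continuous_on_subset[OF cD]) auto
    then obtain B where B: "\<And>x. x \<in> closure {x. \<phi> x \<noteq> 0} \<Longrightarrow> norm (D x) \<le> B" by (auto simp: bounded_iff)
    then have DB: "norm (D x) \<le> max B 0" for x using D0 by (cases "x \<in> closure {x. \<phi> x \<noteq> 0}") (auto simp: le_max_iff_disj)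
    have mD: "D \<in> borel_measurable (lebesgue_on \<Omega>)"
      using \<Omega> by (intro continuous_imp_measurable_on_sets_lebesgue continuous_on_subset[OF cD]) auto
    have int: "integrable (lebesgue_on \<Omega>) (\<lambda>x. f x * D x)" if f: "integrable (lebesgue_on \<Omega>) f" for f
    proof (rule Bochner_Integration.integrable_bound)
      show "integrable (lebesgue_on \<Omega>) (\<lambda>x. max B 0 * norm (f x))"
        by (intro integrable_mult_right integrable_norm f)
      show "(\<lambda>x. f x * D x) \<in> borel_measurable (lebesgue_on \<Omega>)"
        using mD borel_measurable_integrable[OF f] by measurable
      have "norm (f x * D x) \<le> norm (max B 0 * norm (f x))" for x
        using mult_right_mono[OF DB[of x], of "norm (f x)"] by (simp add: abs_mult mult.commute)
      then show "AE x in lebesgue_on \<Omega>. norm (f x * D x) \<le> norm (max B 0 * norm (f x))" by simp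
    qed
    have ic: "integrable (lebesgue_on \<Omega>) (\<lambda>x. c)"
      using \<Omega> by (intro integrable_continuous_bounded) auto
    have "(LINT x|lebesgue_on \<Omega>. (u x - c) * D x) = (LINT x|lebesgue_on \<Omega>. u x * D x - c * D x)"
      by (simp add: left_diff_distrib)
    also have "\<dots> = (LINT x|lebesgue_on \<Omega>. u x * D x) - (LINT x|lebesgue_on \<Omega>. c * D x)"
      by (intro Bochner_Integration.integral_diff int Lp_integrable[OF \<Omega> u] ic)
    also have "(LINT x|lebesgue_on \<Omega>. c * D x) = 0"
    proof -
      have "(LINT x|lebesgue_on \<Omega>. c * frechet_derivative \<phi> (at x) b) = - (LINT x|lebesgue_on \<Omega>. (0 \<bullet> b) * \<phi> x)"
        using w0 phi b unfolding has_weak_gradient_def by blast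
      then show ?thesis by (simp add: D_def)
    qed
    finally show "(LINT x|lebesgue_on \<Omega>. (u x - c) * frechet_derivative \<phi> (at x) b) =
        - (LINT x|lebesgue_on \<Omega>. (g x \<bullet> b) * \<phi> x)"
      using w phi b by (simp add: has_weak_gradient_def D_def)
  qed
qed

text \<open>An infimum of reals over the empty set says nothing, so a competitor must be exhibited.
  A coordinate function shifted to vanish at \<open>y\<close> is zero only on a hyperplane, which
  cannot fill a nonempty open set up to a null set.\<close>

lemma admissible_vanishing_exists:
  fixes \<Omega> :: "'a::euclidean_space set"
  assumes \<Omega>: "open \<Omega>" "bounded \<Omega>" "\<Omega> \<noteq> {}" and p: "0 < p"
  obtains u g where "(u, g) \<in> admissible p \<Omega>" "u y = 0"
proof -
  obtain b :: 'a where b: "b \<in> Basis" using nonempty_Basis by blast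
  define u where "u x = x \<bullet> b + - (y \<bullet> b)" for x
  have cu: "continuous_on S u" for S unfolding u_def by (intro continuous_intros)
  have Lp: "f \<in> Lp p \<Omega>" if "continuous_on UNIV f" for f :: "'a \<Rightarrow> 'c::euclidean_space"
  proof -
    have "f \<in> borel_measurable (lebesgue_on \<Omega>)"
      using \<Omega> by (intro continuous_imp_measurable_on_sets_lebesgue continuous_on_subset[OF that]) auto
    moreover have "integrable (lebesgue_on \<Omega>) (\<lambda>x. norm (f x) powr p)"
      using \<Omega> that p by (intro integrable_continuous_bounded continuous_on_powr' continuous_intros) auto
    ultimately show ?thesis by (simp add: Lp_def)
  qed
  have "\<not> (AE x in lebesgue_on \<Omega>. u x = 0)"
  proof
    assume "AE x in lebesgue_on \<Omega>. u x = 0"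
    then obtain N where N: "N \<in> null_sets (lebesgue_on \<Omega>)" "\<Omega> - {x. u x = 0} \<subseteq> N"
      by (auto simp: eventually_ae_filter)
    then have "negligible N"
      using \<Omega>(1) by (auto simp: negligible_iff_null_sets null_sets_restrict_space)
    then have "negligible (N \<union> {x. b \<bullet> x = y \<bullet> b})"
      using b by (intro negligible_Un negligible_hyperplane) auto
    moreover have "\<Omega> \<subseteq> N \<union> {x. b \<bullet> x = y \<bullet> b}"
      using N(2) by (auto simp: u_def inner_commute)
    ultimately have "negligible \<Omega>" by (rule negligible_subset)
    with \<Omega>(1,3) open_not_negligible show False by blast
  qed
  then have "(u, \<lambda>_. b) \<in> admissible p \<Omega>"
    using has_weak_gradient_affine[OF \<Omega>(1), of b "- (y \<bullet> b)"] Lp[OF cu] Lp[of "\<lambda>_. b"] cu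
    by (simp add: admissible_def sobolev_def u_def[abs_def])
  then show ?thesis by (rule that) (simp add: u_def)
qed

text \<open>The second claim supplies the lower bound for the infimum over weights in
  \<open>lambda_opt\<close>.\<close>

lemma ell1_le_quotient:
  assumes \<sigma>: "AE x in boundary_measure \<Omega>. 0 \<le> \<sigma> x" and ug: "(u, g) \<in> admissible p \<Omega>"
  shows "ell1 p \<sigma> \<Omega> \<le> ((LINT x|lebesgue_on \<Omega>. norm (g x) powr p)
      + (LINT x|boundary_measure \<Omega>. \<sigma> x * \<bar>u x\<bar> powr p)) / (LINT x|lebesgue_on \<Omega>. \<bar>u x\<bar> powr p)"
    and "0 \<le> ell1 p \<sigma> \<Omega>"
proof -
  let ?Q = "\<lambda>(u, g). ((LINT x|lebesgue_on \<Omega>. norm (g x) powr p)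
      + (LINT x|boundary_measure \<Omega>. \<sigma> x * \<bar>u x\<bar> powr p)) / (LINT x|lebesgue_on \<Omega>. \<bar>u x\<bar> powr p)"
  have nn: "0 \<le> ?Q q" for q
  proof (cases q)
    case (Pair u g)
    have "0 \<le> (LINT x|boundary_measure \<Omega>. \<sigma> x * \<bar>u x\<bar> powr p)"
      using \<sigma> by (intro integral_nonneg_AE) auto
    moreover have "0 \<le> (LINT x|lebesgue_on \<Omega>. norm (g x) powr p)"
      by (intro Bochner_Integration.integral_nonneg) auto
    ultimately show ?thesis using Pair lebesgue_integral_powr_nonneg[of "lebesgue_on \<Omega>" u p] by simp
  qed
  have "bdd_below (?Q ` admissible p \<Omega>)" using nn by (intro bdd_belowI[of _ 0]) auto
  from cINF_lower[OF this ug] show "ell1 p \<sigma> \<Omega> \<le> ((LINT x|lebesgue_on \<Omega>. norm (g x) powr p)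
      + (LINT x|boundary_measure \<Omega>. \<sigma> x * \<bar>u x\<bar> powr p)) / (LINT x|lebesgue_on \<Omega>. \<bar>u x\<bar> powr p)"
    by (simp add: ell1_def)
  show "0 \<le> ell1 p \<sigma> \<Omega>"
    unfolding ell1_def using ug nn by (intro cINF_greatest) auto
qed

text \<open>The mass t is spread evenly over a patch around y on which |u|^p \<le> \<eta>, by
  continuity and \<open>u y = 0\<close>; the boundary term is then at most \<eta> t.\<close>

lemma lambda_opt_le_quotient:
  fixes \<Omega> :: "'a::euclidean_space set"
  assumes \<Omega>: "open \<Omega>" "C1_holder_boundary \<epsilon> \<Omega>" "0 < \<epsilon>" and y: "y \<in> frontier \<Omega>"
    and ug: "(u, g) \<in> admissible p \<Omega>" "u y = 0" and t: "0 < t" and p: "0 < p"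
  shows "lambda_opt p t \<Omega> \<le> (LINT x|lebesgue_on \<Omega>. norm (g x) powr p) / (LINT x|lebesgue_on \<Omega>. \<bar>u x\<bar> powr p)"
proof (rule field_le_epsilon)
  fix e :: real assume e: "0 < e"
  let ?N = "LINT x|lebesgue_on \<Omega>. \<bar>u x\<bar> powr p" and ?G = "LINT x|lebesgue_on \<Omega>. norm (g x) powr p"
  let ?H = "hausdorff_measure (DIM('a) - 1) :: 'a measure"
  have N: "0 < ?N" by (rule admissible_pos[OF ug(1)])
  \<comment> \<open>So that \<eta> t divided by the denominator is the permitted error
    \<open>e\<close>.\<close>
  define \<eta> where "\<eta> = e * ?N / t"
  have \<eta>: "0 < \<eta>" using e N t by (simp add: \<eta>_def)
  obtain e0 r \<Lambda> \<gamma> where "lipschitz_epigraph \<Omega> y e0 r \<Lambda> \<gamma>"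
    by (rule C1_holder_boundary_lipschitz_epigraph[OF \<Omega> y])
  then interpret lipschitz_epigraph \<Omega> y e0 r \<Lambda> \<gamma> .
  have "continuous_on (closure \<Omega>) u" using ug by (simp add: admissible_def)
  moreover have ycl: "y \<in> closure \<Omega>" using y by (simp add: frontier_def)
  moreover have "0 < \<eta> powr (1 / p)" using \<eta> by simp
  ultimately obtain d where d: "0 < d" "\<And>x. x \<in> closure \<Omega> \<Longrightarrow> dist x y < d \<Longrightarrow> dist (u x) (u y) < \<eta> powr (1 / p)"
    unfolding continuous_on_iff by metis
  \<comment> \<open>\<open>d\<close> makes u small, and \<open>r\<close> keeps the patch in the
    chart, where its measure is finite.\<close>
  define A where "A = frontier \<Omega> \<inter> ball y (min d r)"
  have A: "A \<in> sets borel" "A \<subseteq> frontier \<Omega>" by (auto simp: A_def frontier_closed borel_closed)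
  have uA: "\<bar>u x\<bar> powr p \<le> \<eta>" if "x \<in> A" for x
  proof -
    have "x \<in> closure \<Omega>" "dist x y < d" using that by (auto simp: A_def frontier_def dist_commute)
    then have "\<bar>u x\<bar> \<le> \<eta> powr (1 / p)" using d(2) ug(2) by (fastforce simp: dist_real_def)
    then have "\<bar>u x\<bar> powr p \<le> (\<eta> powr (1 / p)) powr p" using p by (intro powr_mono2) auto
    then show ?thesis using p \<eta> by (simp add: powr_powr)
  qed
  have HA: "emeasure ?H A = hausdorff_outer (DIM('a) - 1) A"
    using A(1) by (rule emeasure_hausdorff_measure)
  have "0 < emeasure ?H A"
    unfolding HA unfolding A_def using y r_pos d(1) by (intro hausdorff_outer_frontier_pos) auto
  moreover have "emeasure ?H A < \<infinity>"
  proof -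
    have "emeasure ?H A \<le> emeasure ?H (frontier \<Omega> \<inter> ball y r)"
      by (intro emeasure_mono) (auto simp: A_def frontier_closed borel_closed)
    also have "\<dots> = hausdorff_outer (DIM('a) - 1) (frontier \<Omega> \<inter> ball y r)"
      by (intro emeasure_hausdorff_measure) (auto simp: frontier_closed borel_closed)
    also have "\<dots> < \<infinity>" by (rule hausdorff_outer_frontier_finite)
    finally show ?thesis .
  qed
  ultimately have mA: "0 < measure ?H A" "emeasure ?H A < \<infinity>"
    by (auto simp: measure_def enn2real_positive_iff)
  have fr: "frontier \<Omega> \<inter> space ?H \<in> sets ?H" by (simp add: frontier_closed borel_closed)
  have sp: "space (boundary_measure \<Omega>) = frontier \<Omega>"
    by (simp add: boundary_measure_def space_restrict_space)
  have Ab: "A \<in> sets (boundary_measure \<Omega>)"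
    using A fr by (auto simp: boundary_measure_def sets_restrict_space_iff)
  have eA: "emeasure (boundary_measure \<Omega>) A = emeasure ?H A"
    using A fr by (simp add: boundary_measure_def emeasure_restrict_space)
  define \<sigma> where "\<sigma> x = t / measure ?H A * indicator A x" for x
  have \<sigma>0: "0 \<le> \<sigma> x" for x using t mA by (simp add: \<sigma>_def)
  have intA: "integrable (boundary_measure \<Omega>) (indicator A :: 'a \<Rightarrow> real)"
    using Ab eA mA(2) by (intro integrable_real_indicator) auto
  have int\<sigma>: "integrable (boundary_measure \<Omega>) \<sigma>"
    unfolding \<sigma>_def by (intro integrable_mult_right intA)
  have L\<sigma>: "(LINT x|boundary_measure \<Omega>. \<sigma> x) = t"
  proof -
    have "measure (boundary_measure \<Omega>) A = measure ?H A" using eA by (simp add: measure_def)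
    then show ?thesis
      unfolding \<sigma>_def using Ab mA sp A(2) by (simp add: Int_absorb2)
  qed
  have "\<sigma> \<in> Sigma_m t \<Omega>" using int\<sigma> L\<sigma> \<sigma>0 by (simp add: Sigma_m_def)
  moreover have "bdd_below ((\<lambda>\<sigma>. ell1 p \<sigma> \<Omega>) ` Sigma_m t \<Omega>)"
    using ell1_le_quotient(2)[OF _ ug(1)] by (intro bdd_belowI[of _ 0]) (auto simp: Sigma_m_def)
  ultimately have "lambda_opt p t \<Omega> \<le> ell1 p \<sigma> \<Omega>"
    unfolding lambda_opt_def by (intro cINF_lower)
  also have "\<dots> \<le> (?G + (LINT x|boundary_measure \<Omega>. \<sigma> x * \<bar>u x\<bar> powr p)) / ?N"
    using \<sigma>0 by (intro ell1_le_quotient(1) ug) simp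
  also have "\<dots> \<le> (?G + \<eta> * t) / ?N"
  proof (intro divide_right_mono add_left_mono)
    have "\<bar>LINT x|boundary_measure \<Omega>. \<sigma> x * \<bar>u x\<bar> powr p\<bar> \<le> (LINT x|boundary_measure \<Omega>. \<eta> * \<sigma> x)"
    proof (rule integral_abs_le_integral)
      show "integrable (boundary_measure \<Omega>) (\<lambda>x. \<eta> * \<sigma> x)" by (intro integrable_mult_right int\<sigma>)
      fix x
      have "\<sigma> x * \<bar>u x\<bar> powr p \<le> \<sigma> x * \<eta>"
      proof (cases "x \<in> A")
        case True then show ?thesis using uA \<sigma>0 by (intro mult_left_mono)
      qed (simp add: \<sigma>_def)
      then show "\<bar>\<sigma> x * \<bar>u x\<bar> powr p\<bar> \<le> \<eta> * \<sigma> x" using \<sigma>0[of x] by (simp add: abs_mult mult.commute)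
    qed
    then show "(LINT x|boundary_measure \<Omega>. \<sigma> x * \<bar>u x\<bar> powr p) \<le> \<eta> * t" using L\<sigma> by simp
  qed (use N in simp)
  also have "\<dots> = ?G / ?N + e" using N t by (simp add: \<eta>_def add_divide_distrib)
  finally show "lambda_opt p t \<Omega> \<le> ?G / ?N + e" .
qed

lemma lambda1_le_quotient:
  assumes "(u, g) \<in> admissible p \<Omega>" "u x = 0"
  shows "lambda1 p x \<Omega> \<le> (LINT y|lebesgue_on \<Omega>. norm (g y) powr p) / (LINT y|lebesgue_on \<Omega>. \<bar>u y\<bar> powr p)"
proof -
  let ?Q = "\<lambda>(u, g). (LINT y|lebesgue_on \<Omega>. norm (g y) powr p) / (LINT y|lebesgue_on \<Omega>. \<bar>u y\<bar> powr p)"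
  let ?S = "{(u, g) \<in> admissible p \<Omega>. u x = 0}"
  have "bdd_below (?Q ` ?S)"
    by (intro bdd_belowI[of _ 0])
       (auto intro!: divide_nonneg_nonneg lebesgue_integral_powr_nonneg Bochner_Integration.integral_nonneg)
  from cINF_lower[OF this, of "(u, g)"] assms show ?thesis by (simp add: lambda1_def)
qed

lemma le_lambda1:
  fixes \<Omega> :: "'a::euclidean_space set"
  assumes "open \<Omega>" "bounded \<Omega>" "\<Omega> \<noteq> {}" "0 < p"
    and "\<And>u g. (u, g) \<in> admissible p \<Omega> \<Longrightarrow> u x = 0 \<Longrightarrow>
      a \<le> (LINT y|lebesgue_on \<Omega>. norm (g y) powr p) / (LINT y|lebesgue_on \<Omega>. \<bar>u y\<bar> powr p)"
  shows "a \<le> lambda1 p x \<Omega>"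
proof -
  obtain u g where "(u, g) \<in> admissible p \<Omega>" "u x = 0"
    using admissible_vanishing_exists[OF assms(1-4), of x] by blast
  then show ?thesis
    unfolding lambda1_def using assms(5) by (intro cINF_greatest) auto
qed

lemma ell1_dirac_less_quotient:
  assumes "ell1_dirac p t x \<Omega> < M" "admissible p \<Omega> \<noteq> {}" "0 \<le> t"
  obtains u g where "(u, g) \<in> admissible p \<Omega>"
    "((LINT y|lebesgue_on \<Omega>. norm (g y) powr p) + t * \<bar>u x\<bar> powr p)
      / (LINT y|lebesgue_on \<Omega>. \<bar>u y\<bar> powr p) < M"
proof -
  obtain z where "z \<in> (\<lambda>(u, g). ((LINT y|lebesgue_on \<Omega>. norm (g y) powr p) + t * \<bar>u x\<bar> powr p)
      / (LINT y|lebesgue_on \<Omega>. \<bar>u y\<bar> powr p)) ` admissible p \<Omega>" "z < M"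
    using cInf_lessD[OF _ assms(1)[unfolded ell1_dirac_def]] assms(2) by blast
  then show ?thesis using that by auto
qed

text \<open>The quotient is invariant under scaling. With the denominator equal to 1, a single
  inequality bounds both the gradient energy and the boundary penalty.\<close>

lemma ell1_dirac_less_normalized:
  assumes "ell1_dirac p t x \<Omega> < M" "admissible p \<Omega> \<noteq> {}" "0 \<le> t" "0 < p"
  obtains u g where "(u, g) \<in> admissible p \<Omega>" "(LINT y|lebesgue_on \<Omega>. \<bar>u y\<bar> powr p) = 1"
    "(LINT y|lebesgue_on \<Omega>. norm (g y) powr p) + t * \<bar>u x\<bar> powr p < M"
proof -
  obtain u g where ug: "(u, g) \<in> admissible p \<Omega>"
    and lt: "((LINT y|lebesgue_on \<Omega>. norm (g y) powr p) + t * \<bar>u x\<bar> powr p)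
      / (LINT y|lebesgue_on \<Omega>. \<bar>u y\<bar> powr p) < M"
    using ell1_dirac_less_quotient[OF assms(1-3)] by blast
  define N where "N = (LINT y|lebesgue_on \<Omega>. \<bar>u y\<bar> powr p)"
  have N: "0 < N" unfolding N_def by (rule admissible_pos[OF ug])
  define a where "a = (1 / N) powr (1 / p)"
  have a: "0 < a" "a powr p = 1 / N" using N assms(4) by (auto simp: a_def powr_powr)
  show ?thesis
  proof (rule that)
    show "((\<lambda>y. a * u y), (\<lambda>y. a *\<^sub>R g y)) \<in> admissible p \<Omega>"
      using ug a(1) by (intro admissible_scale) auto
    have abs: "\<bar>a * v\<bar> powr p = \<bar>v\<bar> powr p / N" for v :: real
      using a by (simp add: abs_mult powr_mult)
    show "(LINT y|lebesgue_on \<Omega>. \<bar>a * u y\<bar> powr p) = 1"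
      unfolding abs using N by (simp add: N_def)
    have "norm (a *\<^sub>R g y) powr p = norm (g y) powr p / N" for y
      using a by (simp add: powr_mult)
    then have "(LINT y|lebesgue_on \<Omega>. norm (a *\<^sub>R g y) powr p) = (LINT y|lebesgue_on \<Omega>. norm (g y) powr p) / N"
      by simp
    then show "(LINT y|lebesgue_on \<Omega>. norm (a *\<^sub>R g y) powr p) + t * \<bar>a * u x\<bar> powr p < M"
      using lt unfolding abs N_def[symmetric] by (simp add: add_divide_distrib)
  qed
qed

section \<open>Passage to the limit along the optimal points\<close>

theorem proposition4p2:
  fixes \<Omega> :: "'a::euclidean_space set" and p \<epsilon> :: real
    and x :: "real \<Rightarrow> 'a" and m :: "nat \<Rightarrow> real" and xbar :: 'a
  assumes "open \<Omega>" and "connected \<Omega>" and "\<Omega> \<noteq> {}" and "bounded \<Omega>"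
    and "0 < \<epsilon>" and "\<epsilon> \<le> 1" and "C1_holder_boundary \<epsilon> \<Omega>"
    and "1 < p" and "real DIM('a) < p"
    and "\<And>t. t > 0 \<Longrightarrow> x t \<in> frontier \<Omega>"
    and "\<And>t. t > 0 \<Longrightarrow> lambda_opt p t \<Omega> = ell1_dirac p t (x t) \<Omega>"
    and "\<And>k. m k > 0" and "filterlim m at_top sequentially"
    and "(\<lambda>k. x (m k)) \<longlonglongrightarrow> xbar"
  shows "xbar \<in> frontier \<Omega> \<and> (\<forall>y \<in> frontier \<Omega>. lambda1 p xbar \<Omega> \<le> lambda1 p y \<Omega>)"
proof (intro conjI ballI)
  note \<Omega> = assms(1,4)
  have xk: "x (m k) \<in> frontier \<Omega>" for k using assms(10,12) by blast
  show xbar: "xbar \<in> frontier \<Omega>"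
    by (rule closed_sequentially[OF frontier_closed _ assms(14)]) (rule xk)
  have adm: "admissible p \<Omega> \<noteq> {}"
    using admissible_vanishing_exists[OF assms(1,4,3), of p] assms(8)
    by (metis empty_iff less_trans zero_less_one)
  fix y assume y: "y \<in> frontier \<Omega>"
  have opt_le: "lambda_opt p t \<Omega> \<le> lambda1 p y \<Omega>" if "0 < t" for t
    using assms(8) that
    by (intro le_lambda1[OF assms(1,4,3)] lambda_opt_le_quotient[OF assms(1,7,5) y]) auto
  have main: "lambda1 p xbar \<Omega> \<le> (lambda1 p y \<Omega> + \<theta>) * (1 + \<theta>) powr p / (1 - \<theta>)"
    if \<theta>: "0 < \<theta>" "\<theta> < 1" for \<theta>
  proof -
    define M where "M = lambda1 p y \<Omega> + \<theta>"
    define V where "V = measure lebesgue \<Omega>"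
    define B where "B = (1 + 1 / \<theta>) powr p * (V + 1)"
    have V0: "0 \<le> V" by (simp add: V_def)
    have "0 < 1 + 1 / \<theta>" using \<theta>(1) by (simp add: add_pos_pos)
    then have B: "0 < B" using V0 by (simp add: B_def)
    \<comment> \<open>Chosen so that |u(xbar)| \<le> 2 e makes (1 + 1/\<theta>)^p |u(xbar)|^p V at
      most \<theta>; the summand 1 in \<open>B\<close> ensures B > 0 from V \<ge> 0.\<close>
    define e where "e = (\<theta> / B) powr (1 / p) / 2"
    have e: "0 < e" using \<theta> B by (simp add: e_def)
    obtain e0 r \<Lambda> \<gamma> where "lipschitz_epigraph \<Omega> xbar e0 r \<Lambda> \<gamma>"
      by (rule C1_holder_boundary_lipschitz_epigraph[OF assms(1,7,5) xbar])
    then interpret lipschitz_epigraph \<Omega> xbar e0 r \<Lambda> \<gamma> .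
    define X where "X = frontier \<Omega> \<inter> ball xbar (r / 2)"
    \<comment> \<open>The largest cone reaches at most \<open>h0 * (\<Lambda> + 3) = r / 4\<close>,
      below the r / 2 that \<open>cone_subset\<close> allows.\<close>
    define h0 where "h0 = r / 4 / (\<Lambda> + 3)"
    have h0: "0 < h0" using r_pos Lip_nonneg by (simp add: h0_def)
    have cone: "cball (z + s *\<^sub>R ((\<Lambda> + 2) *\<^sub>R e0)) s \<subseteq> \<Omega>" if "z \<in> X" "0 < s" "s \<le> h0" for z s
    proof (rule cone_subset)
      have "s * (\<Lambda> + 3) \<le> h0 * (\<Lambda> + 3)" using that Lip_nonneg by (intro mult_right_mono) auto
      also have "\<dots> = r / 4" unfolding h0_def using Lip_nonneg by (subst nonzero_eq_divide_eq[symmetric]) auto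
      also have "\<dots> < r / 2" using r_pos by simp
      finally show "s * (\<Lambda> + 3) < r / 2" .
    qed (use that in \<open>auto simp: X_def\<close>)
    obtain d where d: "0 < d" and equi: "\<And>u g z. (u, g) \<in> sobolev p \<Omega> \<Longrightarrow> continuous_on (closure \<Omega>) u \<Longrightarrow>
      (LINT y|lebesgue_on \<Omega>. \<bar>u y\<bar> powr p) \<le> 1 \<Longrightarrow>
      (LINT y|lebesgue_on \<Omega>. norm (g y) powr p) \<le> M \<Longrightarrow> z \<in> X \<Longrightarrow> dist z xbar < d \<Longrightarrow>
      \<bar>u z - u xbar\<bar> \<le> e"
    proof (rule sobolev_equicontinuous[OF \<Omega> _ assms(9) h0 _ _ cone e, of xbar])
      show "xbar \<in> X" using xbar r_pos by (simp add: X_def)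
      show "X \<subseteq> closure \<Omega>" by (auto simp: X_def frontier_def)
    qed (use assms(8) in auto)
    have "\<forall>\<^sub>F k in sequentially. dist (x (m k)) xbar < min d (r / 2)"
      using d r_pos by (intro tendstoD[OF assms(14)]) auto
    \<comment> \<open>For \<open>m k\<close> of this size, a value of |u| above e at
      \<open>x (m k)\<close> would make the boundary penalty alone reach M.\<close>
    moreover have "\<forall>\<^sub>F k in sequentially. M / e powr p \<le> m k"
      using assms(13) by (simp add: filterlim_at_top)
    ultimately obtain k where k: "dist (x (m k)) xbar < min d (r / 2)" "M / e powr p \<le> m k"
      using eventually_happens'[OF sequentially_bot eventually_conj] by blast
    have less: "ell1_dirac p (m k) (x (m k)) \<Omega> < M"
      using opt_le[OF assms(12), of k] assms(11)[OF assms(12), of k] \<theta>(1) by (simp add: M_def)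
    obtain u g where ug: "(u, g) \<in> admissible p \<Omega>" and N1: "(LINT y|lebesgue_on \<Omega>. \<bar>u y\<bar> powr p) = 1"
      and lt: "(LINT y|lebesgue_on \<Omega>. norm (g y) powr p) + m k * \<bar>u (x (m k))\<bar> powr p < M"
    proof (rule ell1_dirac_less_normalized[OF less adm])
      show "0 \<le> m k" using assms(12)[of k] by simp
      show "0 < p" using assms(8) by simp
    qed
    let ?G = "LINT y|lebesgue_on \<Omega>. norm (g y) powr p"
    have G0: "0 \<le> ?G" by (intro Bochner_Integration.integral_nonneg) auto
    have "0 \<le> m k * \<bar>u (x (m k))\<bar> powr p" using assms(12)[of k] by simp
    with lt have GM: "?G \<le> M" by linarith
    have uk: "\<bar>u (x (m k))\<bar> \<le> e"
    proof (rule ccontr)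
      assume "\<not> ?thesis"
      then have "e powr p \<le> \<bar>u (x (m k))\<bar> powr p" using e assms(8) by (intro powr_mono2) auto
      then have "m k * e powr p \<le> m k * \<bar>u (x (m k))\<bar> powr p"
        using assms(12)[of k] by (intro mult_left_mono) auto
      moreover have "M \<le> m k * e powr p" using k(2) e by (simp add: pos_divide_le_eq)
      ultimately show False using lt G0 by linarith
    qed
    have "x (m k) \<in> X" using xk k(1) by (simp add: X_def dist_commute)
    then have "\<bar>u (x (m k)) - u xbar\<bar> \<le> e"
      using ug N1 GM k(1) by (intro equi) (auto simp: admissible_def)
    with uk have c: "\<bar>u xbar\<bar> \<le> 2 * e" by linarith
    \<comment> \<open>The shift leaves the weak gradient unchanged, so only the denominator moves:
      the integral of |v|^p is at least (1 - \<theta>) / (1 + \<theta>)^p.\<close>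
    define v where "v z = u z - u xbar" for z
    have vL: "v \<in> Lp p \<Omega>" and vw: "has_weak_gradient v g \<Omega>"
      unfolding v_def using ug assms(8)
      by (auto simp: admissible_def sobolev_def intro!: Lp_minus_const[OF \<Omega>] has_weak_gradient_minus_const[OF \<Omega>])
    define N where "N = (LINT y|lebesgue_on \<Omega>. \<bar>v y\<bar> powr p)"
    have intv: "integrable (lebesgue_on \<Omega>) (\<lambda>y. \<bar>v y\<bar> powr p)" using vL by (simp add: Lp_def)
    have intc: "integrable (lebesgue_on \<Omega>) (\<lambda>y. (1 + 1 / \<theta>) powr p * \<bar>u xbar\<bar> powr p)"
      using \<Omega> by (intro integrable_continuous_bounded) auto
    have "(LINT y|lebesgue_on \<Omega>. \<bar>u y\<bar> powr p) \<le> (LINT y|lebesgue_on \<Omega>. (1 + \<theta>) powr p * \<bar>v y\<bar> powr p + (1 + 1 / \<theta>) powr p * \<bar>u xbar\<bar> powr p)"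
    proof (rule integral_mono)
      show "integrable (lebesgue_on \<Omega>) (\<lambda>y. \<bar>u y\<bar> powr p)"
        using ug by (simp add: admissible_def sobolev_def Lp_def)
      show "integrable (lebesgue_on \<Omega>) (\<lambda>y. (1 + \<theta>) powr p * \<bar>v y\<bar> powr p + (1 + 1 / \<theta>) powr p * \<bar>u xbar\<bar> powr p)"
        by (intro Bochner_Integration.integrable_add integrable_mult_right intv intc)
      show "\<bar>u z\<bar> powr p \<le> (1 + \<theta>) powr p * \<bar>v z\<bar> powr p + (1 + 1 / \<theta>) powr p * \<bar>u xbar\<bar> powr p" for z
        unfolding v_def using \<theta> assms(8) by (intro abs_powr_le_powr_diff) auto
    qed
    also have "\<dots> = (1 + \<theta>) powr p * N + (1 + 1 / \<theta>) powr p * \<bar>u xbar\<bar> powr p * V"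
      using intv intc \<Omega>
      by (simp add: N_def V_def measure_restrict_space space_restrict_space mult.commute)
    also have "(1 + 1 / \<theta>) powr p * \<bar>u xbar\<bar> powr p * V \<le> \<theta>"
    proof -
      have "\<bar>u xbar\<bar> powr p \<le> (2 * e) powr p" using c assms(8) by (intro powr_mono2) auto
      also have "\<dots> = \<theta> / B" using \<theta> B assms(8) by (simp add: e_def powr_powr)
      finally have "(1 + 1 / \<theta>) powr p * \<bar>u xbar\<bar> powr p * V \<le> (1 + 1 / \<theta>) powr p * (\<theta> / B) * (V + 1)"
        using V0 \<theta> B by (intro mult_mono) auto
      also have "\<dots> = B * (\<theta> / B)" by (simp add: B_def)
      finally show ?thesis using B by simp
    qed
    finally have N: "1 - \<theta> \<le> (1 + \<theta>) powr p * N" using N1 by simp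
    have "N \<noteq> 0" using N \<theta> by auto
    then have "\<not> (AE z in lebesgue_on \<Omega>. v z = 0)"
      unfolding N_def using integral_nonneg_eq_0_iff_AE[OF intv] by auto
    moreover have "continuous_on (closure \<Omega>) v"
      unfolding v_def using ug by (intro continuous_intros) (simp add: admissible_def)
    ultimately have vadm: "(v, g) \<in> admissible p \<Omega>"
      using vL vw ug by (simp add: admissible_def sobolev_def)
    have N0: "0 < N" unfolding N_def by (rule admissible_pos[OF vadm])
    have "lambda1 p xbar \<Omega> \<le> ?G / N"
      unfolding N_def by (rule lambda1_le_quotient[OF vadm]) (simp add: v_def)
    also have "\<dots> \<le> M / N" using GM N0 by (intro divide_right_mono) auto
    also have "\<dots> \<le> M * (1 + \<theta>) powr p / (1 - \<theta>)"
    proof -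
      have "0 \<le> M" using G0 GM by linarith
      then have "M * (1 - \<theta>) \<le> M * ((1 + \<theta>) powr p * N)" by (rule mult_left_mono[OF N])
      then show ?thesis using N0 \<theta> by (simp add: field_simps)
    qed
    finally show ?thesis by (simp add: M_def)
  qed
  have "((\<lambda>\<theta>. (lambda1 p y \<Omega> + \<theta>) * (1 + \<theta>) powr p / (1 - \<theta>)) \<longlongrightarrow>
      (lambda1 p y \<Omega> + 0) * (1 + 0) powr p / (1 - 0)) (at_right 0)"
    by (intro tendsto_intros) auto
  then have "((\<lambda>\<theta>. (lambda1 p y \<Omega> + \<theta>) * (1 + \<theta>) powr p / (1 - \<theta>)) \<longlongrightarrow> lambda1 p y \<Omega>) (at_right 0)"
    by simp
  moreover have "\<forall>\<^sub>F \<theta> in at_right 0. lambda1 p xbar \<Omega> \<le> (lambda1 p y \<Omega> + \<theta>) * (1 + \<theta>) powr p / (1 - \<theta>)"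
    using eventually_at_right_real[of 0 1] by (auto elim!: eventually_mono intro: main)
  ultimately show "lambda1 p xbar \<Omega> \<le> lambda1 p y \<Omega>"
    by (intro tendsto_lowerbound[where F = "at_right 0"]) auto
qed

end
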